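(* Let $n\ge2$ and let $q$ be a prime power. For $d\ge1$ let $N_d$ be the number of polynomials of degree $d$ in $\mathbb F_q[x_1,\dots,x_n]$, and let $I_d$ (resp. $D_d$) be the number of those that are indecomposable (resp. decomposable) in $\mathbb F_q[x_1,\dots,x_n]$. (a) $I_d/N_d$ tends to $1$ in the two situations where $d\to\infty$ with $q$ fixed, and where $q\to\infty$ with $d$ fixed. (b) If $d$ is a product of at most $2$ prime numbers $p\le p'$, then - $d=p$ and $D_d=q^d(q^n-1)$, or - $d=p^2$ and $D_d=q^{p-1}N_p+(q^d-q^{2p-1})(q^n-1)$, or - $d=pp'$ with $p<p'$ and $D_d=q^{p-1}N_{p'}+q^{p'-1}N_p+(q^d-2q^{p+p'-1})(q^n-1)$. (c) Assume $n=2$. If $d$ is the product of at least $3$ prime numbers, then $$\left|\frac{D_d}{N_d}-\alpha_d\right|\le\alpha_d\,\beta_d,\qquad\text{where}\quad \alpha_d=\frac{q^{\ell-1+\frac12\left(\frac d\ell+1\right)\left(\frac d\ell+2\right)}}{q^{\frac12(d+1)(d+2)}},\qquad \beta_d=\frac{d}{q^{d/\ell}},$$ and $\ell>1$ is the first (hence prime) divisor of $d$.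
   Context: For $n\ge2$ and a field $L$, a non-constant polynomial $F\in L[x_1,\dots,x_n]$ is indecomposable if it is not of the form $u(H)$ with $H\in L[x_1,\dots,x_n]$, $u\in L[t]$ and $\deg u\ge2$; otherwise it is decomposable. Degree means total degree. Thus $N_d=I_d+D_d$, and $N_d=\left(q^{\binom{n+d-1}{n-1}}-1\right)q^{\binom{n+d-1}{n}}$. The number $n$ is fixed. "Product of at least 3 primes" means at least three prime factors counted with multiplicity; "first divisor $\ell>1$" means the smallest divisor of $d$ greater than $1$. *)

theory Defs
  imports
    "HOL-Algebra.UnivPoly"
    "HOL-Algebra.Indexed_Polynomials"
    "HOL-Number_Theory.Prime_Powers"
    Complex_Main
begin

text \<open>
  The limit for growing \<open>q\<close> ranges over fields of varying characteristic, so fields are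
  carrier-based structures rather than types.  A polynomial in \<open>x\<^sub>0, \<dots>, x\<^bsub>n-1\<^esub>\<close> is an indexed
  polynomial of \<open>HOL-Algebra\<close>: it maps a monomial, i.e. a multiset of variables, to its
  coefficient.  That theory provides carrier, addition and constants; the convolution product is
  supplied here.
\<close>

definition mpoly_ring :: "'a ring \<Rightarrow> nat \<Rightarrow> (nat multiset \<Rightarrow> 'a) ring" where
  "mpoly_ring K n = \<lparr>
     carrier = ring.indexed_pset K {..<n} (carrier K),
     monoid.mult = (\<lambda>P Q m. \<Oplus>\<^bsub>K\<^esub>a \<in> {a. a \<subseteq># m}. P a \<otimes>\<^bsub>K\<^esub> Q (m - a)),
     one = ring.indexed_const K \<one>\<^bsub>K\<^esub>,
     zero = ring.indexed_const K \<zero>\<^bsub>K\<^esub>,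
     add = ring.indexed_padd K\<rparr>"

text \<open>The zero polynomial gets total degree \<open>0\<close>.\<close>

definition total_degree :: "'a ring \<Rightarrow> (nat multiset \<Rightarrow> 'a) \<Rightarrow> nat" where
  "total_degree K P = Max (insert 0 (size ` {m. P m \<noteq> \<zero>\<^bsub>K\<^esub>}))"

definition poly_subst :: "'a ring \<Rightarrow> nat \<Rightarrow> (nat \<Rightarrow> 'a) \<Rightarrow> (nat multiset \<Rightarrow> 'a) \<Rightarrow> (nat multiset \<Rightarrow> 'a)" where
  "poly_subst K n u H = UnivPoly.eval K (mpoly_ring K n) (ring.indexed_const K) H u"

definition nonconstant :: "'a ring \<Rightarrow> nat \<Rightarrow> (nat multiset \<Rightarrow> 'a) \<Rightarrow> bool" where
  "nonconstant K n F \<longleftrightarrow>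
     F \<in> carrier (mpoly_ring K n) \<and> F \<notin> ring.indexed_const K ` carrier K"

definition indecomposable :: "'a ring \<Rightarrow> nat \<Rightarrow> (nat multiset \<Rightarrow> 'a) \<Rightarrow> bool" where
  "indecomposable K n F \<longleftrightarrow> nonconstant K n F \<and>
     \<not> (\<exists>H \<in> carrier (mpoly_ring K n). \<exists>u \<in> carrier (UP K).
          2 \<le> deg K u \<and> F = poly_subst K n u H)"

definition decomposable :: "'a ring \<Rightarrow> nat \<Rightarrow> (nat multiset \<Rightarrow> 'a) \<Rightarrow> bool" where
  "decomposable K n F \<longleftrightarrow> nonconstant K n F \<and> \<not> indecomposable K n F"

definition num_polys :: "'a ring \<Rightarrow> nat \<Rightarrow> nat \<Rightarrow> nat" where
  "num_polys K n d = card {F \<in> carrier (mpoly_ring K n). total_degree K F = d}"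

definition num_indecomposable :: "'a ring \<Rightarrow> nat \<Rightarrow> nat \<Rightarrow> nat" where
  "num_indecomposable K n d =
     card {F \<in> carrier (mpoly_ring K n). total_degree K F = d \<and> indecomposable K n F}"

definition num_decomposable :: "'a ring \<Rightarrow> nat \<Rightarrow> nat \<Rightarrow> nat" where
  "num_decomposable K n d =
     card {F \<in> carrier (mpoly_ring K n). total_degree K F = d \<and> decomposable K n F}"

text \<open>
  The filter for a limit over finite fields as their number of elements tends to infinity.  All
  finite fields occur, up to isomorphism, already over \<open>'a = nat\<close>; the limit is then uniform over
  all characteristics.
\<close>

definition finite_fields_at_top :: "'a ring filter" where
  "finite_fields_at_top =
     inf (filtercomap order at_top) (principal {K. field K \<and> finite (carrier K)})"

definition first_divisor :: "nat \<Rightarrow> nat" where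
  "first_divisor d = (LEAST l. 1 < l \<and> l dvd d)"

text \<open>Both divisions by \<open>2\<close> in the exponents of \<open>alpha\<close>, and \<open>d div first_divisor d\<close>, are exact.\<close>

definition alpha :: "nat \<Rightarrow> nat \<Rightarrow> real" where
  "alpha q d = (let l = first_divisor d in
     real q ^ (l - 1 + ((d div l + 1) * (d div l + 2)) div 2) /
     real q ^ (((d + 1) * (d + 2)) div 2))"

definition beta :: "nat \<Rightarrow> nat \<Rightarrow> real" where
  "beta q d = real d / real q ^ (d div first_divisor d)"

end

theory Submission
  imports
    Defs
    "HOL-Computational_Algebra.Polynomial_Factorial"
    "HOL-Computational_Algebra.Field_as_Ring"
    "HOL-Library.Poly_Mapping"
    "HOL-Library.Multiset_Order"
    "HOL-Library.Cardinality"
    "HOL-Number_Theory.Residues"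
begin

text \<open>
  The heart of the matter is a recursion.  Let \<open>q\<close> be the number of elements of the field.  Every
  nonconstant \<open>F\<close> is \<open>u(H)\<close> with \<open>H\<close> indecomposable, and then \<open>deg F = deg u * deg H\<close>.  If \<open>H\<close> is
  normed (constant term \<open>0\<close>, leading coefficient \<open>1\<close>), the pair \<open>(H, u)\<close> is determined by \<open>F\<close>, and \<open>F\<close>
  is decomposable exactly if \<open>deg u \<ge> 2\<close>.  There are \<open>I\<^sub>e / (q (q - 1))\<close> normed indecomposable \<open>H\<close> of
  degree \<open>e\<close> and \<open>(q - 1) q^(d/e)\<close> polynomials \<open>u\<close> of degree \<open>d/e\<close>, so that
  \<open>D\<^sub>d = (\<Sum>e | e dvd d \<and> e < d. q^(d/e - 1) I\<^sub>e)\<close>  (\<open>card_dec\<close>).  Together with \<open>N\<^sub>d = I\<^sub>d + D\<^sub>d\<close> and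
  \<open>N\<^sub>d = q^s(d) - q^s(d-1)\<close>, where \<open>s(d)\<close> is the number of monomials of degree at most \<open>d\<close>, everything
  else is arithmetic.
\<close>

text \<open>
  Uniqueness of \<open>(H, u)\<close> has to hold in every characteristic, including degrees divisible by the
  characteristic, where comparing leading terms does not suffice.  It follows from Gordan's form of
  Lueroth's theorem (\<open>common_inner_polynomial\<close>): if \<open>u(H) = v(G)\<close>, then \<open>H\<close> and \<open>G\<close> are polynomials in
  one common polynomial \<open>P\<close>; for indecomposable \<open>H\<close> and \<open>G\<close> this makes \<open>G\<close> an affine function of \<open>H\<close>.
  The theorem is first proved for one variable (\<open>single_generator\<close>): a subalgebra \<open>C\<close> of \<open>K[t]\<close> that is
  closed under exact division is \<open>K[\<theta>]\<close>.  A Kronecker substitution \<open>\<phi>\<close>, sending \<open>x\<^sub>i\<close> to a large power of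
  \<open>t\<close>, maps \<open>K[H, G]\<close> injectively into \<open>K[t]\<close>, because every nonzero element of \<open>K[H, G]\<close> divides a nonzero
  element of \<open>K[H]\<close>.  The generator \<open>\<theta>\<close> of the quotients of elements of \<open>\<phi>(K[H, G])\<close> is \<open>\<phi>(A)/\<phi>(B)\<close>, and
  the fraction \<open>A/B\<close> is integral over the polynomial ring since \<open>H\<close> is a polynomial in it.  As the
  polynomial ring is completely integrally closed (\<open>completely_integrally_closed\<close>), \<open>A/B\<close> is the wanted
  polynomial \<open>P\<close>.
\<close>

text \<open>
  For the three parts: the proper divisors of a product of at most two primes are so few that the
  recursion unwinds to the stated formulas.  In general a proper divisor \<open>e\<close> contributes at most
  \<open>q^(d/e - 1 + s(e))\<close>, and since \<open>s(d) - s(d-1) > d\<close> this is negligible against \<open>N\<^sub>d\<close>, uniformly enough for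
  both limits.  In two variables \<open>s(d) = (d+1)(d+2)/2\<close>; the divisor \<open>d/l\<close>, with \<open>l\<close> the first divisor of
  \<open>d\<close>, gives the main term \<open>\<alpha>\<^sub>d\<close>, and \<open>exponent_gap\<close> shows that each smaller divisor contributes less by
  at least the factor \<open>q^(d/l)\<close>, which gives \<open>\<beta>\<^sub>d\<close>.
\<close>

text \<open>
  The algebra is carried out over a type of class \<open>field\<close>, whereas the theorem speaks of fields given by
  a carrier, and no single field type contains all finite fields.  Since only one field has to be
  treated at a time, it is enough to have a type for a single, possibly exceptional, one: if the counting
  formulas failed for some finite field, a type isomorphic to such a field would refute the result for
  types (\<open>counting_formulas_finite_field\<close>).
\<close>

hide_const (open) Polynomial.order up_ring.monom up_ring.coeff

section \<open>Lueroth's theorem for polynomials in one variable\<close>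

text \<open>
  In \<open>K[t][y]\<close>, encoded as polynomials in \<open>y\<close> with coefficients in \<open>K[t]\<close>, the lift of \<open>p\<close> is \<open>p(y)\<close>,
  while the constant \<open>[:p:]\<close> is \<open>p(t)\<close>.
\<close>

abbreviation const_poly_lift :: "'k::comm_ring_1 poly \<Rightarrow> 'k poly poly" where
  "const_poly_lift \<equiv> map_poly (\<lambda>c. [:c:])"

lemma poly_const_poly_lift: "poly (const_poly_lift p) x = pcompose p x"
  by (induction p) (simp_all add: map_poly_pCons pcompose_pCons)

lemma map_poly_mult_hom:
  fixes f :: "'a::comm_semiring_0 \<Rightarrow> 'b::comm_semiring_0"
  assumes "f 0 = 0" "\<And>x y. f (x + y) = f x + f y" "\<And>x y. f (x * y) = f x * f y"
  shows "map_poly f (p * q) = map_poly f p * map_poly f q"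
proof -
  have "f (sum g A) = (\<Sum>x\<in>A. f (g x))" for g and A :: "nat set"
    by (induction A rule: infinite_finite_induct) (auto simp: assms)
  then show ?thesis by (intro poly_eqI) (simp add: coeff_map_poly coeff_mult assms)
qed

lemma map_poly_add_hom:
  assumes "f 0 = 0" "\<And>x y. f (x + y) = f x + f y"
  shows "map_poly f (p + q) = map_poly f p + map_poly f q"
  by (intro poly_eqI) (simp add: coeff_map_poly assms)

text \<open>
  The image of \<open>W(t, y)\<close> under \<open>t \<mapsto> z\<close>, \<open>y \<mapsto> x z\<close>, as a polynomial in \<open>z\<close> with coefficients in \<open>K[x]\<close>.  Its
  degree in \<open>z\<close> is the total degree of \<open>W\<close>, so additivity of the total degree becomes additivity of an
  ordinary degree.
\<close>

definition total_degree_form :: "'k::comm_ring_1 poly poly \<Rightarrow> 'k poly poly" where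
  "total_degree_form W = poly (map_poly const_poly_lift W) (monom [:0, 1:] 1)"

lemma total_degree_form_mult:
  "total_degree_form (V * W) = total_degree_form V * total_degree_form (W :: 'k::comm_ring_1 poly poly)"
proof -
  have "const_poly_lift (x * y) = const_poly_lift x * const_poly_lift (y :: 'k poly)" for x y
    by (rule map_poly_mult_hom) auto
  moreover have "const_poly_lift (x + y) = const_poly_lift x + const_poly_lift (y :: 'k poly)" for x y
    by (rule map_poly_add_hom) auto
  ultimately show ?thesis unfolding total_degree_form_def by (subst map_poly_mult_hom) auto
qed

lemma coeff_total_degree_form:
  "coeff (coeff (total_degree_form W) k) i = (if i \<le> k then coeff (coeff W i) (k - i) else 0)"
proof (induction W arbitrary: i k)
  case 0 then show ?case by (simp add: total_degree_form_def)
next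
  case (pCons a W)
  have "total_degree_form (pCons a W) = const_poly_lift a + monom [:0, 1:] 1 * total_degree_form W"
    by (simp add: total_degree_form_def map_poly_pCons)
  then show ?case using pCons.IH
    by (cases i; cases k) (auto simp: coeff_map_poly coeff_monom_mult coeff_pCons)
qed

lemma total_degree_form_eq_0_iff: "total_degree_form W = 0 \<longleftrightarrow> W = 0"
proof
  assume 0: "total_degree_form W = 0"
  have "coeff (coeff W i) k = 0" for i k
    using coeff_total_degree_form[of W "i + k" i] 0 by simp
  then show "W = 0" by (intro poly_eqI) simp
qed (simp add: total_degree_form_def)

lemma degree_total_degree_form_ge:
  assumes "coeff W i \<noteq> 0" shows "i + degree (coeff W i) \<le> degree (total_degree_form W)"
proof (rule le_degree)
  have "coeff (coeff (total_degree_form W) (i + degree (coeff W i))) i \<noteq> 0"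
    using assms by (simp add: coeff_total_degree_form)
  then show "coeff (total_degree_form W) (i + degree (coeff W i)) \<noteq> 0" by auto
qed

lemma degree_total_degree_form_lift_diff:
  fixes h :: "'k::comm_ring_1 poly"
  shows "degree (total_degree_form (const_poly_lift h - [:h:])) \<le> degree h"
proof (rule degree_le, intro allI impI poly_eqI)
  fix k i assume k: "degree h < k"
  show "coeff (coeff (total_degree_form (const_poly_lift h - [:h:])) k) i = coeff 0 i"
    using k by (cases i) (auto simp: coeff_total_degree_form coeff_map_poly coeff_pCons coeff_eq_0 split: nat.splits)
qed

text \<open>
  Closure under exact division makes \<open>C\<close> the intersection of \<open>K[t]\<close> with a subfield of \<open>K(t)\<close>.  This
  allows Lueroth's theorem to be proved without mentioning fraction fields.
\<close>

locale exact_division_closed_subalgebra =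
  fixes C :: "'k::field_gcd poly set" and h :: "'k poly"
  assumes const_mem: "[:c:] \<in> C"
    and add_mem: "x \<in> C \<Longrightarrow> y \<in> C \<Longrightarrow> x + y \<in> C"
    and mult_mem: "x \<in> C \<Longrightarrow> y \<in> C \<Longrightarrow> x * y \<in> C"
    and quotient_mem: "x \<in> C \<Longrightarrow> x \<noteq> 0 \<Longrightarrow> x * y \<in> C \<Longrightarrow> y \<in> C"
    and h_mem: "h \<in> C" and degree_h: "degree h > 0"
begin

lemma zero_mem: "0 \<in> C" using const_mem[of 0] by simp
lemma uminus_mem: "x \<in> C \<Longrightarrow> - x \<in> C" using mult_mem[OF const_mem[of "-1"], of x] by simp
lemma diff_mem: "x \<in> C \<Longrightarrow> y \<in> C \<Longrightarrow> x - y \<in> C" 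
  using add_mem[OF _ uminus_mem, of x y] by simp
lemma pcompose_mem: "x \<in> C \<Longrightarrow> pcompose p x \<in> C"
  by (induction p) (auto simp: pcompose_pCons intro: zero_mem add_mem mult_mem const_mem)

text \<open>
  Relations are the polynomials over \<open>C\<close> that have \<open>y = t\<close> as a root, for example \<open>c(y) - c(t)\<close> with
  \<open>c \<in> C\<close>.
\<close>

definition relation :: "'k poly poly \<Rightarrow> bool" where
  "relation W \<longleftrightarrow> (\<forall>i. coeff W i \<in> C) \<and> poly W [:0, 1:] = 0"

lemma relation_difference:
  assumes "c \<in> C" shows "relation (const_poly_lift c - [:c:])"
  using assms by (auto simp: relation_def poly_const_poly_lift coeff_map_poly coeff_pCons pcompose_idR
      intro!: diff_mem const_mem zero_mem uminus_mem split: nat.splits)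

lemma degree_lift_diff:
  assumes "degree c > 0" shows "degree (const_poly_lift c - [:c:]) = degree c"
    and "lead_coeff (const_poly_lift c - [:c:]) = [:lead_coeff c:]"
proof -
  have 1: "degree (const_poly_lift c) = degree c" by (simp add: degree_map_poly)
  show "degree (const_poly_lift c - [:c:]) = degree c"
    using assms 1 by (metis degree_add_eq_left degree_minus degree_pCons_0 uminus_add_conv_diff add.commute)
  then show "lead_coeff (const_poly_lift c - [:c:]) = [:lead_coeff c:]"
    using assms by (simp add: coeff_map_poly coeff_pCons split: nat.splits)
qed

text \<open>
  The monic minimal polynomial of \<open>t\<close> over the fraction field of \<open>C\<close> already has coefficients in \<open>C\<close>, and
  it divides all relations inside \<open>K[t][y]\<close>, not only over \<open>K(t)\<close>.  It arises as the primitive part of a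
  relation \<open>Q\<close> of least degree: Gauss's lemma gives the divisibility, dividing \<open>h(y) - h(t)\<close> forces the
  leading coefficient to be constant, and the coefficients are quotients of elements of \<open>C\<close>.
\<close>

lemma least_relation:
  obtains D where "lead_coeff D = 1" "degree D > 0" "relation D"
    "\<And>W. relation W \<Longrightarrow> D dvd W" 
proof -
  define P where "P W \<longleftrightarrow> relation W \<and> W \<noteq> 0" for W
  have "P (const_poly_lift h - [:h:])"
    unfolding P_def using relation_difference[OF h_mem] degree_lift_diff[OF degree_h] degree_h by auto
  from ex_has_least_nat[of P, OF this, of degree] obtain Q where "P Q"
    and Qmin: "\<And>W. P W \<Longrightarrow> degree Q \<le> degree W" by blast
  then have Q: "relation Q" "Q \<noteq> 0" by (auto simp: P_def)
  define D where "D = primitive_part Q"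
  have cont: "content D = 1" using Q(2) by (simp add: D_def)
  have gauss: "D dvd W" if "D dvd smult a W" "a \<noteq> 0" for W a
  proof -
    from that(1) have "fract_poly D dvd smult (to_fract a) (fract_poly W)"
      using fract_poly_dvd[of D "smult a W"] by (simp only: fract_poly_smult)
    then have "fract_poly D dvd fract_poly W" using that(2) by (simp add: dvd_smult_iff)
    then show ?thesis using cont by (rule fract_poly_dvdD)
  qed
  have D_dvd_Q: "D dvd Q" unfolding D_def by (metis content_times_primitive_part dvd_smult dvd_refl)
  have Qpos: "degree Q > 0"
  proof (rule ccontr)
    assume "\<not> ?thesis" then obtain c where "Q = [:c:]" by (metis degree_eq_zeroE neq0_conv)
    with Q show False by (auto simp: relation_def)
  qed
  have dvd: "D dvd W" if "relation W" for W
    using that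
  proof (induction "degree W" arbitrary: W rule: less_induct)
    case less
    show ?case
    proof (cases "W = 0 \<or> degree W < degree Q")
      case True then show ?thesis using Qmin less.prems by (force simp: P_def)
    next
      case False
      \<comment> \<open>One step of pseudo-division by \<open>Q\<close>; it stays within the relations and lowers the degree.\<close>
      define W' where "W' = smult (lead_coeff Q) W - monom (lead_coeff W) (degree W - degree Q) * Q"
      have rel: "relation W'"
        using less.prems Q(1) unfolding W'_def relation_def
        by (auto simp: coeff_monom_mult intro!: diff_mem mult_mem zero_mem uminus_mem)
      have c0: "coeff W' i = 0" if "i \<ge> degree W" for i
        using that False Q(2) by (cases "i = degree W") (auto simp: W'_def coeff_monom_mult coeff_eq_0)
      have "W' = 0 \<or> degree W' < degree W" using c0
        by (metis leading_coeff_0_iff not_less)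
      then have "D dvd W'" using less.hyps[OF _ rel] by auto
      then have "D dvd W' + monom (lead_coeff W) (degree W - degree Q) * Q" using D_dvd_Q by simp
      then have "D dvd smult (lead_coeff Q) W" by (simp add: W'_def)
      then show ?thesis using gauss Q(2) by simp
    qed
  qed
  have "D dvd const_poly_lift h - [:h:]" using dvd relation_difference[OF h_mem] by blast
  then have "lead_coeff D dvd [:lead_coeff h:]"
    by (metis degree_lift_diff(2)[OF degree_h] dvdE dvd_triv_left lead_coeff_mult)
  moreover have "is_unit [:lead_coeff h:]" using degree_h by (auto simp: is_unit_const_poly_iff dvd_field_iff)
  ultimately have "is_unit (lead_coeff D)" by (meson dvd_trans)
  then obtain l where l: "lead_coeff D = [:l:]" "l \<noteq> 0"
    by (metis is_unit_poly_iff dvd_field_iff not_is_unit_0 zero_neq_one dvd_0_left_iff)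
  define E where "E = smult [:inverse l:] D"
  have E: "lead_coeff E = 1" "degree E = degree D" using l by (auto simp: E_def one_pCons)
  have dvd': "E dvd W" if "relation W" for W
  proof -
    have "smult [:l:] E = D" using l by (simp add: E_def one_pCons[symmetric])
    then have "E dvd D" by (metis dvd_smult dvd_refl)
    then show ?thesis using dvd[OF that] by (rule dvd_trans)
  qed
  define b where "b = content Q * [:l:]"
  have QE: "Q = smult b E"
  proof -
    have "smult b E = smult (content Q) D" using l by (simp add: b_def E_def mult.assoc mult.left_commute one_pCons[symmetric])
    then show ?thesis by (simp add: D_def)
  qed
  have b0: "b \<noteq> 0" using Q(2) QE by auto
  have bC: "b \<in> C" using Q(1) QE E(1) unfolding relation_def by (metis coeff_smult mult.right_neutral)
  have "coeff E i \<in> C" for i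
    using Q(1) quotient_mem[OF bC b0, of "coeff E i"] QE unfolding relation_def by (metis coeff_smult)
  moreover have "poly E [:0,1:] = 0" using Q(1) QE b0 by (simp add: relation_def)
  ultimately have "relation E" by (simp add: relation_def)
  moreover have "degree E > 0" using Qpos QE b0 by simp
  ultimately show ?thesis using that[of E] E dvd' by simp
qed

text \<open>
  Division with remainder by \<open>\<theta>\<close> shows that \<open>1, t, \<dots>, t^(deg \<theta> - 1)\<close> generate \<open>K[t]\<close> over \<open>K[\<theta>]\<close>.
\<close>

lemma expand_in_powers:
  fixes \<theta> :: "'k poly"
  assumes "degree \<theta> > 0"
  shows "\<exists>W. (\<forall>i\<ge>degree \<theta>. coeff W i = 0) \<and> (\<forall>i. \<exists>r. coeff W i = pcompose r \<theta>) \<and> poly W [:0, 1:] = c"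
proof (induction "degree c" arbitrary: c rule: less_induct)
  case less
  show ?case
  proof (cases "degree c < degree \<theta>")
    case True
    have "\<exists>r. coeff (const_poly_lift c) i = pcompose r \<theta>" for i
      by (rule exI[of _ "[:coeff c i:]"]) (simp add: coeff_map_poly)
    with True show ?thesis
      by (intro exI[of _ "const_poly_lift c"]) (auto simp: coeff_map_poly poly_const_poly_lift pcompose_idR coeff_eq_0)
  next
    case False
    have c: "c = \<theta> * (c div \<theta>) + c mod \<theta>" by simp
    have th0: "\<theta> \<noteq> 0" using assms by auto
    have deg_mod: "degree (c mod \<theta>) < degree \<theta>"
      using degree_mod_less'[OF th0, of c] assms by (cases "c mod \<theta> = 0") auto
    have "degree (c div \<theta>) < degree c"
    proof (cases "c div \<theta> = 0")
      case True then show ?thesis using False assms by simp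
    next
      case nz: False
      note deg_mod
      also have "degree \<theta> \<le> degree (\<theta> * (c div \<theta>))" using nz th0 by (simp add: degree_mult_eq)
      finally have "degree c = degree (\<theta> * (c div \<theta>))" using c by (metis degree_add_eq_left)
      then show ?thesis using nz th0 assms by (simp add: degree_mult_eq)
    qed
    from less.hyps[OF this] obtain W where W: "\<forall>i\<ge>degree \<theta>. coeff W i = 0" "\<forall>i. \<exists>r. coeff W i = pcompose r \<theta>"
      "poly W [:0, 1:] = c div \<theta>" by (elim exE conjE)
    define V where "V = smult \<theta> W + const_poly_lift (c mod \<theta>)"
    have "coeff V i = 0" if "i \<ge> degree \<theta>" for i
    proof -
      have "degree (c mod \<theta>) < i" using that deg_mod by simp
      then show ?thesis using that W(1) by (simp add: V_def coeff_map_poly coeff_eq_0)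
    qed
    moreover have "\<exists>r. coeff V i = pcompose r \<theta>" for i
    proof -
      from W(2) obtain r where r: "coeff W i = pcompose r \<theta>" by blast
      show ?thesis
        by (rule exI[of _ "pCons (coeff (c mod \<theta>) i) r"]) (simp add: V_def coeff_map_poly pcompose_pCons r)
    qed
    moreover have "poly V [:0, 1:] = c"
      using c W(3) by (simp add: V_def poly_const_poly_lift pcompose_idR)
    ultimately show ?thesis by blast
  qed
qed

text \<open>
  Let \<open>D\<close> be the least relation and \<open>m\<close> its degree.  A nonconstant \<open>c \<in> C\<close> has degree at least \<open>m\<close>, since
  \<open>D\<close> divides \<open>c(y) - c(t)\<close>.  On the other hand \<open>D\<close> divides \<open>h(y) - h(t)\<close>, whose total degree is its degree
  in \<open>y\<close>.  The same then holds for \<open>D\<close>, so its coefficient of \<open>y^i\<close> has degree at most \<open>m - i\<close>.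
  Hence all coefficients except the one of \<open>y^0\<close> are constant, and as \<open>D\<close> vanishes at \<open>y = t\<close>, it is
  \<open>\<theta>(y) - \<theta>(t)\<close> with \<open>deg \<theta> = m\<close>.  Minimality of \<open>m\<close> makes \<open>1, t, \<dots>, t^(m-1)\<close> linearly
  independent over \<open>C\<close>, so that the expansion of \<open>c \<in> C\<close> over \<open>K[\<theta>]\<close> consists of its constant term
  only.
\<close>

theorem single_generator: "\<exists>\<theta>\<in>C. \<forall>c\<in>C. \<exists>r. c = pcompose r \<theta>"
proof -
  obtain D where D: "lead_coeff D = 1" "degree D > 0" "relation D" "\<And>W. relation W \<Longrightarrow> D dvd W"
    using least_relation by blast
  define m where "m = degree D"
  have big: "m \<le> degree c" if "c \<in> C" "degree c > 0" for c
  proof -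
    have "const_poly_lift c - [:c:] \<noteq> 0" using degree_lift_diff(1)[OF that(2)] that(2) by fastforce
    from dvd_imp_degree_le[OF D(4)[OF relation_difference[OF that(1)]] this]
    show ?thesis using degree_lift_diff(1)[OF that(2)] by (simp add: m_def)
  qed
  have tot: "i + degree (coeff D i) \<le> m" if nz: "coeff D i \<noteq> 0" for i
  proof -
    obtain V where V: "const_poly_lift h - [:h:] = D * V" using D(4)[OF relation_difference[OF h_mem]] by blast
    have nz': "const_poly_lift h - [:h:] \<noteq> 0" using degree_lift_diff[OF degree_h] degree_h by auto
    then have V0: "V \<noteq> 0" "D \<noteq> 0" using V by auto
    have "degree h = m + degree V"
      using degree_mult_eq[OF V0(2,1)] degree_lift_diff(1)[OF degree_h] V by (simp add: m_def)
    moreover have "degree V \<le> degree (total_degree_form V)"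
      using degree_total_degree_form_ge[of V "degree V"] V0 by simp
    moreover have "total_degree_form V \<noteq> 0" "total_degree_form D \<noteq> 0"
      using V0 by (simp_all add: total_degree_form_eq_0_iff)
    then have "degree (total_degree_form D) + degree (total_degree_form V) \<le> degree h"
      using degree_total_degree_form_lift_diff[of h] V by (simp add: total_degree_form_mult degree_mult_eq)
    ultimately show ?thesis using degree_total_degree_form_ge[OF nz] by linarith
  qed
  have Dc: "coeff D i \<in> C" for i using D(3) by (simp add: relation_def)
  have const: "degree (coeff D i) = 0" if "i > 0" for i
  proof (cases "coeff D i = 0")
    case False
    then show ?thesis using big[OF Dc[of i]] tot[of i] that by linarith
  qed simp
  define \<theta> where "\<theta> = - coeff D 0"
  \<comment> \<open>Evaluating \<open>D\<close> at \<open>y = t\<close> writes \<open>\<theta>\<close> as a polynomial with the constant coefficients of \<open>D\<close>,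
    which exhibits its degree.\<close>
  define R where "R = (\<Sum>i\<in>{1..m}. smult (coeff (coeff D i) 0) (monom 1 i) :: 'k poly)"
  have "\<theta> = R"
  proof -
    have "0 = poly D [:0, 1:]" using D(3) by (simp add: relation_def)
    also have "\<dots> = (\<Sum>i\<le>m. coeff D i * [:0, 1:] ^ i)" by (simp add: poly_altdef m_def)
    also have "\<dots> = coeff D 0 + (\<Sum>i\<in>{1..m}. coeff D i * [:0, 1:] ^ i)"
    proof -
      have "{..m} = insert 0 {1..m}" by auto
      then have "(\<Sum>i\<le>m. coeff D i * [:0, 1:] ^ i) = (\<Sum>i\<in>insert 0 {1..m}. coeff D i * [:0, 1:] ^ i)"
        by (rule arg_cong)
      then show ?thesis by simp
    qed
    also have "(\<Sum>i\<in>{1..m}. coeff D i * [:0, 1:] ^ i) = R"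
      unfolding R_def
    proof (rule sum.cong[OF refl])
      fix i assume "i \<in> {1..m}"
      then have "degree (coeff D i) = 0" using const[of i] by simp
      then obtain a where "coeff D i = [:a:]" by (rule degree_eq_zeroE)
      then show "coeff D i * [:0, 1:] ^ i = smult (coeff (coeff D i) 0) (monom 1 i)"
        by (simp add: monom_altdef)
    qed
    finally show ?thesis unfolding \<theta>_def by (metis minus_unique)
  qed
  moreover have "degree R = m"
  proof (rule antisym)
    show "degree R \<le> m" unfolding R_def
      by (rule degree_sum_le) (auto intro!: order.trans[OF degree_smult_le] order.trans[OF degree_monom_le])
    have "coeff R m = (\<Sum>i\<in>{1..m}. if i = m then coeff (coeff D i) 0 else 0)"
      unfolding R_def coeff_sum by (intro sum.cong) auto
    also have "\<dots> = 1" using D(1,2) by (simp add: m_def)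
    finally show "m \<le> degree R" by (intro le_degree) simp
  qed
  ultimately have deg: "degree \<theta> = m" by simp
  have th: "\<theta> \<in> C" using Dc uminus_mem by (simp add: \<theta>_def)
  have "\<exists>r. c = pcompose r \<theta>" if c: "c \<in> C" for c
  proof -
    obtain W where W: "\<forall>i\<ge>m. coeff W i = 0" "\<forall>i. \<exists>r. coeff W i = pcompose r \<theta>" "poly W [:0, 1:] = c"
      using expand_in_powers[of \<theta> c] deg D(2) by (auto simp: m_def)
    have "relation (W - [:c:])"
      unfolding relation_def
    proof (intro conjI allI)
      fix i
      obtain r where "coeff W i = pcompose r \<theta>" using W(2) by blast
      then have "coeff W i \<in> C" using pcompose_mem[OF th] by simp
      then show "coeff (W - [:c:]) i \<in> C"
        using c by (auto simp: coeff_pCons intro!: diff_mem split: nat.splits)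
    qed (use W(3) in simp)
    then have "D dvd W - [:c:]" by (rule D(4))
    moreover have "degree (W - [:c:]) < m"
    proof (rule le_less_trans)
      show "degree (W - [:c:]) \<le> m - 1"
        using W(1) D(2) by (intro degree_le) (auto simp: coeff_pCons m_def split: nat.splits)
    qed (use D(2) m_def in simp)
    ultimately have "W - [:c:] = 0"
      using dvd_imp_degree_le[of D "W - [:c:]"] unfolding m_def by linarith
    then have "c = coeff W 0" by simp
    then show ?thesis using W(2) by auto
  qed
  then show ?thesis using th by blast
qed

end

section \<open>Polynomials in several variables\<close>

text \<open>
  Monomials are multisets of variables, as for indexed polynomials.  The multiset order is a well-order
  compatible with multiplication of monomials, in other words a monomial order; it compares the
  exponents of the largest variables first.
\<close>

type_synonym 'k mpoly = "nat multiset \<Rightarrow>\<^sub>0 'k"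

abbreviation keys :: "'k::zero mpoly \<Rightarrow> nat multiset set" where "keys \<equiv> Poly_Mapping.keys"
abbreviation lookup :: "'k::zero mpoly \<Rightarrow> nat multiset \<Rightarrow> 'k" where "lookup \<equiv> Poly_Mapping.lookup"

definition monomial_hom :: "('k::comm_ring_1 \<Rightarrow> 'r::comm_ring_1) \<Rightarrow> (nat multiset \<Rightarrow> 'r) \<Rightarrow> 'k mpoly \<Rightarrow> 'r" where
  "monomial_hom f g p = (\<Sum>m\<in>keys p. f (lookup p m) * g m)"

lemma sum_singles: "p = (\<Sum>m\<in>keys p. Poly_Mapping.single m (lookup p m))"
  by (rule poly_mapping_eqI) (simp add: lookup_sum lookup_single when_def in_keys_iff)

lemma mpoly_induct [case_names single add]:
  assumes "\<And>m c. P (Poly_Mapping.single m c)" and "\<And>p q. P p \<Longrightarrow> P q \<Longrightarrow> P (p + q)"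
  shows "P (p :: 'k::comm_monoid_add mpoly)"
proof -
  have "P (\<Sum>m\<in>A. Poly_Mapping.single m (lookup p m))" if "finite A" for A
    using that by induction (use assms(1)[of "{#}" 0] in \<open>auto intro: assms\<close>)
  then show ?thesis using sum_singles[of p] by (metis finite_keys)
qed

locale monomial_hom_data =
  fixes f :: "'k::comm_ring_1 \<Rightarrow> 'r::comm_ring_1" and g :: "nat multiset \<Rightarrow> 'r"
  assumes f_add: "f (x + y) = f x + f y" and f_mult: "f (x * y) = f x * f y" and f_one: "f 1 = 1"
    and g_add: "g (a + b) = g a * g b" and g_empty: "g {#} = 1"
begin

lemma f_zero: "f 0 = 0" using f_add[of 0 0] by simp

lemma monomial_hom_superset:
  assumes "finite A" "keys p \<subseteq> A"
  shows "monomial_hom f g p = (\<Sum>m\<in>A. f (lookup p m) * g m)"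
  unfolding monomial_hom_def using assms
  by (intro sum.mono_neutral_left) (auto simp: in_keys_iff f_zero)

lemma hom_add: "monomial_hom f g (p + q) = monomial_hom f g p + monomial_hom f g q"
proof -
  have "monomial_hom f g (p + q) = (\<Sum>m\<in>keys p \<union> keys q. f (lookup (p + q) m) * g m)"
    by (rule monomial_hom_superset) (auto simp: Poly_Mapping.keys_add)
  also have "\<dots> = (\<Sum>m\<in>keys p \<union> keys q. f (lookup p m) * g m) + (\<Sum>m\<in>keys p \<union> keys q. f (lookup q m) * g m)"
    by (simp add: lookup_add f_add distrib_right sum.distrib)
  also have "\<dots> = monomial_hom f g p + monomial_hom f g q"
    by (simp add: monomial_hom_superset[of "keys p \<union> keys q"])
  finally show ?thesis .
qed

lemma hom_zero [simp]: "monomial_hom f g 0 = 0" by (simp add: monomial_hom_def)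

lemma hom_single: "monomial_hom f g (Poly_Mapping.single m c) = f c * g m"
  by (simp add: monomial_hom_def f_zero)

lemma hom_one [simp]: "monomial_hom f g 1 = 1"
  using hom_single[of "{#}" 1] by (simp add: f_one g_empty)

lemma hom_mult: "monomial_hom f g (p * q) = monomial_hom f g p * monomial_hom f g q"
proof (induction p rule: mpoly_induct)
  case (single m c)
  then show ?case
  proof (induction q rule: mpoly_induct)
    case (single n d)
    then show ?case by (simp add: mult_single hom_single f_mult g_add mult_ac)
  next
    case (add p q)
    then show ?case by (simp add: hom_add ring_distribs)
  qed
next
  case (add p q)
  then show ?case by (simp add: hom_add ring_distribs)
qed

lemma hom_diff: "monomial_hom f g (p - q) = monomial_hom f g p - monomial_hom f g q"
  using hom_add[of "p - q" q] by simp

lemma hom_power: "monomial_hom f g (p ^ k) = monomial_hom f g p ^ k"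
  by (induction k) (simp_all add: hom_mult)

lemma hom_sum: "monomial_hom f g (sum F I) = (\<Sum>i\<in>I. monomial_hom f g (F i))"
  by (induction I rule: infinite_finite_induct) (simp_all add: hom_add)

end

section \<open>Leading monomials\<close>

definition lead_mon :: "'k::zero mpoly \<Rightarrow> nat multiset" where "lead_mon p = Max (keys p)"
abbreviation lead_cf :: "'k::zero mpoly \<Rightarrow> 'k" where "lead_cf p \<equiv> lookup p (lead_mon p)"

lemma lead_cf_nonzero: "p \<noteq> 0 \<Longrightarrow> lead_cf p \<noteq> 0"
  unfolding lead_mon_def by (metis Max_in finite_keys in_keys_iff keys_eq_empty)

lemma lead_mon_ge: "m \<in> keys p \<Longrightarrow> m \<le> lead_mon p"
  unfolding lead_mon_def by simp

lemma lead_mon_eqI: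
  assumes "lookup p m \<noteq> 0" "\<And>n. n \<in> keys p \<Longrightarrow> n \<le> m" shows "lead_mon p = m"
  unfolding lead_mon_def using assms by (intro Max_eqI) (auto simp: in_keys_iff)

lemma lookup_mult_lead:
  fixes p q :: "'k::idom mpoly"
  shows "lookup (p * q) (lead_mon p + lead_mon q) = lead_cf p * lead_cf q"
proof -
  define s t where "s = Poly_Mapping.single (lead_mon p) (lead_cf p)"
    and "t = Poly_Mapping.single (lead_mon q) (lead_cf q)"
  have lt: "m < lead_mon p" if "m \<in> keys (p - Poly_Mapping.single (lead_mon p) (lead_cf p))"
    for m and p :: "'k mpoly"
  proof -
    from that have "m \<noteq> lead_mon p" "m \<in> keys p"
      by (auto simp: in_keys_iff lookup_minus lookup_single when_def split: if_splits)
    then show ?thesis using lead_mon_ge[of m p] by simp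
  qed
  have "p * q = s * t + (s * (q - t) + (p - s) * q)" by (simp add: algebra_simps)
  moreover have "lookup (s * (q - t)) (lead_mon p + lead_mon q) = 0"
  proof (rule ccontr)
    assume "\<not> ?thesis"
    then have "lead_mon p + lead_mon q \<in> keys (s * (q - t))" by (simp add: in_keys_iff)
    then obtain a b where ab: "lead_mon p + lead_mon q = a + b" "a \<in> keys s" "b \<in> keys (q - t)"
      using Poly_Mapping.keys_mult by blast
    then have "a = lead_mon p" "b < lead_mon q" using lt[of b q] by (auto simp: s_def t_def split: if_splits)
    with ab(1) show False by simp
  qed
  moreover have "lookup ((p - s) * q) (lead_mon p + lead_mon q) = 0"
  proof (rule ccontr)
    assume "\<not> ?thesis"
    then have "lead_mon p + lead_mon q \<in> keys ((p - s) * q)" by (simp add: in_keys_iff)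
    then obtain a b where ab: "lead_mon p + lead_mon q = a + b" "a \<in> keys (p - s)" "b \<in> keys q"
      using Poly_Mapping.keys_mult by blast
    then have "a < lead_mon p" "b \<le> lead_mon q" using lt[of a p] lead_mon_ge by (auto simp: s_def)
    with ab(1) show False by (metis add_less_le_mono less_irrefl)
  qed
  ultimately show ?thesis by (simp add: lookup_add s_def t_def mult_single)
qed

lemma lead_mon_mult:
  fixes p q :: "'k::idom mpoly"
  assumes "p \<noteq> 0" "q \<noteq> 0"
  shows "lead_mon (p * q) = lead_mon p + lead_mon q"
proof (rule lead_mon_eqI)
  show "lookup (p * q) (lead_mon p + lead_mon q) \<noteq> 0"
    using lookup_mult_lead[of p q] lead_cf_nonzero[OF assms(1)] lead_cf_nonzero[OF assms(2)] by simp
next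
  fix n assume "n \<in> keys (p * q)"
  then obtain a b where "n = a + b" "a \<in> keys p" "b \<in> keys q" using Poly_Mapping.keys_mult by blast
  then show "n \<le> lead_mon p + lead_mon q" by (simp add: add_mono lead_mon_ge)
qed

lemma count_lead_mon_power:
  fixes p :: "'k::idom mpoly"
  assumes "p \<noteq> 0" shows "count (lead_mon (p ^ j)) i = j * count (lead_mon p) i"
proof (induction j)
  case 0
  have "lead_mon (1 :: 'k mpoly) = {#}" by (rule lead_mon_eqI) auto
  then show ?case by simp
qed (use assms in \<open>simp add: lead_mon_mult\<close>)

definition vars_in :: "nat set \<Rightarrow> 'k::zero mpoly \<Rightarrow> bool" where
  "vars_in V p \<longleftrightarrow> (\<forall>m\<in>keys p. set_mset m \<subseteq> V)"

lemma vars_in_add: "vars_in V p \<Longrightarrow> vars_in V q \<Longrightarrow> vars_in V (p + q)"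
  unfolding vars_in_def using Poly_Mapping.keys_add[of p q] by blast

lemma vars_in_diff: "vars_in V p \<Longrightarrow> vars_in V q \<Longrightarrow> vars_in V (p - (q :: 'k::ab_group_add mpoly))"
  unfolding vars_in_def using Poly_Mapping.keys_diff[of p q] by blast

lemma vars_in_mult:
  assumes "vars_in V p" "vars_in V q" shows "vars_in V (p * (q :: 'k::comm_ring_1 mpoly))"
  unfolding vars_in_def
proof
  fix m assume "m \<in> keys (p * q)"
  then obtain a b where "m = a + b" "a \<in> keys p" "b \<in> keys q" using Poly_Mapping.keys_mult by blast
  then show "set_mset m \<subseteq> V" using assms by (auto simp: vars_in_def)
qed

lemma vars_in_single: "set_mset m \<subseteq> V \<Longrightarrow> vars_in V (Poly_Mapping.single m c)"
  by (simp add: vars_in_def)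

text \<open>
  If all powers of \<open>A/B\<close> have the common denominator \<open>Z\<close>, then \<open>A/B\<close> is a polynomial.  Comparing leading
  monomials in \<open>Z * A ^ j = B ^ j * W\<close>, each variable has an exponent in \<open>j * lead_mon A + lead_mon Z\<close>
  at least as large as in \<open>j * lead_mon B\<close>; for large \<open>j\<close> this means that the leading monomial of \<open>B\<close>
  divides that of \<open>A\<close>.  Subtracting the quotient \<open>s\<close> of the leading terms from \<open>A/B\<close> preserves the
  hypothesis, by the binomial theorem, and lowers the leading monomial of the numerator.
\<close>

lemma completely_integrally_closed:
  fixes A B Z :: "'k::field mpoly"
  assumes "B \<noteq> 0" "Z \<noteq> 0" "vars_in V A" "vars_in V B" and dvd: "\<And>j. B ^ j dvd Z * A ^ j"
  shows "\<exists>P. vars_in V P \<and> A = B * P"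
  using assms(3) dvd
proof (induction "lead_mon A" arbitrary: A rule: less_induct)
  case less
  show ?case
  proof (cases "A = 0")
    case True then show ?thesis by (intro exI[of _ 0]) (simp add: vars_in_def)
  next
    case A: False
    have "count (lead_mon B) i \<le> count (lead_mon A) i" for i
    proof (rule ccontr)
      assume contra: "\<not> ?thesis"
      define j where "j = Suc (count (lead_mon Z) i)"
      obtain W where W: "Z * A ^ j = B ^ j * W" using less.prems(2)[of j] by blast
      then have "W \<noteq> 0" using A assms(2) by auto
      then have "lead_mon Z + lead_mon (A ^ j) = lead_mon (B ^ j) + lead_mon W"
        using W A assms by (metis lead_mon_mult power_not_zero)
      then have "count (lead_mon Z) i + j * count (lead_mon A) i = j * count (lead_mon B) i + count (lead_mon W) i"
        using count_lead_mon_power A assms(1) by (metis count_union)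
      moreover have "j * Suc (count (lead_mon A) i) \<le> j * count (lead_mon B) i"
        using contra by (intro mult_le_mono) auto
      ultimately show False by (simp add: j_def)
    qed
    then have sub: "lead_mon B \<subseteq># lead_mon A" by (simp add: subseteq_mset_def)
    define s where "s = Poly_Mapping.single (lead_mon A - lead_mon B) (lead_cf A / lead_cf B)"
    have lmA: "set_mset (lead_mon A) \<subseteq> V"
      using less.prems(1) lead_cf_nonzero[OF A] by (auto simp: vars_in_def in_keys_iff)
    then have s: "vars_in V s" unfolding s_def
      by (intro vars_in_single) (meson in_diffD subset_iff)
    have s0: "s \<noteq> 0" unfolding s_def
      using lead_cf_nonzero[OF A] lead_cf_nonzero[OF assms(1)] by (metis divide_eq_0_iff lookup_single_eq lookup_zero)
    have lms: "lead_mon s = lead_mon A - lead_mon B"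
      using s0 by (intro lead_mon_eqI) (auto simp: s_def split: if_splits)
    have lmsB: "lead_mon (s * B) = lead_mon A"
      using lead_mon_mult[OF s0 assms(1)] lms sub by simp
    define A' where "A' = A - s * B"
    have vA': "vars_in V A'" unfolding A'_def using less.prems(1) s assms(4) by (intro vars_in_diff vars_in_mult)
    have "lead_mon s + lead_mon B = lead_mon A" using lms sub by simp
    then have "lookup (s * B) (lead_mon A) = lead_cf A"
      using lookup_mult_lead[of s B] lead_cf_nonzero[OF assms(1)] lms by (simp add: s_def)
    then have z: "lookup A' (lead_mon A) = 0" by (simp add: A'_def lookup_minus)
    have le: "m \<le> lead_mon A" if "m \<in> keys A'" for m
      using that Poly_Mapping.keys_diff[of A "s * B"] lead_mon_ge[of m A] lead_mon_ge[of m "s * B"]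
      by (auto simp: A'_def lmsB)
    have dvd': "B ^ j dvd Z * A' ^ j" for j
    proof -
      have "A' ^ j = (A + (- s * B)) ^ j" by (simp add: A'_def)
      also have "Z * \<dots> = (\<Sum>k\<le>j. of_nat (j choose k) * (- s) ^ (j - k) * (Z * A ^ k * B ^ (j - k)))"
        unfolding binomial_ring sum_distrib_left by (simp only: power_mult_distrib mult_ac)
      also have "B ^ j dvd \<dots>"
      proof (rule dvd_sum, rule dvd_mult)
        fix k assume "k \<in> {..j}"
        then have "B ^ j = B ^ k * B ^ (j - k)" by (simp flip: power_add)
        then show "B ^ j dvd Z * A ^ k * B ^ (j - k)" using less.prems(2)[of k] by (simp add: mult_dvd_mono)
      qed
      finally show ?thesis .
    qed
    show ?thesis
    proof (cases "A' = 0")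
      case True then show ?thesis using s by (intro exI[of _ s]) (simp add: A'_def mult.commute)
    next
      case False
      then have "lead_mon A' \<in> keys A'" using lead_cf_nonzero by (simp add: in_keys_iff)
      then have "lead_mon A' < lead_mon A" using le z by (metis in_keys_iff le_imp_less_or_eq)
      from less.hyps[OF this vA' dvd'] obtain P where P: "vars_in V P" "A' = B * P" by blast
      have "A = B * (s + P)" using P(2) by (simp add: A'_def algebra_simps)
      then show ?thesis using vars_in_add[OF s P(1)] by blast
    qed
  qed
qed

section \<open>Substitution into a polynomial in one variable\<close>

definition Const :: "'k::zero \<Rightarrow> 'k mpoly" where "Const c = Poly_Mapping.single {#} c"

lemma Const_0 [simp]: "Const 0 = 0" and Const_1 [simp]: "Const 1 = 1"
  and Const_add: "Const (a + b) = Const a + Const b" for a b :: "'k::comm_ring_1"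
  by (simp_all add: Const_def single_add)

lemma Const_mult: "Const (a * b) = Const a * Const b" for a b :: "'k::comm_ring_1"
  by (simp add: Const_def mult_single)

lemma Const_eq_0_iff [simp]: "Const c = 0 \<longleftrightarrow> c = 0"
  by (metis Const_def Const_0 lookup_single_eq lookup_zero)

definition subst :: "'k::comm_ring_1 poly \<Rightarrow> 'k mpoly \<Rightarrow> 'k mpoly" where
  "subst u H = poly (map_poly Const u) H"

lemma subst_0 [simp]: "subst 0 H = 0" by (simp add: subst_def)

lemma subst_pCons: "subst (pCons a u) H = Const a + H * subst u H"
  by (simp add: subst_def map_poly_pCons)

lemma subst_add: "subst (u + v) H = subst u H + subst v H"
  by (simp add: subst_def map_poly_add_hom Const_add)

lemma subst_mult: "subst (u * v) H = subst u H * subst v H"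
  by (simp add: subst_def map_poly_mult_hom Const_add Const_mult)

lemma subst_pcompose: "subst (pcompose u a) P = subst u (subst a P)"
  by (induction u) (simp_all add: pcompose_pCons subst_add subst_mult subst_pCons)

lemma subst_altdef: "subst u H = (\<Sum>i\<le>degree u. Const (coeff u i) * H ^ i)"
  unfolding subst_def poly_altdef by (simp add: coeff_map_poly degree_map_poly)

lemma vars_in_Const: "vars_in V (Const c)" by (simp add: Const_def vars_in_single)

lemma vars_in_subst: "vars_in V H \<Longrightarrow> vars_in V (subst u H)"
proof (induction u)
  case 0 then show ?case by (simp add: vars_in_def)
qed (auto simp: subst_pCons intro!: vars_in_add vars_in_mult vars_in_Const)

section \<open>Kronecker substitution\<close>

text \<open>
  The substitution \<open>x\<^sub>i \<mapsto> t ^ (N ^ i)\<close>.  As long as \<open>N\<close> exceeds the degrees of the monomials, it respects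
  the monomial order, so the leading monomial determines the degree of the image and nonconstant
  polynomials stay nonconstant.
\<close>

definition kronecker_weight :: "nat \<Rightarrow> nat multiset \<Rightarrow> nat" where
  "kronecker_weight N m = (\<Sum>i\<in>#m. N ^ i)"

definition kronecker :: "nat \<Rightarrow> 'k::comm_ring_1 mpoly \<Rightarrow> 'k poly" where
  "kronecker N = monomial_hom (\<lambda>c. [:c:]) (\<lambda>m. monom 1 (kronecker_weight N m))"

lemma kronecker_weight_less:
  assumes "m < m'" "size m < N"
  shows "kronecker_weight N m < kronecker_weight N m'"
proof -
  from assms(1) obtain old new where old: "old \<noteq> {#}" "old \<subseteq># m'" "m = m' - old + new"
    and dom: "\<And>k. k \<in># new \<Longrightarrow> \<exists>a. a \<in># old \<and> k < a"
    unfolding less_multiset\<^sub>D\<^sub>M by blast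
  \<comment> \<open>The largest removed variable outweighs everything that replaces it: the replacements are smaller
    and fewer than \<open>N\<close>.\<close>
  define x where "x = Max (set_mset old)"
  have x: "x \<in># old" unfolding x_def using old(1) by simp
  have "kronecker_weight N new < N ^ x"
  proof (cases "new = {#}")
    case True then show ?thesis using assms(2) by (simp add: kronecker_weight_def)
  next
    case False
    then obtain y where "y \<in># new" by blast
    have lt: "k < x" if k: "k \<in># new" for k
    proof -
      from dom[OF k] obtain a where "a \<in># old" "k < a" by blast
      then show ?thesis unfolding x_def by (meson Max_ge finite_set_mset less_le_trans)
    qed
    have "kronecker_weight N new \<le> (\<Sum>i\<in>#new. N ^ (x - 1))"
      unfolding kronecker_weight_def
    proof (rule sum_mset_mono)
      fix i assume "i \<in># new"
      from lt[OF this] show "N ^ i \<le> N ^ (x - 1)" using assms(2) by (intro power_increasing) auto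
    qed
    also have "\<dots> = size new * N ^ (x - 1)" by simp
    also have "\<dots> < N * N ^ (x - 1)" using old(3) assms(2) by simp
    also have "\<dots> = N ^ x" using lt[OF \<open>y \<in># new\<close>] by (cases x) auto
    finally show ?thesis .
  qed
  also have "N ^ x \<le> kronecker_weight N old"
    using x unfolding kronecker_weight_def by (metis insert_DiffM image_mset_add_mset sum_mset.add_mset le_add1)
  finally have "kronecker_weight N (m' - old) + kronecker_weight N new < kronecker_weight N (m' - old) + kronecker_weight N old" by simp
  then show ?thesis
    using old(2,3) unfolding kronecker_weight_def
    by (metis image_mset_union subset_mset.diff_add sum_mset.union)
qed

interpretation kronecker: monomial_hom_data "\<lambda>c. [:c:]" "\<lambda>m. monom (1::'k::comm_ring_1) (kronecker_weight N m)"
  rewrites "monomial_hom (\<lambda>c. [:c:]) (\<lambda>m. monom 1 (kronecker_weight N m)) = kronecker N"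
  by unfold_locales (simp_all add: kronecker_weight_def mult_monom kronecker_def one_pCons monom_0)

lemma kronecker_Const: "kronecker N (Const c) = [:c:]"
  unfolding Const_def kronecker.hom_single by (simp add: kronecker_weight_def monom_0)

lemma kronecker_subst: "kronecker N (subst u H) = pcompose u (kronecker N H)"
  by (induction u) (simp_all add: subst_pCons pcompose_pCons kronecker.hom_add kronecker.hom_mult kronecker_Const)

lemma degree_kronecker_pos:
  fixes p :: "'k::idom mpoly"
  assumes m: "m \<in> keys p" "m \<noteq> {#}" and N: "\<And>m. m \<in> keys p \<Longrightarrow> size m < N"
  shows "degree (kronecker N p) > 0"
proof -
  have p0: "p \<noteq> 0" using m by auto
  have in_keys: "lead_mon p \<in> keys p" using lead_cf_nonzero[OF p0] by (simp add: in_keys_iff)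
  define w where "w = kronecker_weight N (lead_mon p)"
  have "{#} < m" using m(2) by simp
  also have "m \<le> lead_mon p" using lead_mon_ge m(1) by blast
  finally have "kronecker_weight N {#} < w" unfolding w_def using N[OF m(1)]
    by (intro kronecker_weight_less) auto
  have "coeff (kronecker N p) w = (\<Sum>m\<in>keys p. if m = lead_mon p then lookup p m else 0)"
    unfolding kronecker_def monomial_hom_def coeff_sum
  proof (rule sum.cong[OF refl])
    fix m assume "m \<in> keys p"
    then have "kronecker_weight N m < w" if "m \<noteq> lead_mon p"
      unfolding w_def using that lead_mon_ge[of m p] N by (intro kronecker_weight_less) auto
    then show "coeff ([:lookup p m:] * monom 1 (kronecker_weight N m)) w = (if m = lead_mon p then lookup p m else 0)"
      by (auto simp: w_def)
  qed
  also have "\<dots> = lead_cf p" using in_keys by simp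
  finally have "coeff (kronecker N p) w \<noteq> 0" using lead_cf_nonzero[OF p0] by simp
  then have "w \<le> degree (kronecker N p)" by (rule le_degree)
  then show ?thesis using \<open>kronecker_weight N {#} < w\<close> by linarith
qed

text \<open>
  Gaussian elimination without division: more vectors than coordinates are linearly dependent over any
  integral domain.
\<close>

lemma linear_dependence:
  fixes M :: "'i \<Rightarrow> 'j \<Rightarrow> 'd::idom"
  assumes "finite J" "finite I" "card J < card I"
  shows "\<exists>c. (\<exists>i\<in>I. c i \<noteq> 0) \<and> (\<forall>j\<in>J. (\<Sum>i\<in>I. c i * M i j) = 0)"
  using assms
proof (induction J arbitrary: I M rule: finite_induct)
  case empty
  then have "I \<noteq> {}" by auto
  then show ?case by (intro exI[of _ "\<lambda>_. 1"]) auto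
next
  case (insert k J)
  show ?case
  proof (cases "\<forall>i\<in>I. M i k = 0")
    case True
    have "card J < card I" using insert by simp
    from insert.IH[OF insert.prems(1) this, of M] True show ?thesis by auto
  next
    case False
    then obtain p where p: "p \<in> I" "M p k \<noteq> 0" by blast
    define I' where "I' = I - {p}"
    have I': "finite I'" "I = insert p I'" "p \<notin> I'" "card J < card I'"
      using p insert by (auto simp: I'_def)
    from insert.IH[OF I'(1,4), of "\<lambda>i j. M p k * M i j - M i k * M p j"]
    obtain c where c: "\<exists>i\<in>I'. c i \<noteq> 0" "\<forall>j\<in>J. (\<Sum>i\<in>I'. c i * (M p k * M i j - M i k * M p j)) = 0" by blast
    \<comment> \<open>The pivot row \<open>p\<close> clears column \<open>k\<close>; its coefficient compensates for the multiples subtracted.\<close>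
    define d where "d i = (if i = p then - (\<Sum>i\<in>I'. c i * M i k) else c i * M p k)" for i
    have sum: "(\<Sum>i\<in>I. d i * M i j) = (\<Sum>i\<in>I'. c i * (M p k * M i j - M i k * M p j))" for j
    proof -
      have "(\<Sum>i\<in>I. d i * M i j) = d p * M p j + (\<Sum>i\<in>I'. d i * M i j)" using I' by simp
      also have "(\<Sum>i\<in>I'. d i * M i j) = (\<Sum>i\<in>I'. c i * M p k * M i j)"
        using I'(3) by (intro sum.cong) (auto simp: d_def)
      also have "d p * M p j = (\<Sum>i\<in>I'. - (c i * M i k * M p j))" by (simp add: d_def sum_distrib_right sum_negf)
      finally show ?thesis by (simp add: sum.distrib[symmetric] algebra_simps)
    qed
    have "\<exists>i\<in>I. d i \<noteq> 0" using c(1) I' p by (auto simp: d_def)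
    moreover have "(\<Sum>i\<in>I. d i * M i k) = 0" unfolding sum by (simp add: mult.commute)
    moreover have "\<forall>j\<in>J. (\<Sum>i\<in>I. d i * M i j) = 0" unfolding sum using c(2) by blast
    ultimately show ?thesis by blast
  qed
qed

section \<open>Algebraically dependent polynomials\<close>

text \<open>
  The subalgebra \<open>K[H, G]\<close>.
\<close>

inductive_set algebra_gen :: "'k::comm_ring_1 mpoly \<Rightarrow> 'k mpoly \<Rightarrow> 'k mpoly set"
  for H G where
    Const: "Const c \<in> algebra_gen H G"
  | fst: "H \<in> algebra_gen H G"
  | snd: "G \<in> algebra_gen H G"
  | add: "x \<in> algebra_gen H G \<Longrightarrow> y \<in> algebra_gen H G \<Longrightarrow> x + y \<in> algebra_gen H G"
  | mult: "x \<in> algebra_gen H G \<Longrightarrow> y \<in> algebra_gen H G \<Longrightarrow> x * y \<in> algebra_gen H G"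

lemma algebra_gen_diff:
  assumes "x \<in> algebra_gen H G" "y \<in> algebra_gen H G" shows "x - y \<in> algebra_gen H G"
proof -
  have "Const (-1) * y \<in> algebra_gen H G" using assms by (intro algebra_gen.intros)
  moreover have "Const (-1) * y = - y"
    using Const_add[of 1 "-1"] by (metis Const_0 Const_1 add.right_inverse minus_unique mult_minus1)
  ultimately show ?thesis using algebra_gen.add[OF assms(1)] by fastforce
qed

lemma algebra_gen_power: "x \<in> algebra_gen H G \<Longrightarrow> x ^ k \<in> algebra_gen H G"
  by (induction k) (auto intro: algebra_gen.mult algebra_gen.Const[of 1, simplified])

lemma algebra_gen_sum: "(\<And>i. i \<in> I \<Longrightarrow> f i \<in> algebra_gen H G) \<Longrightarrow> sum f I \<in> algebra_gen H G"
  by (induction I rule: infinite_finite_induct)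
     (auto intro: algebra_gen.add algebra_gen.Const[of 0, simplified])

lemma vars_in_algebra_gen:
  assumes "x \<in> algebra_gen H G" "vars_in V H" "vars_in V G" shows "vars_in V x"
  using assms by induction (auto intro: vars_in_Const vars_in_add vars_in_mult)

text \<open>
  The equation says that \<open>A/B\<close> is integral of degree \<open>k\<close> over the polynomial ring, so each power of it is
  a combination of its first \<open>k\<close> powers and has denominator \<open>B ^ k\<close>.
\<close>

lemma integral_dvd:
  fixes A B :: "'k::field mpoly"
  assumes "l \<noteq> 0" "Const l * A ^ k = (\<Sum>i<k. Y i * A ^ i * B ^ (k - i))"
  shows "B ^ j dvd B ^ k * A ^ j"
proof (induction j rule: less_induct)
  case (less j)
  show ?case
  proof (cases "j \<le> k")
    case True then show ?thesis by (simp add: le_imp_power_dvd dvd_mult2)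
  next
    case False
    have "Const l * (B ^ k * A ^ j) = (B ^ k * A ^ (j - k)) * (Const l * A ^ k)"
      using False by (simp add: mult_ac flip: power_add)
    also have "\<dots> = (\<Sum>i<k. Y i * (B ^ k * A ^ (j - k + i) * B ^ (k - i)))"
      unfolding assms(2) by (simp add: sum_distrib_left power_add mult_ac)
    also have "B ^ j dvd \<dots>"
    proof (rule dvd_sum, rule dvd_mult)
      fix i assume i: "i \<in> {..<k}"
      then have "B ^ j = B ^ (j - k + i) * B ^ (k - i)" using False by (simp flip: power_add)
      moreover have "B ^ (j - k + i) dvd B ^ k * A ^ (j - k + i)" using i False by (intro less) auto
      ultimately show "B ^ j dvd B ^ k * A ^ (j - k + i) * B ^ (k - i)" by (simp add: mult_dvd_mono)
    qed
    finally have "B ^ j dvd Const (inverse l) * (Const l * (B ^ k * A ^ j))" by (rule dvd_mult)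
    moreover have "Const (inverse l) * Const l = (1 :: 'k mpoly)" using assms(1) by (simp flip: Const_mult)
    ultimately show ?thesis by (metis mult.assoc mult_1)
  qed
qed

text \<open>
  \<open>B ^ degree a * a(A/B)\<close>, cleared of denominators.
\<close>

definition homogenize :: "'k::comm_ring_1 poly \<Rightarrow> 'k mpoly \<Rightarrow> 'k mpoly \<Rightarrow> 'k mpoly" where
  "homogenize a A B = (\<Sum>i\<le>degree a. Const (coeff a i) * A ^ i * B ^ (degree a - i))"

lemma homogenize_mult: "homogenize a (B * P) B = B ^ degree a * subst a P"
proof -
  have "B ^ degree a = B ^ i * B ^ (degree a - i)" if "i \<le> degree a" for i
    using that by (simp flip: power_add)
  then show ?thesis
    unfolding homogenize_def subst_altdef sum_distrib_left
    by (intro sum.cong) (auto simp: power_mult_distrib mult_ac)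
qed

locale dependent_pair =
  fixes H G :: "'k::field_gcd mpoly" and u v :: "'k poly" and V :: "nat set"
  assumes vars: "vars_in V H" "vars_in V G"
    and dep: "subst u H = subst v G" and deg_v: "degree v > 0"
    and nonconst: "\<exists>m\<in>keys H. m \<noteq> {#}"
begin

text \<open>
  The module over \<open>K[H]\<close> generated by the powers \<open>G ^ j\<close> with \<open>j < degree v\<close>.  As \<open>v(G) = u(H)\<close> expresses
  \<open>G ^ degree v\<close> in lower powers, it is closed under multiplication by \<open>G\<close> and hence contains \<open>K[H, G]\<close>.
\<close>

definition span :: "'k mpoly set" where
  "span = {\<Sum>j<degree v. subst (a j) H * G ^ j | a. True}"

lemma span_add: "x \<in> span \<Longrightarrow> y \<in> span \<Longrightarrow> x + y \<in> span"
proof -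
  assume "x \<in> span" "y \<in> span"
  then obtain a b where "x = (\<Sum>j<degree v. subst (a j) H * G ^ j)" "y = (\<Sum>j<degree v. subst (b j) H * G ^ j)"
    unfolding span_def by blast
  then have "x + y = (\<Sum>j<degree v. subst (a j + b j) H * G ^ j)"
    by (simp add: subst_add ring_distribs sum.distrib)
  then show ?thesis unfolding span_def by (intro CollectI exI[of _ "\<lambda>j. a j + b j"]) simp
qed

lemma span_subst_mult: "x \<in> span \<Longrightarrow> subst r H * x \<in> span"
proof -
  assume "x \<in> span"
  then obtain a where "x = (\<Sum>j<degree v. subst (a j) H * G ^ j)" unfolding span_def by blast
  then have "subst r H * x = (\<Sum>j<degree v. subst (r * a j) H * G ^ j)"
    by (simp add: subst_mult sum_distrib_left mult.assoc)
  then show ?thesis unfolding span_def by (intro CollectI exI[of _ "\<lambda>j. r * a j"]) simp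
qed

lemma span_sum: "finite I \<Longrightarrow> (\<And>i. i \<in> I \<Longrightarrow> f i \<in> span) \<Longrightarrow> sum f I \<in> span"
proof (induction I rule: finite_induct)
  case empty
  have "0 = (\<Sum>j<degree v. subst 0 H * G ^ j)" by simp
  then show ?case unfolding span_def by (intro CollectI exI[of _ "\<lambda>j. 0"]) simp
qed (auto intro: span_add)

lemma span_small_power: "j < degree v \<Longrightarrow> G ^ j \<in> span"
proof -
  assume j: "j < degree v"
  have "G ^ j = (\<Sum>i<degree v. if i = j then G ^ i else 0)" using j by simp
  also have "\<dots> = (\<Sum>i<degree v. subst (if i = j then 1 else 0) H * G ^ i)"
    by (intro sum.cong) (auto simp: one_pCons subst_pCons)
  finally show ?thesis unfolding span_def by (intro CollectI exI[of _ "\<lambda>i. if i = j then 1 else 0"]) simp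
qed

lemma span_Const_mult: "x \<in> span \<Longrightarrow> Const c * x \<in> span"
  using span_subst_mult[of x "[:c:]"] by (simp add: subst_pCons)

lemma span_top_power: "G ^ degree v \<in> span"
proof -
  define l where "l = lead_coeff v"
  have l: "l \<noteq> 0" using deg_v by (auto simp: l_def)
  have "{..degree v} = insert (degree v) {..<degree v}" by auto
  then have "subst u H = Const l * G ^ degree v + (\<Sum>j<degree v. Const (coeff v j) * G ^ j)"
    unfolding dep subst_altdef[of v] by (simp add: l_def)
  then have "Const l * G ^ degree v = subst u H * G ^ 0 + (\<Sum>j<degree v. Const (- coeff v j) * G ^ j)"
    by (simp add: Const_def single_uminus sum_negf algebra_simps)
  also have "\<dots> \<in> span"
    by (intro span_add span_sum span_Const_mult span_subst_mult span_small_power) (use deg_v in auto)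
  finally have "Const (inverse l) * (Const l * G ^ degree v) \<in> span" by (rule span_Const_mult)
  moreover have "Const (inverse l) * Const l = 1" using l by (simp flip: Const_mult)
  ultimately show ?thesis by (metis mult.assoc mult_1)
qed

lemma span_mult_G: "x \<in> span \<Longrightarrow> G * x \<in> span"
proof -
  assume "x \<in> span"
  then obtain a where "x = (\<Sum>j<degree v. subst (a j) H * G ^ j)" unfolding span_def by blast
  then have "G * x = (\<Sum>j<degree v. subst (a j) H * G ^ Suc j)"
    by (simp add: sum_distrib_left mult_ac)
  also have "\<dots> \<in> span"
  proof (intro span_sum span_subst_mult)
    fix j assume "j \<in> {..<degree v}"
    then consider "Suc j < degree v" | "Suc j = degree v" by fastforce
    then show "G ^ Suc j \<in> span" using span_small_power span_top_power by cases metis+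
  qed simp
  finally show ?thesis .
qed

lemma span_algebra_gen_mult: "E \<in> algebra_gen H G \<Longrightarrow> x \<in> span \<Longrightarrow> E * x \<in> span"
proof (induction arbitrary: x rule: algebra_gen.induct)
  case fst
  then show ?case using span_subst_mult[of x "[:0, 1:]"] by (simp add: subst_pCons)
qed (auto simp: ring_distribs mult.assoc intro: span_Const_mult span_mult_G span_add)

lemma span_power: "E \<in> algebra_gen H G \<Longrightarrow> E ^ i \<in> span"
  using span_algebra_gen_mult[OF algebra_gen_power, of E 1 i] span_small_power[of 0] deg_v by simp

text \<open>
  The powers \<open>1, E, \<dots>, E ^ degree v\<close> lie in a module over \<open>K[H]\<close> with only \<open>degree v\<close> generators, so they
  are linearly dependent.  Dividing the dependence by the lowest power of \<open>E\<close> that occurs in it leaves a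
  nonzero element of \<open>K[H]\<close> that is divisible by \<open>E\<close>.
\<close>

lemma divides_function_of_H:
  assumes "E \<in> algebra_gen H G" "E \<noteq> 0"
  shows "\<exists>W r. r \<noteq> 0 \<and> E * W = subst r H"
proof -
  have "\<forall>i. \<exists>a. E ^ i = (\<Sum>j<degree v. subst (a j) H * G ^ j)"
    using span_power[OF assms(1)] unfolding span_def by blast
  then obtain a where a: "\<And>i. E ^ i = (\<Sum>j<degree v. subst (a i j) H * G ^ j)" by metis
  obtain c where c: "\<exists>i\<in>{..degree v}. c i \<noteq> 0" "\<forall>j\<in>{..<degree v}. (\<Sum>i\<in>{..degree v}. c i * a i j) = 0"
    using linear_dependence[of "{..<degree v}" "{..degree v}" a] by auto
  have subst_sum: "subst (sum f I) H = (\<Sum>i\<in>I. subst (f i) H)" for f and I :: "nat set"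
    by (induction I rule: infinite_finite_induct) (auto simp: subst_add)
  have "(\<Sum>i\<le>degree v. subst (c i) H * E ^ i) = (\<Sum>i\<le>degree v. \<Sum>j<degree v. subst (c i * a i j) H * G ^ j)"
    unfolding a by (simp add: sum_distrib_left subst_mult mult.assoc)
  also have "\<dots> = (\<Sum>j<degree v. subst (\<Sum>i\<le>degree v. c i * a i j) H * G ^ j)"
    unfolding subst_sum sum_distrib_right by (rule sum.swap)
  also have "\<dots> = 0" using c(2) by simp
  finally have rel: "(\<Sum>i\<le>degree v. subst (c i) H * E ^ i) = 0" .
  define i0 where "i0 = (LEAST i. i \<le> degree v \<and> c i \<noteq> 0)"
  have i0: "i0 \<le> degree v" "c i0 \<noteq> 0"
    using LeastI_ex[of "\<lambda>i. i \<le> degree v \<and> c i \<noteq> 0"] c(1) unfolding i0_def by auto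
  have small: "c i = 0" if "i < i0" for i
    using not_less_Least[of i "\<lambda>i. i \<le> degree v \<and> c i \<noteq> 0"] that i0(1) unfolding i0_def by auto
  define W where "W = (\<Sum>i\<in>{i0<..degree v}. subst (c i) H * E ^ (i - Suc i0))"
  have "0 = (\<Sum>i\<in>{i0..degree v}. subst (c i) H * E ^ i)"
    unfolding rel[symmetric] using small i0(1) by (intro sum.mono_neutral_right) (auto simp: not_le)
  also have "{i0..degree v} = insert i0 {i0<..degree v}" using i0(1) by auto
  also have "(\<Sum>i\<in>insert i0 {i0<..degree v}. subst (c i) H * E ^ i)
      = subst (c i0) H * E ^ i0 + (\<Sum>i\<in>{i0<..degree v}. subst (c i) H * E ^ i)" by simp
  also have "(\<Sum>i\<in>{i0<..degree v}. subst (c i) H * E ^ i) = E ^ i0 * (E * W)"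
    unfolding W_def sum_distrib_left
  proof (rule sum.cong[OF refl])
    fix i assume "i \<in> {i0<..degree v}"
    then have "i = i0 + Suc (i - Suc i0)" by simp
    then have "E ^ i = E ^ i0 * E ^ Suc (i - Suc i0)" by (metis power_add)
    then show "subst (c i) H * E ^ i = E ^ i0 * (E * (subst (c i) H * E ^ (i - Suc i0)))"
      by (simp add: mult_ac)
  qed
  finally have "E ^ i0 * (subst (c i0) H + E * W) = 0" by (simp add: algebra_simps)
  then have "subst (c i0) H + E * W = 0" using assms(2) by simp
  then have "E * W = - subst (c i0) H" by (simp only: add_eq_0_iff)
  then have "E * (- W) = subst (c i0) H" by simp
  then show ?thesis using i0(2) by blast
qed

text \<open>
  Larger than the degree of every monomial of \<open>H\<close>, so that \<open>\<phi>\<close> keeps \<open>H\<close> nonconstant.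
\<close>

definition kronecker_base :: nat where
  "kronecker_base = Suc (Max (size ` keys H))"

abbreviation \<phi> :: "'k mpoly \<Rightarrow> 'k poly" where "\<phi> \<equiv> kronecker kronecker_base"

lemma degree_phi_H: "degree (\<phi> H) > 0"
proof -
  obtain m where "m \<in> keys H" "m \<noteq> {#}" using nonconst by blast
  then show ?thesis
    by (rule degree_kronecker_pos) (simp add: kronecker_base_def le_imp_less_Suc)
qed

text \<open>
  If \<open>\<phi>\<close> kills \<open>E\<close>, it kills the nonzero multiple \<open>r(H)\<close> of \<open>E\<close>, but \<open>r(\<phi> H) \<noteq> 0\<close> because \<open>\<phi> H\<close> is not
  constant.
\<close>

lemma phi_inj:
  assumes "E \<in> algebra_gen H G" "\<phi> E = 0" shows "E = 0"
proof (rule ccontr)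
  assume "E \<noteq> 0"
  from divides_function_of_H[OF assms(1) this] obtain W r where r: "r \<noteq> 0" "E * W = subst r H" by blast
  have "pcompose r (\<phi> H) = \<phi> E * \<phi> W" unfolding kronecker_subst[symmetric] r(2)[symmetric] kronecker.hom_mult ..
  then have "pcompose r (\<phi> H) = 0" using assms(2) by simp
  then show False using r(1) degree_phi_H pcompose_eq_0 by blast
qed

lemma phi_homogenize:
  assumes "\<phi> A = \<theta> * \<phi> B"
  shows "\<phi> (homogenize a A B) = \<phi> B ^ degree a * pcompose a \<theta>"
proof -
  have 1: "\<phi> B ^ degree a = \<phi> B ^ i * \<phi> B ^ (degree a - i)" if "i \<le> degree a" for i
    using that by (simp flip: power_add)
  have 2: "pcompose a \<theta> = (\<Sum>i\<le>degree a. [:coeff a i:] * \<theta> ^ i)"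
    by (simp add: pcompose_altdef poly_altdef degree_map_poly coeff_map_poly)
  show ?thesis
    unfolding homogenize_def kronecker.hom_sum kronecker.hom_mult kronecker.hom_power assms 2 sum_distrib_left
  proof (rule sum.cong[OF refl])
    fix i assume "i \<in> {..degree a}"
    then show "\<phi> (Const (coeff a i)) * (\<theta> * \<phi> B) ^ i * \<phi> B ^ (degree a - i)
        = \<phi> B ^ degree a * ([:coeff a i:] * \<theta> ^ i)"
      using 1[of i] by (simp add: power_mult_distrib kronecker_Const mult_ac)
  qed
qed

lemma homogenize_in_algebra_gen:
  "A \<in> algebra_gen H G \<Longrightarrow> B \<in> algebra_gen H G \<Longrightarrow> homogenize a A B \<in> algebra_gen H G"
  unfolding homogenize_def
  by (intro algebra_gen_sum algebra_gen.mult algebra_gen_power algebra_gen.Const)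

text \<open>
  Gordan's theorem.  Lueroth's theorem in \<open>K[t]\<close> yields \<open>\<theta> = \<phi> A / \<phi> B\<close> with \<open>A, B \<in> K[H, G]\<close>, of which
  \<open>\<phi> H\<close> and \<open>\<phi> G\<close> are polynomials.  Cleared of denominators, these identities hold in \<open>K[H, G]\<close> since
  \<open>\<phi>\<close> is injective there.  The one for \<open>H\<close> is an equation of integral dependence for \<open>A/B\<close>, so \<open>A/B\<close> is a
  polynomial \<open>P\<close>.
\<close>

theorem common_inner_polynomial: "\<exists>P a b. vars_in V P \<and> H = subst a P \<and> G = subst b P"
proof -
  define S where "S = algebra_gen H G"
  define C where "C = {c. \<exists>A\<in>S. \<exists>B\<in>S. \<phi> B \<noteq> 0 \<and> \<phi> A = c * \<phi> B}"
  have one: "1 \<in> S" unfolding S_def using algebra_gen.Const[of 1] by simp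
  have phi_C: "\<phi> x \<in> C" if "x \<in> S" for x
    unfolding C_def using that one by (intro CollectI bexI[of _ x] bexI[of _ 1]) auto
  interpret C: exact_division_closed_subalgebra C "\<phi> H"
  proof
    fix c show "[:c:] \<in> C" using phi_C[of "Const c"] by (simp add: S_def algebra_gen.Const kronecker_Const)
  next
    fix x y assume "x \<in> C" "y \<in> C"
    then obtain A B A' B' where *: "A \<in> S" "B \<in> S" "A' \<in> S" "B' \<in> S" "\<phi> B \<noteq> 0" "\<phi> B' \<noteq> 0"
      "\<phi> A = x * \<phi> B" "\<phi> A' = y * \<phi> B'" unfolding C_def by blast
    have "A * B' + A' * B \<in> S" "B * B' \<in> S" "A * A' \<in> S" using * unfolding S_def
      by (auto intro: algebra_gen.intros)
    moreover have "\<phi> (B * B') \<noteq> 0" "\<phi> (A * B' + A' * B) = (x + y) * \<phi> (B * B')" "\<phi> (A * A') = (x * y) * \<phi> (B * B')"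
      using * by (simp_all add: kronecker.hom_add kronecker.hom_mult algebra_simps)
    ultimately show "x + y \<in> C" "x * y \<in> C" unfolding C_def by blast+
  next
    fix x y assume "x \<in> C" "x \<noteq> 0" "x * y \<in> C"
    then obtain A B A' B' where *: "A \<in> S" "B \<in> S" "A' \<in> S" "B' \<in> S" "\<phi> B \<noteq> 0" "\<phi> B' \<noteq> 0"
      "\<phi> A = x * \<phi> B" "\<phi> A' = x * y * \<phi> B'" unfolding C_def by blast
    have "A' * B \<in> S" "A * B' \<in> S" using * unfolding S_def
      by (auto intro: algebra_gen.intros)
    moreover have "\<phi> (A * B') \<noteq> 0" "\<phi> (A' * B) = y * \<phi> (A * B')"
      using * \<open>x \<noteq> 0\<close> by (simp_all add: kronecker.hom_mult algebra_simps)
    ultimately show "y \<in> C" unfolding C_def by blast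
  next
    show "\<phi> H \<in> C" using phi_C by (simp add: S_def algebra_gen.fst)
    show "0 < degree (\<phi> H)" by (rule degree_phi_H)
  qed
  obtain \<theta> where \<theta>: "\<theta> \<in> C" "\<forall>c\<in>C. \<exists>r. c = pcompose r \<theta>" using C.single_generator by blast
  obtain A B where AB: "A \<in> S" "B \<in> S" "\<phi> B \<noteq> 0" "\<phi> A = \<theta> * \<phi> B" using \<theta>(1) unfolding C_def by blast
  have B0: "B \<noteq> 0" using AB(3) by auto
  have lift: "\<exists>a. \<phi> x = pcompose a \<theta> \<and> B ^ degree a * x = homogenize a A B" if x: "x \<in> S" for x
  proof -
    obtain a where a: "\<phi> x = pcompose a \<theta>" using \<theta>(2) phi_C[OF x] by blast
    have "B ^ degree a * x - homogenize a A B \<in> algebra_gen H G"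
      using AB x unfolding S_def
      by (intro algebra_gen_diff algebra_gen.mult algebra_gen_power homogenize_in_algebra_gen)
    moreover have "\<phi> (B ^ degree a * x - homogenize a A B) = 0"
      using phi_homogenize[OF AB(4)] a
      by (simp add: kronecker.hom_diff kronecker.hom_mult kronecker.hom_power)
    ultimately have "B ^ degree a * x - homogenize a A B = 0" by (rule phi_inj)
    then show ?thesis using a by auto
  qed
  obtain a where a: "\<phi> H = pcompose a \<theta>" "B ^ degree a * H = homogenize a A B"
    using lift[of H] by (auto simp: S_def algebra_gen.fst)
  obtain b where b: "B ^ degree b * G = homogenize b A B"
    using lift[of G] by (auto simp: S_def algebra_gen.snd)
  define k where "k = degree a"
  have k: "k > 0" using degree_phi_H a(1) unfolding k_def by (metis degree_pcompose mult_0 neq0_conv)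
  define l where "l = coeff a k"
  have l: "l \<noteq> 0" using k unfolding l_def k_def by auto
  define Y where "Y i = (if i = 0 then H else 0) - Const (coeff a i)" for i
  have "Const l * A ^ k = (\<Sum>i<k. Y i * A ^ i * B ^ (k - i))"
  proof -
    have "{..k} = insert k {..<k}" by auto
    then have "B ^ k * H = Const l * A ^ k + (\<Sum>i<k. Const (coeff a i) * A ^ i * B ^ (k - i))"
      using a(2) unfolding homogenize_def k_def[symmetric] by (simp add: l_def)
    moreover have "(\<Sum>i<k. (if i = 0 then H else 0) * A ^ i * B ^ (k - i)) = (\<Sum>i<k. if i = 0 then H * B ^ k else 0)"
      by (intro sum.cong) auto
    ultimately show ?thesis using k by (simp add: Y_def left_diff_distrib sum_subtractf algebra_simps)
  qed
  from integral_dvd[OF l this] have dvd: "B ^ j dvd B ^ k * A ^ j" for j .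
  have "vars_in V A" "vars_in V B"
    using AB vars_in_algebra_gen vars unfolding S_def by blast+
  from completely_integrally_closed[OF B0 _ this dvd] B0
  obtain P where P: "vars_in V P" "A = B * P" by auto
  have "H = subst a P" using a(2) B0 unfolding P(2) homogenize_mult by simp
  moreover have "G = subst b P" using b B0 unfolding P(2) homogenize_mult by simp
  ultimately show ?thesis using P(1) by blast
qed

end

section \<open>Total degree\<close>

definition tdeg :: "'k::zero mpoly \<Rightarrow> nat" where "tdeg p = Max (insert 0 (size ` keys p))"

lemma tdeg_ge: "m \<in> keys p \<Longrightarrow> size m \<le> tdeg p" by (simp add: tdeg_def)

lemma tdeg_le_iff: "tdeg p \<le> d \<longleftrightarrow> (\<forall>m\<in>keys p. size m \<le> d)" by (auto simp: tdeg_def)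

lemma tdeg_attained: "tdeg p > 0 \<Longrightarrow> \<exists>m\<in>keys p. size m = tdeg p"
proof -
  assume *: "tdeg p > 0"
  have "tdeg p \<in> insert 0 (size ` keys p)" unfolding tdeg_def by (rule Max_in) auto
  then show ?thesis using * by auto
qed

lemma tdeg_pos_iff: "tdeg p > 0 \<longleftrightarrow> (\<exists>m\<in>keys p. m \<noteq> {#})"
proof
  assume "tdeg p > 0"
  moreover obtain m where "m \<in> keys p" "size m = tdeg p" using tdeg_attained[OF calculation] by blast
  ultimately show "\<exists>m\<in>keys p. m \<noteq> {#}" by (intro bexI[of _ m]) auto
next
  assume "\<exists>m\<in>keys p. m \<noteq> {#}"
  then obtain m where "m \<in> keys p" "m \<noteq> {#}" by blast
  then have "0 < size m" "size m \<le> tdeg p" using tdeg_ge[of m p] nonempty_has_size[of m] by auto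
  then show "tdeg p > 0" by linarith
qed

lemma tdeg_Const [simp]: "tdeg (Const c) = 0"
  by (simp add: tdeg_def Const_def)

lemma eq_Const_if_tdeg_0: "tdeg p = 0 \<Longrightarrow> p = Const (lookup p {#})"
  using tdeg_pos_iff[of p] by (intro poly_mapping_eqI) (auto simp: Const_def lookup_single when_def in_keys_iff)

text \<open>
  The substitution \<open>x\<^sub>i \<mapsto> x\<^sub>i T\<close>, which turns the total degree into the degree in \<open>T\<close>.
\<close>

definition grading :: "'k::comm_ring_1 mpoly \<Rightarrow> 'k mpoly poly" where
  "grading = monomial_hom (\<lambda>c. [:Const c:]) (\<lambda>m. monom (Poly_Mapping.single m 1) (size m))"

interpretation grading: monomial_hom_data "\<lambda>c::'k::comm_ring_1. [:Const c:]" "\<lambda>m. monom (Poly_Mapping.single m 1) (size m)"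
  rewrites "monomial_hom (\<lambda>c::'k. [:Const c:]) (\<lambda>m. monom (Poly_Mapping.single m 1) (size m)) = grading"
  by unfold_locales (simp_all add: Const_add Const_mult mult_monom mult_single grading_def one_pCons monom_0)

lemma lookup_coeff_grading: "lookup (coeff (grading p) k) m = (if size m = k then lookup p m else 0)"
proof -
  have "coeff (grading p) k = (\<Sum>m\<in>keys p. Poly_Mapping.single m (if size m = k then lookup p m else 0))"
    unfolding grading_def monomial_hom_def coeff_sum
    by (intro sum.cong) (auto simp: Const_def mult_single)
  then show ?thesis by (auto simp: lookup_sum lookup_single when_def in_keys_iff)
qed

lemma degree_grading: "degree (grading p) = tdeg p"
proof (rule antisym)
  show "degree (grading p) \<le> tdeg p"
  proof (rule degree_le, intro allI impI poly_mapping_eqI)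
    fix k m assume "tdeg p < k"
    then show "lookup (coeff (grading p) k) m = lookup 0 m"
      using tdeg_ge[of m p] by (cases "m \<in> keys p") (auto simp: lookup_coeff_grading in_keys_iff)
  qed
  show "tdeg p \<le> degree (grading p)"
  proof (cases "tdeg p = 0")
    case False
    then obtain m where m: "m \<in> keys p" "size m = tdeg p" using tdeg_attained[of p] by auto
    have "coeff (grading p) (tdeg p) \<noteq> 0"
      using lookup_coeff_grading[of p "tdeg p" m] m by (metis in_keys_iff lookup_zero)
    then show ?thesis by (rule le_degree)
  qed simp
qed

lemma grading_eq_0_iff: "grading p = 0 \<longleftrightarrow> p = 0"
proof
  assume 0: "grading p = 0"
  show "p = 0"
  proof (rule poly_mapping_eqI)
    fix m show "lookup p m = lookup 0 m" using lookup_coeff_grading[of p "size m" m] 0 by simp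
  qed
qed simp

lemma tdeg_mult:
  fixes p r :: "'k::idom mpoly"
  assumes "p \<noteq> 0" "r \<noteq> 0" shows "tdeg (p * r) = tdeg p + tdeg r"
  using assms by (simp flip: degree_grading add: grading.hom_mult degree_mult_eq grading_eq_0_iff)

lemma tdeg_Const_add: "tdeg (p :: 'k::comm_ring_1 mpoly) > 0 \<Longrightarrow> tdeg (Const c + p) = tdeg p"
proof -
  assume "tdeg p > 0"
  moreover have "degree (grading (Const c)) = 0" by (simp add: degree_grading)
  ultimately show ?thesis
    by (simp flip: degree_grading add: grading.hom_add degree_add_eq_right)
qed

lemma tdeg_subst:
  fixes H :: "'k::idom mpoly"
  assumes H: "tdeg H > 0" and "u \<noteq> 0"
  shows "subst u H \<noteq> 0 \<and> tdeg (subst u H) = degree u * tdeg H"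
  using assms(2)
proof (induction u)
  case (pCons a u)
  have H0: "H \<noteq> 0" using H by (auto simp: tdeg_def)
  show ?case
  proof (cases "u = 0")
    case True then show ?thesis using pCons by (simp add: subst_pCons)
  next
    case False
    with pCons have "subst u H \<noteq> 0" "tdeg (subst u H) = degree u * tdeg H" by auto
    then have "tdeg (H * subst u H) = degree (pCons a u) * tdeg H"
      using tdeg_mult[OF H0] False by simp
    moreover from this have "tdeg (Const a + H * subst u H) = tdeg (H * subst u H)"
      using H False by (intro tdeg_Const_add) simp
    ultimately have "tdeg (subst (pCons a u) H) = degree (pCons a u) * tdeg H" by (simp add: subst_pCons)
    moreover from this have "subst (pCons a u) H \<noteq> 0" using H False by (auto simp: tdeg_def)
    ultimately show ?thesis by simp
  qed
qed simp

corollary tdeg_subst': "tdeg (H :: 'k::idom mpoly) > 0 \<Longrightarrow> tdeg (subst u H) = degree u * tdeg H"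
  using tdeg_subst[of H u] by (cases "u = 0") (auto simp: tdeg_def)

lemma subst_inj:
  fixes H :: "'k::idom mpoly"
  assumes "tdeg H > 0" "subst u H = subst v H" shows "u = v"
proof -
  have "subst (u - v) H + subst v H = subst v H" unfolding subst_add[symmetric] using assms(2) by simp
  then show ?thesis using tdeg_subst[OF assms(1), of "u - v"] by auto
qed

lemma subst_tdeg_0: "tdeg (H :: 'k::comm_ring_1 mpoly) = 0 \<Longrightarrow> tdeg (subst u H) = 0"
proof -
  assume "tdeg H = 0"
  then obtain c where c: "H = Const c" using eq_Const_if_tdeg_0 by blast
  have "subst u H = Const (poly u c)"
    unfolding c by (induction u) (simp_all add: subst_pCons Const_add Const_mult)
  then show ?thesis by simp
qed

section \<open>Existence and uniqueness of decompositions\<close>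

definition mpolys :: "nat \<Rightarrow> 'k::zero mpoly set" where "mpolys n = {p. vars_in {..<n} p}"

definition indec :: "nat \<Rightarrow> 'k::comm_ring_1 mpoly \<Rightarrow> bool" where
  "indec n F \<longleftrightarrow> F \<in> mpolys n \<and> tdeg F > 0 \<and> \<not> (\<exists>H\<in>mpolys n. \<exists>u. 2 \<le> degree u \<and> F = subst u H)"

definition dec :: "nat \<Rightarrow> 'k::comm_ring_1 mpoly \<Rightarrow> bool" where
  "dec n F \<longleftrightarrow> F \<in> mpolys n \<and> tdeg F > 0 \<and> (\<exists>H\<in>mpolys n. \<exists>u. 2 \<le> degree u \<and> F = subst u H)"

text \<open>
  Every nonconstant polynomial is \<open>a H + b\<close> for a unique normed \<open>H\<close> and unique \<open>a \<noteq> 0\<close> and \<open>b\<close>.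
\<close>

definition normed :: "'k::comm_ring_1 mpoly \<Rightarrow> bool" where
  "normed H \<longleftrightarrow> lookup H {#} = 0 \<and> lead_cf H = 1"

lemma lookup_Const_mult: "lookup (Const c * H) m = c * lookup H m" for H :: "'k::comm_ring_1 mpoly"
proof (induction H rule: mpoly_induct)
  case (single n d)
  then show ?case by (simp add: Const_def mult_single lookup_single when_def)
qed (simp add: ring_distribs lookup_add)

lemma subst_linear: "subst [:b, a:] H = Const b + Const a * H"
  by (simp add: subst_pCons mult.commute)

lemma subst_mpolys: "H \<in> mpolys n \<Longrightarrow> subst u H \<in> mpolys n"
  by (simp add: mpolys_def vars_in_subst)

lemma subst_linear_inverse:
  fixes a :: "'k::field"
  assumes "a \<noteq> 0" "F = subst [:b, a:] H" shows "H = subst [:- b / a, 1 / a:] F"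
proof -
  have "subst [:- b / a, 1 / a:] F = subst (pcompose [:- b / a, 1 / a:] [:b, a:]) H"
    using assms(2) by (simp only: subst_pcompose)
  also have "pcompose [:- b / a, 1 / a:] [:b, a:] = [:0, 1:]" using assms(1) by (simp add: pcompose_pCons)
  finally show ?thesis by (simp add: subst_pCons)
qed

lemma degree_1_obtain:
  assumes "degree u = 1" obtains b a where "u = [:b, a:]" "a \<noteq> 0"
  using assms by (metis degree_eq_zeroE degree_pCons_eq_if nat.simps(3) One_nat_def old.nat.inject pCons_cases pCons_eq_0_iff zero_neq_one)

lemma indec_subst_linear:
  fixes a :: "'k::field"
  assumes "a \<noteq> 0" "indec n H" shows "indec n (subst [:b, a:] H)"
proof -
  let ?F = "subst [:b, a:] H"
  have "tdeg ?F = tdeg H" using assms tdeg_subst'[of H "[:b, a:]"] by (simp add: indec_def)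
  moreover have False if "G \<in> mpolys n" "2 \<le> degree u" "?F = subst u G" for G u
  proof -
    have "H = subst (pcompose [:- b / a, 1 / a:] u) G"
      using subst_linear_inverse[OF assms(1), of ?F b H, OF refl] that(3) by (simp add: subst_pcompose)
    moreover have "degree (pcompose [:- b / a, 1 / a:] u) = degree u"
      using assms(1) by (simp add: degree_pcompose)
    ultimately show False using assms(2) that unfolding indec_def by metis
  qed
  ultimately show ?thesis using assms(2) subst_mpolys unfolding indec_def by auto
qed

lemma normalize_exists:
  fixes F :: "'k::field mpoly"
  assumes "tdeg F > 0"
  shows "\<exists>b a H. a \<noteq> 0 \<and> F = subst [:b, a:] H \<and> normed H"
proof -
  have F0: "F \<noteq> 0" using assms by (auto simp: tdeg_def)
  obtain m where m: "m \<in> keys F" "m \<noteq> {#}" using assms tdeg_pos_iff by blast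
  then have ne: "lead_mon F \<noteq> {#}" using lead_mon_ge[OF m(1)] by auto
  define a b where "a = lead_cf F" and "b = lookup F {#}"
  have a: "a \<noteq> 0" using lead_cf_nonzero[OF F0] by (simp add: a_def)
  define H where "H = subst [:- b / a, 1 / a:] F"
  have lk: "lookup H m = (if m = {#} then 0 else lookup F m / a)" for m
    unfolding H_def subst_linear lookup_add lookup_Const_mult
    by (simp add: Const_def lookup_single when_def b_def)
  have "lead_mon H = lead_mon F"
    using ne a lead_mon_ge[of _ F]
    by (intro lead_mon_eqI) (auto simp: lk a_def[symmetric] in_keys_iff split: if_splits)
  then have "normed H" using ne a by (simp add: normed_def lk a_def)
  moreover have "F = subst [:b, a:] H"
    using subst_linear_inverse[of "1 / a" H "- b / a" F] a by (simp add: H_def)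
  ultimately show ?thesis using a by blast
qed

lemma normed_unique:
  fixes H G :: "'k::field mpoly"
  assumes "normed H" "normed G" "G = subst [:b, a:] H"
  shows "G = H" "b = 0" "a = 1"
proof -
  have lk: "lookup G m = (if m = {#} then b else 0) + a * lookup H m" for m
    unfolding assms(3) subst_linear lookup_add lookup_Const_mult
    by (simp add: Const_def lookup_single when_def)
  show b: "b = 0" using lk[of "{#}"] assms by (simp add: normed_def)
  have a: "a \<noteq> 0"
  proof
    assume "a = 0"
    then have "lookup G (lead_mon G) = 0" using lk b by simp
    then show False using assms by (simp add: normed_def)
  qed
  have "keys G = keys H" using lk a b by (auto simp: in_keys_iff)
  then have "lead_mon G = lead_mon H" by (simp add: lead_mon_def)
  then show "a = 1" using lk[of "lead_mon G"] assms(1,2) b by (auto simp: normed_def split: if_splits)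
  then show "G = H" using b lk by (intro poly_mapping_eqI) simp
qed

lemma decomposition_exists:
  fixes F :: "'k::field mpoly"
  assumes "F \<in> mpolys n" "tdeg F > 0"
  shows "\<exists>H u. indec n H \<and> normed H \<and> degree u > 0 \<and> F = subst u H"
  using assms
proof (induction "tdeg F" arbitrary: F rule: less_induct)
  case less
  show ?case
  proof (cases "indec n F")
    case True
    obtain b a H where *: "a \<noteq> 0" "F = subst [:b, a:] H" "normed H"
      using normalize_exists less.prems(2) by blast
    have "indec n (subst [:- b / a, 1 / a:] F)" using True *(1) by (intro indec_subst_linear) simp_all
    then have "indec n H" unfolding subst_linear_inverse[OF *(1,2), symmetric] .
    then show ?thesis using * by (intro exI[of _ H] exI[of _ "[:b, a:]"]) simp
  next
    case False
    then obtain G w where G: "G \<in> mpolys n" "2 \<le> degree w" "F = subst w G"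
      using less.prems unfolding indec_def by blast
    have pos: "tdeg G > 0" using subst_tdeg_0[of G w] G less.prems(2) by (metis gr0I less_irrefl)
    then have "tdeg G < tdeg F" using tdeg_subst'[OF pos, of w] G by simp
    from less.hyps[OF this G(1) pos] obtain H u where "indec n H" "normed H" "degree u > 0" "G = subst u H" by blast
    then show ?thesis using G by (intro exI[of _ H] exI[of _ "pcompose w u"]) (auto simp: subst_pcompose degree_pcompose)
  qed
qed

text \<open>
  By Gordan's theorem \<open>H\<close> and \<open>G\<close> are polynomials in a common \<open>P\<close>, of degree \<open>1\<close> because they are
  indecomposable.  So each is an affine function of the other, and normed polynomials related in this
  way are equal.
\<close>

lemma decomposition_unique:
  fixes H G :: "'k::field_gcd mpoly"
  assumes "indec n H" "normed H" "degree u > 0" "indec n G" "normed G" "degree v > 0"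
    and eq: "subst u H = subst v G"
  shows "H = G" "u = v"
proof -
  interpret dependent_pair H G u v "{..<n}"
    by unfold_locales (use assms in \<open>auto simp: indec_def mpolys_def tdeg_pos_iff\<close>)
  obtain P a b where P: "vars_in {..<n} P" "H = subst a P" "G = subst b P"
    using common_inner_polynomial by blast
  have deg1: "degree a = 1" if "indec n (subst a P)" for a
  proof (rule ccontr)
    assume "degree a \<noteq> 1"
    moreover have "degree a \<noteq> 0" using that tdeg_subst'[of P a] subst_tdeg_0[of P a] unfolding indec_def
      by (metis gr0I less_irrefl mult_0)
    ultimately have "2 \<le> degree a" by simp
    then show False using that P(1) unfolding indec_def mpolys_def by blast
  qed
  obtain a0 a1 b0 b1 where ab: "a = [:a0, a1:]" "a1 \<noteq> 0" "b = [:b0, b1:]"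
    using deg1[of a] deg1[of b] assms P degree_1_obtain by metis
  have "G = subst (pcompose b [:- a0 / a1, 1 / a1:]) H"
    using subst_linear_inverse[OF ab(2), of H a0 P] P ab by (simp add: subst_pcompose)
  then have "G = subst [:b0 - b1 * a0 / a1, b1 / a1:] H" by (simp add: ab pcompose_pCons)
  then show "H = G" using normed_unique assms by metis
  then show "u = v" using eq subst_inj[of H u v] assms by (simp add: indec_def)
qed

lemma dec_subst_iff:
  fixes H :: "'k::field_gcd mpoly"
  assumes "indec n H" "degree u > 0"
  shows "dec n (subst u H) \<longleftrightarrow> 2 \<le> degree u"
proof
  assume d: "dec n (subst u H)"
  show "2 \<le> degree u"
  proof (rule ccontr)
    assume "\<not> ?thesis"
    then have "degree u = 1" using assms by simp
    then obtain b a where "u = [:b, a:]" "a \<noteq> 0" by (rule degree_1_obtain)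
    then have "indec n (subst u H)" using indec_subst_linear assms by blast
    then show False using d by (auto simp: indec_def dec_def)
  qed
next
  assume "2 \<le> degree u"
  then show "dec n (subst u H)"
    using assms tdeg_subst'[of H u] subst_mpolys[of H n u] unfolding dec_def indec_def by auto
qed

section \<open>Counting\<close>

definition mons :: "nat \<Rightarrow> nat \<Rightarrow> nat multiset set" where
  "mons n d = {m. set_mset m \<subseteq> {..<n} \<and> size m \<le> d}"

lemma finite_mons: "finite (mons n d)"
proof (rule finite_subset)
  show "mons n d \<subseteq> mset ` {xs. set xs \<subseteq> {..<n} \<and> length xs \<le> d}"
  proof
    fix m assume m: "m \<in> mons n d"
    obtain xs where "m = mset xs" using ex_mset[of m] by auto
    with m show "m \<in> mset ` {xs. set xs \<subseteq> {..<n} \<and> length xs \<le> d}" by (auto simp: mons_def)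
  qed
  show "finite (mset ` {xs. set xs \<subseteq> {..<n} \<and> length xs \<le> d})"
    by (intro finite_imageI finite_lists_length_le) simp
qed

lemma card_keys_subset:
  assumes "finite A"
  shows "card {p :: 'k::{finite,comm_ring_1} mpoly. keys p \<subseteq> A} = CARD('k) ^ card A"
    and "finite {p :: 'k mpoly. keys p \<subseteq> A}"
proof -
  have bij: "bij_betw (\<lambda>p. restrict (lookup p) A) {p :: 'k mpoly. keys p \<subseteq> A} (A \<rightarrow>\<^sub>E UNIV)"
  proof (rule bij_betwI')
    fix p r :: "'k mpoly" assume *: "p \<in> {p. keys p \<subseteq> A}" "r \<in> {p. keys p \<subseteq> A}"
    show "(restrict (lookup p) A = restrict (lookup r) A) = (p = r)"
    proof
      assume eq: "restrict (lookup p) A = restrict (lookup r) A"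
      show "p = r"
      proof (rule poly_mapping_eqI)
        fix m show "lookup p m = lookup r m"
        proof (cases "m \<in> A")
          case True then show ?thesis using fun_cong[OF eq, of m] by simp
        next
          case False
          then have "m \<notin> keys p" "m \<notin> keys r" using * by auto
          then show ?thesis by (simp add: in_keys_iff)
        qed
      qed
    qed simp
  next
    fix f :: "nat multiset \<Rightarrow> 'k" assume f: "f \<in> A \<rightarrow>\<^sub>E UNIV"
    define p where "p = (\<Sum>m\<in>A. Poly_Mapping.single m (f m))"
    have lk: "lookup p m = (if m \<in> A then f m else 0)" for m
      using assms by (simp add: p_def lookup_sum lookup_single when_def)
    have "keys p \<subseteq> A" by (auto simp: in_keys_iff lk split: if_splits)
    moreover have "f = restrict (lookup p) A" using f by (auto simp: lk fun_eq_iff PiE_def extensional_def)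
    ultimately show "\<exists>p\<in>{p. keys p \<subseteq> A}. f = restrict (lookup p) A" by blast
  qed auto
  show "card {p :: 'k mpoly. keys p \<subseteq> A} = CARD('k) ^ card A"
    using bij_betw_same_card[OF bij] assms by (simp add: card_PiE)
  have "finite (A \<rightarrow>\<^sub>E (UNIV :: 'k set))" using assms by (intro finite_PiE) auto
  then show "finite {p :: 'k mpoly. keys p \<subseteq> A}" using bij_betw_finite[OF bij] by blast
qed

lemma mpolys_tdeg_le: "{p \<in> mpolys n. tdeg p \<le> d} = {p. keys p \<subseteq> mons n d}"
  by (auto simp: mpolys_def vars_in_def tdeg_le_iff mons_def subset_iff)

lemma finite_mpolys_tdeg: "finite {p :: 'k::{finite,comm_ring_1} mpoly. p \<in> mpolys n \<and> tdeg p = d}"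
proof (rule finite_subset)
  show "{p :: 'k mpoly. p \<in> mpolys n \<and> tdeg p = d} \<subseteq> {p \<in> mpolys n. tdeg p \<le> d}" by auto
  show "finite {p :: 'k mpoly. p \<in> mpolys n \<and> tdeg p \<le> d}"
    unfolding mpolys_tdeg_le by (intro card_keys_subset finite_mons)
qed

lemma card_mpolys_tdeg:
  assumes "d > 0"
  shows "card {p :: 'k::{finite,comm_ring_1} mpoly. p \<in> mpolys n \<and> tdeg p = d}
    = CARD('k) ^ card (mons n d) - CARD('k) ^ card (mons n (d - 1))"
proof -
  have "{p :: 'k mpoly. p \<in> mpolys n \<and> tdeg p = d} = {p \<in> mpolys n. tdeg p \<le> d} - {p \<in> mpolys n. tdeg p \<le> d - 1}"
    using assms by auto
  also have "card \<dots> = card {p :: 'k mpoly. p \<in> mpolys n \<and> tdeg p \<le> d} - card {p :: 'k mpoly. p \<in> mpolys n \<and> tdeg p \<le> d - 1}"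
  proof (rule card_Diff_subset)
    show "finite {p :: 'k mpoly. p \<in> mpolys n \<and> tdeg p \<le> d - 1}"
      unfolding mpolys_tdeg_le by (intro card_keys_subset finite_mons)
  qed auto
  finally show ?thesis by (simp add: mpolys_tdeg_le card_keys_subset(1) finite_mons)
qed

lemma card_poly_degree_le:
  "finite {u :: 'k::{finite,comm_ring_1} poly. degree u \<le> k} \<and> card {u :: 'k poly. degree u \<le> k} = CARD('k) ^ Suc k"
proof (induction k)
  case 0
  have "{u :: 'k poly. degree u \<le> 0} = range (\<lambda>c. [:c:])" by (auto elim: degree_eq_zeroE)
  moreover have "inj (\<lambda>c :: 'k. [:c:])" by (rule injI) simp
  ultimately show ?case by (simp add: card_image)
next
  case (Suc k)
  have eq: "{u :: 'k poly. degree u \<le> Suc k} = (\<lambda>(a, u). pCons a u) ` (UNIV \<times> {u. degree u \<le> k})"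
  proof (intro equalityI subsetI)
    fix u :: "'k poly" assume u: "u \<in> {u. degree u \<le> Suc k}"
    obtain a v where "u = pCons a v" by (cases u)
    then show "u \<in> (\<lambda>(a, u). pCons a u) ` (UNIV \<times> {u. degree u \<le> k})"
      using u by (auto simp: image_iff degree_pCons_eq_if split: if_splits)
  qed (auto simp: degree_pCons_eq_if)
  have "inj_on (\<lambda>(a, u). pCons a u) (UNIV \<times> {u :: 'k poly. degree u \<le> k})" by (auto simp: inj_on_def)
  then show ?case unfolding eq using Suc by (auto simp: card_image card_cartesian_product)
qed

lemma card_poly_degree_eq:
  assumes "k > 0"
  shows "finite {u :: 'k::{finite,comm_ring_1} poly. degree u = k}"
    "card {u :: 'k poly. degree u = k} = (CARD('k) - 1) * CARD('k) ^ k"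
proof -
  have eq: "{u :: 'k poly. degree u = k} = {u. degree u \<le> k} - {u. degree u \<le> k - 1}" using assms by auto
  show "finite {u :: 'k poly. degree u = k}" unfolding eq using card_poly_degree_le by blast
  have "card {u :: 'k poly. degree u = k} = card {u :: 'k poly. degree u \<le> k} - card {u :: 'k poly. degree u \<le> k - 1}"
    unfolding eq using card_poly_degree_le by (intro card_Diff_subset) auto
  then show "card {u :: 'k poly. degree u = k} = (CARD('k) - 1) * CARD('k) ^ k"
    using assms by (cases k) (simp_all add: card_poly_degree_le diff_mult_distrib)
qed

definition normed_indecs :: "nat \<Rightarrow> nat \<Rightarrow> 'k::comm_ring_1 mpoly set" where
  "normed_indecs n e = {H. indec n H \<and> normed H \<and> tdeg H = e}"

lemma finite_normed_indecs: "finite (normed_indecs n e :: 'k::{finite,comm_ring_1} mpoly set)"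
  by (rule finite_subset[OF _ finite_mpolys_tdeg[of n e]]) (auto simp: normed_indecs_def indec_def)

text \<open>
  The factor counts the affine functions \<open>a y + b\<close> with \<open>a \<noteq> 0\<close> that are applied to a normed polynomial.
\<close>

lemma card_indec:
  "card {H :: 'k::{finite,field_gcd} mpoly. indec n H \<and> tdeg H = e}
    = (CARD('k) - 1) * CARD('k) * card (normed_indecs n e :: 'k mpoly set)"
proof -
  let ?S = "(normed_indecs n e :: 'k mpoly set) \<times> (UNIV :: 'k set) \<times> (UNIV - {0} :: 'k set)"
  have "bij_betw (\<lambda>(H, b, a). subst [:b, a:] H) ?S {H. indec n H \<and> tdeg H = e}"
    unfolding bij_betw_def
  proof
    show "inj_on (\<lambda>(H, b, a). subst [:b, a:] H) ?S"
    proof (rule inj_onI)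
      fix x y assume x: "x \<in> ?S" and y: "y \<in> ?S"
        and "(\<lambda>(H, b, a). subst [:b, a:] H) x = (\<lambda>(H, b, a). subst [:b, a:] H) y"
      moreover obtain H b a G b' a' where xy: "x = (H, b, a)" "y = (G, b', a')" by (cases x, cases y)
      ultimately have eq: "subst [:b, a:] H = subst [:b', a':] G" by simp
      have "H = G" "[:b, a:] = [:b', a':]"
        using decomposition_unique[of n H "[:b, a:]" G "[:b', a':]"] x y xy eq
        by (simp_all add: normed_indecs_def)
      then show "x = y" using xy by simp
    qed
    show "(\<lambda>(H, b, a). subst [:b, a:] H) ` ?S = {H. indec n H \<and> tdeg H = e}"
    proof (intro equalityI subsetI)
      fix F assume "F \<in> (\<lambda>(H, b, a). subst [:b, a:] H) ` ?S"
      then obtain H b a where "H \<in> normed_indecs n e" "a \<noteq> 0" "F = subst [:b, a:] H" by auto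
      then show "F \<in> {H. indec n H \<and> tdeg H = e}"
        using indec_subst_linear[of a n H b] tdeg_subst'[of H "[:b, a:]"]
        by (auto simp: normed_indecs_def indec_def)
    next
      fix F :: "'k mpoly" assume "F \<in> {H. indec n H \<and> tdeg H = e}"
      then have F: "indec n F" "tdeg F = e" by auto
      then have "tdeg F > 0" by (simp add: indec_def)
      then obtain b a H where *: "a \<noteq> 0" "F = subst [:b, a:] H" "normed H" using normalize_exists by blast
      have H: "H = subst [:- b / a, 1 / a:] F" by (rule subst_linear_inverse[OF *(1,2)])
      have "indec n (subst [:- b / a, 1 / a:] F)" using F(1) *(1) by (intro indec_subst_linear) simp_all
      moreover have "tdeg (subst [:- b / a, 1 / a:] F) = e" using F *(1) tdeg_subst'[of F "[:- b / a, 1 / a:]"]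
        by (simp add: indec_def)
      ultimately have "H \<in> normed_indecs n e" using *(3) unfolding H[symmetric] normed_indecs_def by simp
      then have "(H, b, a) \<in> ?S" using *(1) by simp
      then show "F \<in> (\<lambda>(H, b, a). subst [:b, a:] H) ` ?S" 
        by (rule rev_image_eqI) (simp add: *(2))
    qed
  qed
  from bij_betw_same_card[OF this] show ?thesis
    by (simp add: card_cartesian_product mult_ac card_Diff_singleton)
qed

text \<open>
  The pairs of a normed indecomposable \<open>H\<close> of degree \<open>e\<close> and a \<open>u\<close> of degree \<open>d div e\<close>, with \<open>e\<close>
  running through the proper divisors of \<open>d\<close>, correspond bijectively to the decomposable polynomials of
  degree \<open>d\<close>.  Passing from normed to arbitrary indecomposable polynomials turns the factor
  \<open>(q - 1) q ^ (d div e)\<close> for \<open>u\<close> into \<open>q ^ (d div e - 1)\<close>.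
\<close>

lemma card_dec:
  assumes "d > 0"
  shows "card {F :: 'k::{finite,field_gcd} mpoly. dec n F \<and> tdeg F = d}
    = (\<Sum>e | e dvd d \<and> e < d. CARD('k) ^ (d div e - 1) * card {H :: 'k mpoly. indec n H \<and> tdeg H = e})"
proof -
  define E where "E = {e. e dvd d \<and> e < d}"
  have fin: "finite E" unfolding E_def by (rule finite_subset[of _ "{..<d}"]) auto
  have E: "e > 0" "d div e > 1" "d div e * e = d" if "e \<in> E" for e
  proof -
    show "e > 0" using that assms by (auto simp: E_def intro: Nat.gr0I)
    show eq: "d div e * e = d" using that by (simp add: E_def)
    have "d div e \<noteq> 0" "d div e \<noteq> 1" using eq that assms by (auto simp: E_def)
    then show "d div e > 1" by linarith
  qed
  define S where "S e = (normed_indecs n e :: 'k mpoly set) \<times> {u :: 'k poly. degree u = d div e}" for e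
  have finS: "finite (S e)" if "e \<in> E" for e
    unfolding S_def using E[OF that] by (intro finite_cartesian_product finite_normed_indecs card_poly_degree_eq) auto
  have bij: "bij_betw (\<lambda>(H, u). subst u H) (\<Union>e\<in>E. S e) {F. dec n F \<and> tdeg F = d}"
    unfolding bij_betw_def
  proof
    show "inj_on (\<lambda>(H, u). subst u H) (\<Union>e\<in>E. S e)"
    proof (rule inj_onI, clarify)
      fix H G :: "'k mpoly" and u v e e'
      assume *: "e \<in> E" "e' \<in> E" "(H, u) \<in> S e" "(G, v) \<in> S e'" "subst u H = subst v G"
      then have "degree u > 0" "degree v > 0" using E[of e] E[of e'] by (auto simp: S_def)
      then show "H = G \<and> u = v"
        using decomposition_unique[of n H u G v] * by (auto simp: S_def normed_indecs_def)
    qed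
    show "(\<lambda>(H, u). subst u H) ` (\<Union>e\<in>E. S e) = {F. dec n F \<and> tdeg F = d}"
    proof (intro equalityI subsetI)
      fix F assume "F \<in> (\<lambda>(H, u). subst u H) ` (\<Union>e\<in>E. S e)"
      then obtain H u e where *: "e \<in> E" "(H, u) \<in> S e" "F = subst u H" by auto
      then have H: "indec n H" "tdeg H = e" "degree u = d div e" by (auto simp: S_def normed_indecs_def)
      have "dec n F" using dec_subst_iff[OF H(1), of u] E[OF *(1)] H(3) *(3) by simp
      moreover have "tdeg F = d" using tdeg_subst'[of H u] E[OF *(1)] H *(3) by simp
      ultimately show "F \<in> {F. dec n F \<and> tdeg F = d}" by simp
    next
      fix F :: "'k mpoly" assume "F \<in> {F. dec n F \<and> tdeg F = d}"
      then have F: "dec n F" "tdeg F = d" by auto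
      then obtain H u where H: "indec n H" "normed H" "degree u > 0" "F = subst u H"
        using decomposition_exists[of F n] by (auto simp: dec_def)
      have u: "2 \<le> degree u" using dec_subst_iff[OF H(1,3)] F(1) H(4) by simp
      have pos: "tdeg H > 0" using H(1) by (simp add: indec_def)
      have d: "d = degree u * tdeg H" using tdeg_subst'[OF pos, of u] F(2) H(4) by simp
      have "tdeg H \<in> E" unfolding E_def using d u pos by auto
      moreover have "(H, u) \<in> S (tdeg H)" unfolding S_def normed_indecs_def using H d pos by simp
      ultimately show "F \<in> (\<lambda>(H, u). subst u H) ` (\<Union>e\<in>E. S e)" using H(4) by force
    qed
  qed
  have "card (\<Union>e\<in>E. S e) = (\<Sum>e\<in>E. card (S e))"
    using fin finS by (intro card_UN_disjoint) (auto simp: S_def normed_indecs_def)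
  also have "\<dots> = (\<Sum>e\<in>E. CARD('k) ^ (d div e - 1) * card {H :: 'k mpoly. indec n H \<and> tdeg H = e})"
  proof (rule sum.cong[OF refl])
    fix e assume e: "e \<in> E"
    have "CARD('k) ^ (d div e) = CARD('k) ^ (d div e - 1) * CARD('k)"
      using E(2)[OF e] by (metis Suc_diff_1 less_trans power_Suc2 zero_less_one)
    then show "card (S e) = CARD('k) ^ (d div e - 1) * card {H :: 'k mpoly. indec n H \<and> tdeg H = e}"
      unfolding S_def card_cartesian_product card_indec using E[OF e]
      by (subst card_poly_degree_eq(2)) auto
  qed
  finally show ?thesis using bij_betw_same_card[OF bij] by (simp add: E_def)
qed

lemma card_indec_add_card_dec:
  assumes "d > 0"
  shows "card {F :: 'k::{finite,comm_ring_1} mpoly. indec n F \<and> tdeg F = d} + card {F :: 'k mpoly. dec n F \<and> tdeg F = d}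
    = card {F :: 'k mpoly. F \<in> mpolys n \<and> tdeg F = d}"
proof -
  have "{F :: 'k mpoly. F \<in> mpolys n \<and> tdeg F = d} = {F. indec n F \<and> tdeg F = d} \<union> {F. dec n F \<and> tdeg F = d}"
    using assms by (auto simp: indec_def dec_def)
  moreover have "finite {F :: 'k mpoly. indec n F \<and> tdeg F = d}" "finite {F :: 'k mpoly. dec n F \<and> tdeg F = d}"
    by (rule finite_subset[OF _ finite_mpolys_tdeg[of n d]]; auto simp: indec_def dec_def)+
  ultimately show ?thesis
    by (simp only:) (rule card_Un_disjoint[symmetric], auto simp: indec_def dec_def)
qed

section \<open>Polynomials over carrier-based finite fields\<close>

lemma lookup_single_mult:
  fixes r :: "'k::comm_ring_1 mpoly"
  shows "lookup (Poly_Mapping.single n c * r) m = (if n \<subseteq># m then c * lookup r (m - n) else 0)"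
proof (induction r rule: mpoly_induct)
  case (single k d)
  have "n + k = m \<longleftrightarrow> n \<subseteq># m \<and> k = m - n" by (metis add_diff_cancel_left' mset_subset_eq_add_left subset_mset.add_diff_inverse)
  then show ?case by (auto simp: mult_single lookup_single when_def)
next
  case (add p q)
  then show ?case by (simp add: ring_distribs lookup_add)
qed

lemma finite_submultisets: "finite {a. a \<subseteq># (m :: nat multiset)}"
proof -
  obtain k where k: "\<forall>i\<in>set_mset m. i < k" by (meson finite_nat_set_iff_bounded finite_set_mset)
  have "set_mset a \<subseteq> {..<k} \<and> size a \<le> size m" if "a \<subseteq># m" for a
    using that k by (auto dest: mset_subset_eqD size_mset_mono)
  then have "{a. a \<subseteq># m} \<subseteq> mons k (size m)" by (auto simp: mons_def)
  then show ?thesis using finite_mons by (rule finite_subset)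
qed

lemma lookup_mult_submultisets:
  fixes p r :: "'k::comm_ring_1 mpoly"
  shows "lookup (p * r) m = (\<Sum>a\<in>{a. a \<subseteq># m}. lookup p a * lookup r (m - a))"
proof (induction p rule: mpoly_induct)
  case (single n c)
  have "(\<Sum>a\<in>{a. a \<subseteq># m}. lookup (Poly_Mapping.single n c) a * lookup r (m - a))
      = (\<Sum>a\<in>{a. a \<subseteq># m}. if a = n then c * lookup r (m - n) else 0)"
    by (intro sum.cong) (auto simp: lookup_single when_def)
  then show ?case by (simp add: lookup_single_mult finite_submultisets)
next
  case (add p q)
  then show ?case by (simp add: ring_distribs lookup_add sum.distrib)
qed

text \<open>
  The polynomials over a type form a ring in the carrier-based sense.  Its image under an isomorphism is
  the ring \<open>mpoly_ring K n\<close>, which thereby inherits the ring axioms.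
\<close>

definition mpoly_class_ring :: "nat \<Rightarrow> 'k::comm_ring_1 mpoly ring" where
  "mpoly_class_ring n = \<lparr>carrier = mpolys n, monoid.mult = (*), one = 1, zero = 0, add = (+)\<rparr>"

lemma mpolys_closed:
  fixes p r :: "'k::comm_ring_1 mpoly"
  shows "0 \<in> mpolys n" "1 \<in> mpolys n"
    "p \<in> mpolys n \<Longrightarrow> r \<in> mpolys n \<Longrightarrow> p + r \<in> mpolys n"
    "p \<in> mpolys n \<Longrightarrow> r \<in> mpolys n \<Longrightarrow> p - r \<in> mpolys n"
    "p \<in> mpolys n \<Longrightarrow> r \<in> mpolys n \<Longrightarrow> p * r \<in> mpolys n"
    "Const c \<in> mpolys n"
    "p \<in> mpolys n \<Longrightarrow> p ^ i \<in> mpolys n"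
proof -
  show "0 \<in> mpolys n" by (simp add: mpolys_def vars_in_def)
  show one: "1 \<in> mpolys n" by (simp add: mpolys_def vars_in_def)
  show mult: "p * r \<in> mpolys n" if "p \<in> mpolys n" "r \<in> mpolys n" for p r :: "'k mpoly"
    using that by (simp add: mpolys_def vars_in_mult)
  show "p ^ i \<in> mpolys n" if "p \<in> mpolys n"
    by (induction i) (auto intro: one mult that)
qed (auto simp: mpolys_def vars_in_Const intro: vars_in_add vars_in_diff)

lemma cring_mpoly_class_ring: "cring (mpoly_class_ring n :: 'k::comm_ring_1 mpoly ring)"
proof (rule cringI)
  show "abelian_group (mpoly_class_ring n :: 'k mpoly ring)"
  proof (rule abelian_groupI)
    fix x :: "'k mpoly" assume "x \<in> carrier (mpoly_class_ring n)"
    then show "\<exists>y\<in>carrier (mpoly_class_ring n). y \<oplus>\<^bsub>mpoly_class_ring n\<^esub> x = \<zero>\<^bsub>mpoly_class_ring n\<^esub>"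
      using mpolys_closed(4)[OF mpolys_closed(1), of x n]
      by (intro bexI[of _ "0 - x"]) (simp_all add: mpoly_class_ring_def)
  qed (simp_all add: mpoly_class_ring_def mpolys_closed add_ac)
  show "comm_monoid (mpoly_class_ring n :: 'k mpoly ring)"
    by (rule comm_monoidI) (simp_all add: mpoly_class_ring_def mpolys_closed mult_ac)
qed (simp add: mpoly_class_ring_def distrib_right)

locale finite_field_copy =
  fixes K :: "'a ring" and \<iota> :: "'k::{field_gcd,finite} \<Rightarrow> 'a"
  assumes field_K: "field K" and bij: "bij_betw \<iota> UNIV (carrier K)"
    and iota_add: "\<iota> (x + y) = \<iota> x \<oplus>\<^bsub>K\<^esub> \<iota> y"
    and iota_mult: "\<iota> (x * y) = \<iota> x \<otimes>\<^bsub>K\<^esub> \<iota> y"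
    and iota_one: "\<iota> 1 = \<one>\<^bsub>K\<^esub>"
begin

interpretation K: field K by (rule field_K)

lemma iota_closed [simp]: "\<iota> x \<in> carrier K" using bij by (auto simp: bij_betw_def)
lemma iota_inj [simp]: "\<iota> x = \<iota> y \<longleftrightarrow> x = y" using bij by (auto simp: bij_betw_def dest: injD)
lemma iota_surj: "c \<in> carrier K \<Longrightarrow> \<exists>x. c = \<iota> x" using bij by (auto simp: bij_betw_def)

lemma iota_zero: "\<iota> 0 = \<zero>\<^bsub>K\<^esub>"
  using iota_add[of 0 0] K.add.l_cancel_one'[of "\<iota> 0" "\<iota> 0"] by simp
lemma iota_eq_zero_iff [simp]: "\<iota> x = \<zero>\<^bsub>K\<^esub> \<longleftrightarrow> x = 0" by (simp flip: iota_zero)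

lemma iota_sum: "finite A \<Longrightarrow> \<iota> (\<Sum>a\<in>A. f a) = (\<Oplus>\<^bsub>K\<^esub>a\<in>A. \<iota> (f a))"
  by (induction A rule: finite_induct) (simp_all add: iota_zero iota_add K.finsum_insert Pi_def)

text \<open>
  \<open>\<iota>\<close> applied to all coefficients, for polynomials in several variables; below, \<open>\<Upsilon>\<close> does the same for one
  variable.  Both commute with substitution (\<open>poly_subst_Psi\<close>), so they preserve decompositions.
\<close>

definition \<Psi> :: "'k mpoly \<Rightarrow> nat multiset \<Rightarrow> 'a" where "\<Psi> p = (\<lambda>m. \<iota> (lookup p m))"

lemma Psi_inj: "\<Psi> p = \<Psi> r \<Longrightarrow> p = r"
  by (rule poly_mapping_eqI) (auto simp: \<Psi>_def fun_eq_iff)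

lemma Psi_add: "\<Psi> (p + r) = K.indexed_padd (\<Psi> p) (\<Psi> r)"
  by (simp add: \<Psi>_def K.indexed_padd_def lookup_add iota_add)

lemma Psi_Const: "\<Psi> (Const c) = K.indexed_const (\<iota> c)"
  by (auto simp: \<Psi>_def K.indexed_const_def Const_def lookup_single when_def iota_zero)

lemma Psi_var_mult: "\<Psi> (Poly_Mapping.single {#i#} 1 * p) = K.indexed_pmult (\<Psi> p) i"
  by (auto simp: \<Psi>_def K.indexed_pmult_def lookup_single_mult iota_zero fun_eq_iff)

lemma Psi_single_mem:
  "set_mset m \<subseteq> {..<n} \<Longrightarrow> \<Psi> (Poly_Mapping.single m c) \<in> K.indexed_pset {..<n} (carrier K)"
proof (induction m)
  case empty
  show ?case using Psi_Const[of c] K.indexed_pset.indexed_const[of "\<iota> c" "carrier K" "{..<n}"] by (simp add: Const_def)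
next
  case (add i m)
  have "\<Psi> (Poly_Mapping.single (add_mset i m) c) = K.indexed_pmult (\<Psi> (Poly_Mapping.single m c)) i"
    unfolding Psi_var_mult[symmetric] by (simp add: mult_single)
  then show ?case using add by (auto intro: K.indexed_pset.indexed_pmult)
qed

lemma Psi_mem: assumes "p \<in> mpolys n" shows "\<Psi> p \<in> K.indexed_pset {..<n} (carrier K)"
proof -
  have "\<Psi> (\<Sum>m\<in>A. Poly_Mapping.single m (lookup p m)) \<in> K.indexed_pset {..<n} (carrier K)"
    if "finite A" "A \<subseteq> keys p" for A
    using that
  proof (induction A rule: finite_induct)
    case empty
    show ?case using Psi_single_mem[of "{#}" n 0] by simp
  next
    case (insert m A)
    then have "set_mset m \<subseteq> {..<n}" using assms by (auto simp: mpolys_def vars_in_def)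
    then show ?case using insert by (auto simp: Psi_add intro: K.indexed_pset.indexed_padd Psi_single_mem)
  qed
  from this[of "keys p"] show ?thesis using sum_singles[of p] by simp
qed

lemma Psi_surj: assumes "Q \<in> K.indexed_pset {..<n} (carrier K)" shows "\<exists>p\<in>mpolys n. Q = \<Psi> p"
  using assms
proof induction
  case (indexed_const k)
  then show ?case using iota_surj[of k] Psi_Const mpolys_closed(6) by metis
next
  case (indexed_padd P Q)
  then show ?case using Psi_add mpolys_closed(3) by metis
next
  case (indexed_pmult P i)
  then obtain p where p: "p \<in> mpolys n" "P = \<Psi> p" by blast
  have "Poly_Mapping.single {#i#} 1 \<in> mpolys n" using indexed_pmult.hyps by (simp add: mpolys_def vars_in_single)
  then show ?case using p Psi_var_mult mpolys_closed(5) by metis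
qed

lemma Psi_bij: "bij_betw \<Psi> (mpolys n) (carrier (mpoly_ring K n))"
  unfolding bij_betw_def
proof
  show "inj_on \<Psi> (mpolys n)" by (rule inj_onI) (rule Psi_inj)
  show "\<Psi> ` mpolys n = carrier (mpoly_ring K n)"
    using Psi_mem Psi_surj by (fastforce simp: mpoly_ring_def)
qed

lemma Psi_mult: "\<Psi> (p * r) = \<Psi> p \<otimes>\<^bsub>mpoly_ring K n\<^esub> \<Psi> r"
  by (simp add: \<Psi>_def mpoly_ring_def lookup_mult_submultisets iota_sum finite_submultisets iota_mult)

lemma Psi_plus: "\<Psi> (p + r) = \<Psi> p \<oplus>\<^bsub>mpoly_ring K n\<^esub> \<Psi> r"
  by (simp add: Psi_add mpoly_ring_def)

lemma Psi_one: "\<Psi> 1 = \<one>\<^bsub>mpoly_ring K n\<^esub>"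
  using Psi_Const[of 1] by (simp add: mpoly_ring_def iota_one)

lemma Psi_zero: "\<Psi> 0 = \<zero>\<^bsub>mpoly_ring K n\<^esub>"
  using Psi_Const[of 0] by (simp add: mpoly_ring_def iota_zero)

lemma cring_mpoly_ring: "cring (mpoly_ring K n)"
proof -
  have "\<Psi> \<in> ring_iso (mpoly_class_ring n) (mpoly_ring K n)"
    unfolding ring_iso_def
  proof (intro CollectI conjI ring_hom_memI)
    show "bij_betw \<Psi> (carrier (mpoly_class_ring n)) (carrier (mpoly_ring K n))"
      using Psi_bij by (simp add: mpoly_class_ring_def)
    fix p :: "'k mpoly" assume "p \<in> carrier (mpoly_class_ring n)"
    then show "\<Psi> p \<in> carrier (mpoly_ring K n)" using Psi_bij by (auto simp: mpoly_class_ring_def bij_betw_def)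
  qed (simp_all add: mpoly_class_ring_def Psi_mult[symmetric] Psi_plus[symmetric] Psi_one)
  from cring.ring_iso_imp_img_cring[OF cring_mpoly_class_ring this]
  show ?thesis using Psi_zero[of n] by (simp add: mpoly_class_ring_def)
qed

lemma Psi_closed: "p \<in> mpolys n \<Longrightarrow> \<Psi> p \<in> carrier (mpoly_ring K n)"
  using Psi_bij by (auto simp: bij_betw_def)

lemma Psi_power:
  assumes "p \<in> mpolys n" shows "\<Psi> (p ^ i) = \<Psi> p [^]\<^bsub>mpoly_ring K n\<^esub> i"
proof -
  interpret S: cring "mpoly_ring K n" by (rule cring_mpoly_ring)
  show ?thesis by (induction i) (simp_all add: Psi_one[of n] Psi_mult[of _ _ n] mult.commute[of p])
qed

lemma Psi_sum:
  assumes "finite A" "\<And>a. a \<in> A \<Longrightarrow> f a \<in> mpolys n"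
  shows "\<Psi> (\<Sum>a\<in>A. f a) = (\<Oplus>\<^bsub>mpoly_ring K n\<^esub>a\<in>A. \<Psi> (f a))"
proof -
  interpret S: cring "mpoly_ring K n" by (rule cring_mpoly_ring)
  from assms show ?thesis
    by (induction A rule: finite_induct)
       (simp_all add: Psi_zero[of n] Psi_plus[of _ _ n] S.finsum_insert Pi_def Psi_closed)
qed

definition \<Upsilon> :: "'k poly \<Rightarrow> nat \<Rightarrow> 'a" where "\<Upsilon> u = (\<lambda>i. \<iota> (coeff u i))"

lemma Upsilon_closed: "\<Upsilon> u \<in> carrier (UP K)"
  unfolding UP_def up_def by (auto simp: \<Upsilon>_def bound_def intro!: exI[of _ "degree u"] coeff_eq_0)

lemma coeff_UP: "f \<in> carrier (UP K) \<Longrightarrow> up_ring.coeff (UP K) f = f"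
  by (simp add: UP_def)

lemma Upsilon_surj: assumes "f \<in> carrier (UP K)" shows "\<exists>u. f = \<Upsilon> u"
proof -
  from assms obtain N where f: "\<And>i. f i \<in> carrier K" "\<And>i. N < i \<Longrightarrow> f i = \<zero>\<^bsub>K\<^esub>"
    unfolding UP_def up_def by (auto simp: bound_def)
  have "\<forall>i. \<exists>x. f i = \<iota> x" using iota_surj f(1) by blast
  from choice[OF this] obtain g where g: "\<And>i. f i = \<iota> (g i)" by blast
  have "g i = 0" if "N < i" for i using f(2)[OF that] by (simp add: g)
  then have "coeff (Abs_poly g) = g" by (intro coeff_Abs_poly[of N])
  then show ?thesis by (intro exI[of _ "Abs_poly g"]) (simp add: \<Upsilon>_def g fun_eq_iff)
qed

lemma deg_Upsilon: "deg K (\<Upsilon> u) = degree u"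
  unfolding deg_def coeff_UP[OF Upsilon_closed]
proof (rule Least_equality)
  show "bound \<zero>\<^bsub>K\<^esub> (degree u) (\<Upsilon> u)" by (auto simp: bound_def \<Upsilon>_def coeff_eq_0)
  fix k assume "bound \<zero>\<^bsub>K\<^esub> k (\<Upsilon> u)"
  then show "degree u \<le> k" by (intro degree_le) (auto simp: bound_def \<Upsilon>_def)
qed

lemma poly_subst_Psi:
  assumes "H \<in> mpolys n" shows "poly_subst K n (\<Upsilon> u) (\<Psi> H) = \<Psi> (subst u H)"
proof -
  have "poly_subst K n (\<Upsilon> u) (\<Psi> H)
      = (\<Oplus>\<^bsub>mpoly_ring K n\<^esub>i\<in>{..degree u}. K.indexed_const (\<iota> (coeff u i)) \<otimes>\<^bsub>mpoly_ring K n\<^esub> \<Psi> H [^]\<^bsub>mpoly_ring K n\<^esub> i)"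
    unfolding poly_subst_def UnivPoly.eval_def
    by (simp add: Upsilon_closed deg_Upsilon coeff_UP) (simp add: \<Upsilon>_def)
  also have "\<dots> = (\<Oplus>\<^bsub>mpoly_ring K n\<^esub>i\<in>{..degree u}. \<Psi> (Const (coeff u i) * H ^ i))"
    by (simp add: Psi_mult[of _ _ n] Psi_Const Psi_power[OF assms])
  also have "\<dots> = \<Psi> (subst u H)"
    unfolding subst_altdef by (intro Psi_sum[symmetric]) (auto intro: mpolys_closed assms)
  finally show ?thesis .
qed

lemma total_degree_Psi: "total_degree K (\<Psi> p) = tdeg p"
  by (simp add: total_degree_def tdeg_def \<Psi>_def Poly_Mapping.keys.rep_eq)

lemma nonconstant_Psi: "p \<in> mpolys n \<Longrightarrow> nonconstant K n (\<Psi> p) \<longleftrightarrow> tdeg p > 0"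
proof -
  assume p: "p \<in> mpolys n"
  have "\<Psi> p \<in> K.indexed_const ` carrier K \<longleftrightarrow> tdeg p = 0"
  proof
    assume "\<Psi> p \<in> K.indexed_const ` carrier K"
    then obtain c where "\<Psi> p = \<Psi> (Const c)" using iota_surj Psi_Const by (metis imageE)
    then have "p = Const c" by (rule Psi_inj)
    then show "tdeg p = 0" by simp
  next
    assume "tdeg p = 0"
    then have "\<Psi> p = K.indexed_const (\<iota> (lookup p {#}))" using eq_Const_if_tdeg_0 Psi_Const by metis
    then show "\<Psi> p \<in> K.indexed_const ` carrier K" by simp
  qed
  then show ?thesis using p Psi_closed by (simp add: nonconstant_def)
qed

lemma indecomposable_Psi: assumes "p \<in> mpolys n" shows "indecomposable K n (\<Psi> p) \<longleftrightarrow> indec n p"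
proof -
  have "(\<exists>H\<in>carrier (mpoly_ring K n). \<exists>u\<in>carrier (UP K). 2 \<le> deg K u \<and> \<Psi> p = poly_subst K n u H)
      \<longleftrightarrow> (\<exists>H\<in>mpolys n. \<exists>u. 2 \<le> degree u \<and> p = subst u H)" (is "?L \<longleftrightarrow> ?R")
  proof
    assume ?L
    then obtain Q f where *: "Q \<in> carrier (mpoly_ring K n)" "f \<in> carrier (UP K)" "2 \<le> deg K f" "\<Psi> p = poly_subst K n f Q"
      by blast
    obtain H where H: "H \<in> mpolys n" "Q = \<Psi> H" using *(1) Psi_bij[of n] by (auto simp: bij_betw_def)
    obtain u where u: "f = \<Upsilon> u" using Upsilon_surj *(2) by blast
    have "\<Psi> p = \<Psi> (subst u H)" using * H u poly_subst_Psi by simp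
    then have "p = subst u H" by (rule Psi_inj)
    then show ?R using H *(3) u deg_Upsilon by auto
  next
    assume ?R
    then obtain H u where *: "H \<in> mpolys n" "2 \<le> degree u" "p = subst u H" by blast
    then show ?L using Psi_closed[of H n] Upsilon_closed[of u]
      by (intro bexI[of _ "\<Psi> H"] bexI[of _ "\<Upsilon> u"]) (auto simp: deg_Upsilon poly_subst_Psi)
  qed
  then show ?thesis using assms nonconstant_Psi by (simp add: indecomposable_def indec_def)
qed

lemma card_Psi:
  assumes "\<And>p. p \<in> mpolys n \<Longrightarrow> P (\<Psi> p) \<longleftrightarrow> R p"
  shows "card {F \<in> carrier (mpoly_ring K n). P F} = card {p \<in> mpolys n. R p}"
proof -
  have "{F \<in> carrier (mpoly_ring K n). P F} = \<Psi> ` {p \<in> mpolys n. R p}"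
  proof (intro equalityI subsetI)
    fix F assume F: "F \<in> {F \<in> carrier (mpoly_ring K n). P F}"
    then obtain p where "p \<in> mpolys n" "F = \<Psi> p" using Psi_bij[of n] by (auto simp: bij_betw_def)
    then show "F \<in> \<Psi> ` {p \<in> mpolys n. R p}" using F assms by auto
  qed (use Psi_closed assms in auto)
  then show ?thesis using Psi_inj by (simp add: card_image inj_on_def)
qed

lemma order_K: "order K = CARD('k)"
  using bij_betw_same_card[OF bij] by (simp add: Coset.order_def)

lemma num_polys_K: "num_polys K n d = card {p :: 'k mpoly. p \<in> mpolys n \<and> tdeg p = d}"
  unfolding num_polys_def by (rule card_Psi) (simp add: total_degree_Psi)

lemma num_indecomposable_K: "num_indecomposable K n d = card {p :: 'k mpoly. indec n p \<and> tdeg p = d}"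
proof -
  have "num_indecomposable K n d = card {p \<in> mpolys n. tdeg (p :: 'k mpoly) = d \<and> indec n p}"
    unfolding num_indecomposable_def by (rule card_Psi) (simp add: total_degree_Psi indecomposable_Psi)
  also have "{p \<in> mpolys n. tdeg (p :: 'k mpoly) = d \<and> indec n p} = {p. indec n p \<and> tdeg p = d}"
    by (auto simp: indec_def)
  finally show ?thesis .
qed

lemma num_decomposable_K: "num_decomposable K n d = card {p :: 'k mpoly. dec n p \<and> tdeg p = d}"
proof -
  have "num_decomposable K n d = card {p \<in> mpolys n. tdeg (p :: 'k mpoly) = d \<and> dec n p}"
    unfolding num_decomposable_def
    by (rule card_Psi) (auto simp: total_degree_Psi indecomposable_Psi decomposable_def nonconstant_Psi indec_def dec_def)
  also have "{p \<in> mpolys n. tdeg (p :: 'k mpoly) = d \<and> dec n p} = {p. dec n p \<and> tdeg p = d}"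
    by (auto simp: dec_def)
  finally show ?thesis .
qed

end

text \<open>
  All that the counting theorem needs to know about a finite field.
\<close>

definition counting_formulas :: "'a ring \<Rightarrow> bool" where
  "counting_formulas K \<longleftrightarrow> (\<forall>n d. d > 0 \<longrightarrow>
     num_polys K n d = order K ^ card (mons n d) - order K ^ card (mons n (d - 1)) \<and>
     num_indecomposable K n d + num_decomposable K n d = num_polys K n d \<and>
     num_decomposable K n d = (\<Sum>e | e dvd d \<and> e < d. order K ^ (d div e - 1) * num_indecomposable K n e))"

lemma (in finite_field_copy) counting_formulas_K: "counting_formulas K"
  unfolding counting_formulas_def order_K num_polys_K num_indecomposable_K num_decomposable_K
  using card_mpolys_tdeg card_indec_add_card_dec card_dec by blast

text \<open>
  A finite field that is isomorphic to a counterexample to the counting formulas over \<open>'a\<close>, should there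
  be one.  Its elements are integers because a finite field over \<open>'a\<close> can always be copied there, and
  because without a counterexample some finite field must still be available, which \<open>'a\<close> may be too
  small to carry.
\<close>

definition critical_field :: "'a itself \<Rightarrow> int ring" where
  "critical_field _ = (SOME M. field M \<and> finite (carrier M) \<and>
     ((\<exists>K :: 'a ring. field K \<and> finite (carrier K) \<and> \<not> counting_formulas K) \<longrightarrow>
      (\<exists>K :: 'a ring. field K \<and> \<not> counting_formulas K \<and> ring_iso M K \<noteq> {})))"

lemma field_copy_exists:
  assumes "field K" "finite (carrier K)"
  shows "\<exists>M :: int ring. field M \<and> finite (carrier M) \<and> ring_iso M K \<noteq> {}"
proof -
  interpret field K by fact
  obtain g :: "'a \<Rightarrow> int" where g: "inj_on g (carrier K)"
    using finite_imp_inj_to_nat_seg[OF assms(2)] inj_of_nat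
    by (metis comp_inj_on inj_on_subset subset_UNIV)
  have iso: "g \<in> ring_iso K (image_ring g K)" using g by (rule inj_imp_image_ring_iso)
  then have "inv_into (carrier K) g \<in> ring_iso (image_ring g K) K" using is_ring ring_iso_set_sym by blast
  moreover have "field (image_ring g K)" using g by (rule inj_imp_image_ring_is_field)
  moreover have "finite (carrier (image_ring g K))" using assms(2) by (simp add: image_ring_carrier)
  ultimately show ?thesis by blast
qed

lemma critical_field:
  shows "field (critical_field TYPE('a))" "finite (carrier (critical_field TYPE('a)))"
    "\<exists>K :: 'a ring. field K \<and> finite (carrier K) \<and> \<not> counting_formulas K \<Longrightarrow>
      \<exists>K :: 'a ring. field K \<and> \<not> counting_formulas K \<and> ring_iso (critical_field TYPE('a)) K \<noteq> {}"
proof -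
  let ?P = "\<lambda>M :: int ring. field M \<and> finite (carrier M) \<and>
     ((\<exists>K :: 'a ring. field K \<and> finite (carrier K) \<and> \<not> counting_formulas K) \<longrightarrow>
      (\<exists>K :: 'a ring. field K \<and> \<not> counting_formulas K \<and> ring_iso M K \<noteq> {}))"
  have "\<exists>M. ?P M"
  proof (cases "\<exists>K :: 'a ring. field K \<and> finite (carrier K) \<and> \<not> counting_formulas K")
    case True then show ?thesis using field_copy_exists by metis
  next
    case False
    interpret residues_prime 2 "residue_ring (int 2)" by unfold_locales simp_all
    show ?thesis using False is_field finite by blast
  qed
  from someI_ex[OF this] have "?P (critical_field TYPE('a))" unfolding critical_field_def .
  then show "field (critical_field TYPE('a))" "finite (carrier (critical_field TYPE('a)))"
    "\<exists>K :: 'a ring. field K \<and> finite (carrier K) \<and> \<not> counting_formulas K \<Longrightarrow>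
      \<exists>K :: 'a ring. field K \<and> \<not> counting_formulas K \<and> ring_iso (critical_field TYPE('a)) K \<noteq> {}" by blast+
qed

typedef 'a critical = "carrier (critical_field TYPE('a))"
proof -
  interpret field "critical_field TYPE('a)" by (rule critical_field)
  show ?thesis using one_closed by blast
qed

interpretation critical: cring "critical_field TYPE('a)"
proof -
  interpret field "critical_field TYPE('a)" by (rule critical_field)
  show "cring (critical_field TYPE('a))" by (rule is_cring)
qed

lemma Rep_critical_closed [simp]: "Rep_critical (x :: 'a critical) \<in> carrier (critical_field TYPE('a))"
  using Rep_critical .

instantiation critical :: (type) field
begin

definition zero_critical :: "'a critical" where "zero_critical = Abs_critical \<zero>\<^bsub>critical_field TYPE('a)\<^esub>"
definition one_critical :: "'a critical" where "one_critical = Abs_critical \<one>\<^bsub>critical_field TYPE('a)\<^esub>"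
definition plus_critical :: "'a critical \<Rightarrow> 'a critical \<Rightarrow> 'a critical" where
  "plus_critical x y = Abs_critical (Rep_critical x \<oplus>\<^bsub>critical_field TYPE('a)\<^esub> Rep_critical y)"
definition uminus_critical :: "'a critical \<Rightarrow> 'a critical" where
  "uminus_critical x = Abs_critical (\<ominus>\<^bsub>critical_field TYPE('a)\<^esub> Rep_critical x)"
definition minus_critical :: "'a critical \<Rightarrow> 'a critical \<Rightarrow> 'a critical" where
  "minus_critical x y = x + (- y)"
definition times_critical :: "'a critical \<Rightarrow> 'a critical \<Rightarrow> 'a critical" where
  "times_critical x y = Abs_critical (Rep_critical x \<otimes>\<^bsub>critical_field TYPE('a)\<^esub> Rep_critical y)"
definition inverse_critical :: "'a critical \<Rightarrow> 'a critical" where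
  "inverse_critical x = (if x = 0 then 0 else Abs_critical (inv\<^bsub>critical_field TYPE('a)\<^esub> Rep_critical x))"
definition divide_critical :: "'a critical \<Rightarrow> 'a critical \<Rightarrow> 'a critical" where
  "divide_critical x y = x * inverse y"

lemma Rep_critical_zero: "Rep_critical (0 :: 'a critical) = \<zero>\<^bsub>critical_field TYPE('a)\<^esub>"
  by (simp add: zero_critical_def Abs_critical_inverse)
lemma Rep_critical_one: "Rep_critical (1 :: 'a critical) = \<one>\<^bsub>critical_field TYPE('a)\<^esub>"
  by (simp add: one_critical_def Abs_critical_inverse)
lemma Rep_critical_plus:
  "Rep_critical (x + y :: 'a critical) = Rep_critical x \<oplus>\<^bsub>critical_field TYPE('a)\<^esub> Rep_critical y"
  by (simp add: plus_critical_def Abs_critical_inverse)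
lemma Rep_critical_times:
  "Rep_critical (x * y :: 'a critical) = Rep_critical x \<otimes>\<^bsub>critical_field TYPE('a)\<^esub> Rep_critical y"
  by (simp add: times_critical_def Abs_critical_inverse)
lemma Rep_critical_uminus:
  "Rep_critical (- x :: 'a critical) = \<ominus>\<^bsub>critical_field TYPE('a)\<^esub> Rep_critical x"
  by (simp add: uminus_critical_def Abs_critical_inverse)

instance
proof
  fix x y z :: "'a critical"
  note rep = Rep_critical_zero Rep_critical_one Rep_critical_plus Rep_critical_times Rep_critical_uminus Rep_critical_inject[symmetric]
  show "x + y + z = x + (y + z)" by (simp add: rep critical.a_assoc)
  show "x + y = y + x" by (simp add: rep critical.a_comm)
  show "0 + x = x" by (simp add: rep)
  show "- x + x = 0" by (simp add: rep critical.l_neg)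
  show "x - y = x + - y" by (simp add: minus_critical_def)
  show "x * y * z = x * (y * z)" by (simp add: rep critical.m_assoc)
  show "x * y = y * x" by (simp add: rep critical.m_comm)
  show "1 * x = x" by (simp add: rep)
  show "(x + y) * z = x * z + y * z" by (simp add: rep critical.l_distr)
  show "(0 :: 'a critical) \<noteq> 1"
    using domain.one_not_zero[OF field.axioms(1)[OF critical_field(1)[where 'a = 'a]]] by (auto simp: rep)
  show "inverse (0 :: 'a critical) = 0" by (simp add: inverse_critical_def)
  show "x div y = x * inverse y" by (simp add: divide_critical_def)
  show "inverse x * x = 1" if "x \<noteq> 0"
  proof -
    have "Rep_critical x \<in> Units (critical_field TYPE('a))"
      using that by (simp add: field.field_Units[OF critical_field(1)] rep)
    then show ?thesis using that
      by (simp add: inverse_critical_def rep Abs_critical_inverse del: Rep_critical_inject)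
  qed
qed

end

instantiation critical :: (type)
  "{unique_euclidean_ring, normalization_euclidean_semiring, normalization_semidom_multiplicative}"
begin

definition [simp]: "normalize_critical = (normalize_field :: 'a critical \<Rightarrow> _)"
definition [simp]: "unit_factor_critical = (unit_factor_field :: 'a critical \<Rightarrow> _)"
definition [simp]: "modulo_critical = (mod_field :: 'a critical \<Rightarrow> _)"
definition [simp]: "euclidean_size_critical = (euclidean_size_field :: 'a critical \<Rightarrow> _)"
definition [simp]: "division_segment (x :: 'a critical) = 1"

instance
  by standard (simp_all add: dvd_field_iff field_split_simps split: if_splits)

end

instantiation critical :: (type) euclidean_ring_gcd
begin

definition gcd_critical :: "'a critical \<Rightarrow> 'a critical \<Rightarrow> 'a critical" where
  "gcd_critical = Euclidean_Algorithm.gcd"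
definition lcm_critical :: "'a critical \<Rightarrow> 'a critical \<Rightarrow> 'a critical" where
  "lcm_critical = Euclidean_Algorithm.lcm"
definition Gcd_critical :: "'a critical set \<Rightarrow> 'a critical" where
 "Gcd_critical = Euclidean_Algorithm.Gcd"
definition Lcm_critical :: "'a critical set \<Rightarrow> 'a critical" where
 "Lcm_critical = Euclidean_Algorithm.Lcm"

instance by standard (simp_all add: gcd_critical_def lcm_critical_def Gcd_critical_def Lcm_critical_def)

end

instance critical :: (type) field_gcd ..

instance critical :: (type) finite
proof
  have "(UNIV :: 'a critical set) = Abs_critical ` carrier (critical_field TYPE('a))"
    by (metis Abs_critical_cases UNIV_eq_I imageI)
  then show "finite (UNIV :: 'a critical set)" using critical_field(2)[where 'a = 'a] by (metis finite_imageI)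
qed

text \<open>
  If the formulas fail for some \<open>K\<close>, they fail for a field \<open>L\<close> isomorphic to the type \<open>'a critical\<close>, which
  \<open>counting_formulas_K\<close> excludes.
\<close>

theorem counting_formulas_finite_field:
  fixes K :: "'a ring"
  assumes "field K" "finite (carrier K)"
  shows "counting_formulas K"
proof (rule ccontr)
  assume "\<not> ?thesis"
  then obtain L :: "'a ring" and f where L: "field L" "\<not> counting_formulas L"
    and f: "f \<in> ring_iso (critical_field TYPE('a)) L"
    using critical_field(3) assms by blast
  have hom: "f \<in> ring_hom (critical_field TYPE('a)) L" and bij: "bij_betw f (carrier (critical_field TYPE('a))) (carrier L)"
    using f by (auto simp: ring_iso_def)
  interpret finite_field_copy L "\<lambda>x :: 'a critical. f (Rep_critical x)"
  proof (rule finite_field_copy.intro)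
    show "field L" by fact
    have "bij_betw Rep_critical (UNIV :: 'a critical set) (carrier (critical_field TYPE('a)))"
      by (rule bij_betwI[of _ _ _ Abs_critical]) (auto simp: Rep_critical_inverse Abs_critical_inverse)
    from bij_betw_trans[OF this bij] show "bij_betw (\<lambda>x :: 'a critical. f (Rep_critical x)) UNIV (carrier L)"
      by (simp add: comp_def)
  qed (simp_all add: Rep_critical_plus Rep_critical_times Rep_critical_one ring_hom_add[OF hom] ring_hom_mult[OF hom] ring_hom_one[OF hom])
  show False using counting_formulas_K L(2) by blast
qed

section \<open>Numbers of monomials\<close>

definition mons_eq :: "nat \<Rightarrow> nat \<Rightarrow> nat multiset set" where
  "mons_eq n d = {m. set_mset m \<subseteq> {..<n} \<and> size m = d}"

lemma card_mons_step:
  assumes "d > 0" shows "card (mons n d) = card (mons n (d - 1)) + card (mons_eq n d)"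
proof -
  have "mons n d = mons n (d - 1) \<union> mons_eq n d" using assms by (auto simp: mons_def mons_eq_def)
  moreover have "finite (mons_eq n d)"
    by (rule finite_subset[OF _ finite_mons[of n d]]) (auto simp: mons_def mons_eq_def)
  ultimately show ?thesis using assms finite_mons[of n "d - 1"]
    by (simp only:) (rule card_Un_disjoint, auto simp: mons_def mons_eq_def)
qed

lemma card_mons_0: "card (mons n 0) = 1"
proof -
  have "mons n 0 = {{#}}" by (auto simp: mons_def)
  then show ?thesis by simp
qed

lemma card_mons_1: "card (mons n 1) = Suc n"
proof -
  have "mons_eq n 1 = (\<lambda>i. {#i#}) ` {..<n}"
    using size_1_singleton_mset by (fastforce simp: mons_eq_def)
  moreover have "inj_on (\<lambda>i. {#i#}) {..<n}" by (auto simp: inj_on_def)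
  ultimately show ?thesis using card_mons_step[of 1 n] card_mons_0 by (simp add: card_image)
qed

text \<open>
  The monomials \<open>x\<^sub>0 ^ i * x\<^sub>1 ^ (d - i)\<close>: all monomials of degree \<open>d\<close> in two variables, and enough of them
  in more variables.
\<close>

definition binary_mon :: "nat \<Rightarrow> nat \<Rightarrow> nat multiset" where
  "binary_mon d i = replicate_mset i 0 + replicate_mset (d - i) 1"

lemma inj_binary_mon: "inj_on (binary_mon d) {..d}"
proof (rule inj_onI)
  fix i j assume "binary_mon d i = binary_mon d j"
  then have "count (binary_mon d i) 0 = count (binary_mon d j) 0" by simp
  then show "i = j" by (simp add: binary_mon_def)
qed

lemma binary_mon_mem: "2 \<le> n \<Longrightarrow> i \<le> d \<Longrightarrow> binary_mon d i \<in> mons_eq n d"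
  by (auto simp: mons_eq_def binary_mon_def split: if_splits)

lemma card_mons_eq_ge: assumes "2 \<le> n" shows "Suc d \<le> card (mons_eq n d)"
proof -
  have "card (binary_mon d ` {..d}) \<le> card (mons_eq n d)"
    using binary_mon_mem[OF assms] by (intro card_mono finite_subset[OF _ finite_mons[of n d]])
      (auto simp: mons_def mons_eq_def)
  then show ?thesis by (simp add: card_image inj_binary_mon)
qed

lemma card_mons_eq_2: "card (mons_eq 2 d) = Suc d"
proof -
  have "mons_eq 2 d = binary_mon d ` {..d}"
  proof (intro equalityI subsetI)
    fix m assume m: "m \<in> mons_eq 2 d"
    have eq: "m = replicate_mset (count m 0) 0 + replicate_mset (count m 1) 1"
    proof (rule multiset_eqI)
      fix i :: nat
      show "count m i = count (replicate_mset (count m 0) 0 + replicate_mset (count m 1) 1) i"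
      proof (cases "i \<in># m")
        case True
        then have "i = 0 \<or> i = 1" using m by (force simp: mons_eq_def)
        then show ?thesis by auto
      next
        case False then show ?thesis by (auto simp: not_in_iff)
      qed
    qed
    have "d = size m" using m by (simp add: mons_eq_def)
    also have "\<dots> = count m 0 + count m 1" by (subst eq) simp
    finally have "d - count m 0 = count m 1" "count m 0 \<le> d" by simp_all
    then have "m = binary_mon d (count m 0)" using eq by (simp add: binary_mon_def)
    then show "m \<in> binary_mon d ` {..d}" using \<open>count m 0 \<le> d\<close> by blast
  qed (use binary_mon_mem in auto)
  then show ?thesis by (simp add: card_image inj_binary_mon)
qed

lemma card_mons_2: "2 * card (mons 2 d) = (d + 1) * (d + 2)"
proof (induction d)
  case (Suc d)
  have "card (mons 2 (Suc d)) = card (mons 2 d) + (d + 2)"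
    using card_mons_step[of "Suc d" 2] card_mons_eq_2[of "Suc d"] by simp
  then show ?case using Suc by simp
qed (simp add: card_mons_0)

lemma card_mons_gap: "2 \<le> n \<Longrightarrow> d > 0 \<Longrightarrow> card (mons n (d - 1)) + d + 1 \<le> card (mons n d)"
  using card_mons_step[of d n] card_mons_eq_ge[of n d] by simp

lemma card_mons_mono: "e \<le> d \<Longrightarrow> card (mons n e) \<le> card (mons n d)"
  by (intro card_mono finite_mons) (auto simp: mons_def)

section \<open>Consequences of the recursion for the number of decomposable polynomials\<close>

locale counted_field =
  fixes K :: "'a ring" and n q :: nat
  assumes field_K: "field K" and finite_K: "finite (carrier K)" and n: "2 \<le> n" and q: "order K = q"
begin

abbreviation "N \<equiv> num_polys K n"
abbreviation "I \<equiv> num_indecomposable K n"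
abbreviation "D \<equiv> num_decomposable K n"
abbreviation "s d \<equiv> card (mons n d)"

lemma formulas:
  assumes "d > 0"
  shows "N d = q ^ s d - q ^ s (d - 1)" "I d + D d = N d"
    "D d = (\<Sum>e | e dvd d \<and> e < d. q ^ (d div e - 1) * I e)"
  using counting_formulas_finite_field[OF field_K finite_K] assms unfolding counting_formulas_def q by blast+

lemma q_ge_2: "2 \<le> q"
proof -
  interpret field K by (rule field_K)
  have "card {\<zero>\<^bsub>K\<^esub>, \<one>\<^bsub>K\<^esub>} \<le> card (carrier K)" using finite_K by (intro card_mono) auto
  then show ?thesis using q by (simp add: Coset.order_def)
qed

lemma N_add: "d > 0 \<Longrightarrow> N d + q ^ s (d - 1) = q ^ s d"
  using formulas(1)[of d] power_increasing[OF card_mons_mono[of "d - 1" d n], of q] q_ge_2 by simp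

lemma N_ge: assumes "d > 0" shows "q ^ s d \<le> 2 * N d"
proof -
  have "2 * q ^ s (d - 1) \<le> q * q ^ s (d - 1)" using q_ge_2 by (intro mult_right_mono) auto
  also have "\<dots> = q ^ Suc (s (d - 1))" by simp
  also have "\<dots> \<le> q ^ s d" using card_mons_gap[OF n assms] q_ge_2 by (intro power_increasing) auto
  finally show ?thesis using N_add[OF assms] by simp
qed

lemma I_le: "d > 0 \<Longrightarrow> I d \<le> q ^ s d" "d > 0 \<Longrightarrow> I d \<le> N d"
  using formulas(2)[of d] N_add[of d] by simp_all

lemma N_1: "int (N 1) = int q * (int q ^ n - 1)"
proof -
  have "N 1 + q = q * q ^ n" using N_add[of 1] card_mons_0 card_mons_1[of n] by simp
  then have "int (N 1) + int q = int q * int q ^ n" by (metis of_nat_add of_nat_mult of_nat_power)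
  then show ?thesis by (simp add: algebra_simps)
qed

lemma I_1: "I 1 = N 1"
proof -
  have "{e :: nat. e dvd 1 \<and> e < 1} = {}" by auto
  then have "D 1 = 0" using formulas(3)[of 1] by (simp del: dvd_1_iff_1 nat_dvd_1_iff_1)
  then show ?thesis using formulas(2)[of 1] by simp
qed

section \<open>Degrees with at most two prime factors\<close>

lemma D_prime:
  assumes "Factorial_Ring.prime p"
  shows "int (D p) = int q ^ p * (int q ^ n - 1)"
proof -
  have p: "p > 1" using assms prime_gt_1_nat by blast
  have "{e. e dvd p \<and> e < p} = {1}" using assms p by (auto simp: prime_nat_iff)
  then have "D p = q ^ (p - 1) * N 1" using formulas(3)[of p] p I_1 by simp
  then have "int (D p) = int q ^ (p - 1) * int (N 1)" by simp
  also have "\<dots> = (int q ^ (p - 1) * int q) * (int q ^ n - 1)" by (simp only: N_1 mult.assoc)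
  also have "int q ^ (p - 1) * int q = int q ^ p" using p by (metis power_minus_mult less_trans zero_less_one)
  finally show ?thesis .
qed

lemma int_I: "d > 0 \<Longrightarrow> int (I d) = int (N d) - int (D d)"
  using formulas(2)[of d] by simp

lemma D_prime_square:
  assumes "Factorial_Ring.prime p"
  shows "int (D (p ^ 2)) = int q ^ (p - 1) * int (N p) + (int q ^ (p ^ 2) - int q ^ (2 * p - 1)) * (int q ^ n - 1)"
proof -
  have p: "p > 1" using assms prime_gt_1_nat by blast
  have "{e. e dvd p ^ 2 \<and> e < p ^ 2} = {1, p}"
  proof (intro equalityI subsetI)
    fix e assume e: "e \<in> {e. e dvd p ^ 2 \<and> e < p ^ 2}"
    then obtain i where "i \<le> 2" "e = p ^ i" using divides_primepow_nat[OF assms] by blast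
    moreover have "i \<noteq> 2" using e \<open>e = p ^ i\<close> by auto
    ultimately have "i = 0 \<or> i = 1" by linarith
    then show "e \<in> {1, p}" using \<open>e = p ^ i\<close> by auto
  qed (use p less_1_mult[OF p p] in \<open>auto simp: power2_eq_square\<close>)
  then have "D (p ^ 2) = q ^ (p ^ 2 - 1) * N 1 + q ^ (p - 1) * I p"
    using formulas(3)[of "p ^ 2"] p I_1 by (simp add: power2_eq_square)
  then have "int (D (p ^ 2)) = int q ^ (p ^ 2 - 1) * int (N 1) + int q ^ (p - 1) * int (I p)" by simp
  also have "int (I p) = int (N p) - int q ^ p * (int q ^ n - 1)" using int_I[of p] p D_prime[OF assms] by simp
  also have "int q ^ (p ^ 2 - 1) * int (N 1) = int q ^ (p ^ 2) * (int q ^ n - 1)"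
    using p by (simp only: N_1 mult.assoc[symmetric]) (metis power_minus_mult zero_less_power less_trans zero_less_one)
  finally have "int (D (p ^ 2)) = int q ^ (p ^ 2) * (int q ^ n - 1)
      + int q ^ (p - 1) * (int (N p) - int q ^ p * (int q ^ n - 1))" .
  moreover have "int q ^ (2 * p - 1) = int q ^ (p - 1) * int q ^ p" using p by (simp add: mult_2 flip: power_add)
  ultimately show ?thesis by (simp add: algebra_simps)
qed

lemma D_two_primes:
  assumes "Factorial_Ring.prime p" "Factorial_Ring.prime p'" "p < p'"
  shows "int (D (p * p')) = int q ^ (p - 1) * int (N p') + int q ^ (p' - 1) * int (N p)
    + (int q ^ (p * p') - 2 * int q ^ (p + p' - 1)) * (int q ^ n - 1)"
proof -
  have p: "p > 1" "p' > 1" using assms prime_gt_1_nat by blast+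
  have "{e. e dvd p * p' \<and> e < p * p'} = {1, p, p'}"
  proof (intro equalityI subsetI)
    fix e assume e: "e \<in> {e. e dvd p * p' \<and> e < p * p'}"
    then obtain a b where ab: "e = a * b" "a dvd p" "b dvd p'" using division_decomp by blast
    then have "a = 1 \<or> a = p" "b = 1 \<or> b = p'" using assms by (auto simp: prime_nat_iff)
    then show "e \<in> {1, p, p'}" using e ab by auto
  qed (use p less_1_mult[OF p] in auto)
  then have "D (p * p') = q ^ (p * p' - 1) * N 1 + q ^ (p' - 1) * I p + q ^ (p - 1) * I p'"
    using formulas(3)[of "p * p'"] p assms(3) I_1 by simp
  then have "int (D (p * p')) = int q ^ (p * p' - 1) * int (N 1) + int q ^ (p' - 1) * int (I p) + int q ^ (p - 1) * int (I p')"
    by simp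
  also have "int (I p) = int (N p) - int q ^ p * (int q ^ n - 1)" using int_I[of p] p D_prime[OF assms(1)] by simp
  also have "int (I p') = int (N p') - int q ^ p' * (int q ^ n - 1)" using int_I[of p'] p D_prime[OF assms(2)] by simp
  also have "int q ^ (p * p' - 1) * int (N 1) = int q ^ (p * p') * (int q ^ n - 1)"
    using p by (simp only: N_1 mult.assoc[symmetric]) (metis power_minus_mult nat_0_less_mult_iff less_trans zero_less_one)
  finally have "int (D (p * p')) = int q ^ (p * p') * (int q ^ n - 1)
      + int q ^ (p' - 1) * (int (N p) - int q ^ p * (int q ^ n - 1))
      + int q ^ (p - 1) * (int (N p') - int q ^ p' * (int q ^ n - 1))" .
  moreover have "int q ^ (p + p' - 1) = int q ^ (p - 1) * int q ^ p'" "int q ^ (p + p' - 1) = int q ^ (p' - 1) * int q ^ p"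
    using p by (simp_all flip: power_add add: add.commute)
  ultimately show ?thesis by (simp add: algebra_simps)
qed

theorem at_most_two_primes:
  assumes "size (prime_factorization d) \<in> {1, 2}"
  shows "(\<exists>p. Factorial_Ring.prime p \<and> d = p \<and>
           int (num_decomposable K n d) = int q ^ d * (int q ^ n - 1)) \<or>
        (\<exists>p. Factorial_Ring.prime p \<and> d = p ^ 2 \<and>
           int (num_decomposable K n d) =
             int q ^ (p - 1) * int (num_polys K n p)
             + (int q ^ d - int q ^ (2 * p - 1)) * (int q ^ n - 1)) \<or>
        (\<exists>p p'. Factorial_Ring.prime p \<and> Factorial_Ring.prime p' \<and> p < p' \<and> d = p * p' \<and>
           int (num_decomposable K n d) =
             int q ^ (p - 1) * int (num_polys K n p')
             + int q ^ (p' - 1) * int (num_polys K n p)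
             + (int q ^ d - 2 * int q ^ (p + p' - 1)) * (int q ^ n - 1))"
proof -
  have "d \<noteq> 0" using assms by (intro notI) simp
  then have d: "d = prod_mset (prime_factorization d)" by (simp add: prod_mset_prime_factorization_nat)
  have prime: "Factorial_Ring.prime p" if "p \<in># prime_factorization d" for p
    using that by (rule in_prime_factors_imp_prime)
  from assms consider "size (prime_factorization d) = 1" | "size (prime_factorization d) = 2" by auto
  then show ?thesis
  proof cases
    case 1
    then obtain p where "prime_factorization d = {#p#}" using size_1_singleton_mset by blast
    then have "Factorial_Ring.prime p" "d = p" using prime[of p] d by simp_all
    then show ?thesis using D_prime by blast
  next
    case 2
    then obtain p M where "prime_factorization d = add_mset p M" "size M = 1"
      by (metis Suc_1 size_eq_Suc_imp_eq_union size_add_mset Suc_inject)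
    then obtain p' where "prime_factorization d = {#p, p'#}" using size_1_singleton_mset by blast
    then have pp: "Factorial_Ring.prime p" "Factorial_Ring.prime p'" "d = p * p'" using prime d by simp_all
    consider "p = p'" | "p < p'" | "p' < p" by linarith
    then show ?thesis
    proof cases
      case 1 then show ?thesis using pp D_prime_square[of p] by (auto simp: power2_eq_square)
    next
      case 2 then show ?thesis using pp D_two_primes[of p p'] by blast
    next
      case 3 then show ?thesis using pp D_two_primes[of p' p] by (metis mult.commute)
    qed
  qed
qed

section \<open>Almost all polynomials are indecomposable\<close>

text \<open>
  Each divisor \<open>e\<close> contributes at most \<open>q ^ (k e + s e)\<close>; the exponent \<open>c\<close> records by how much all of them
  fall short of \<open>t\<close>.
\<close>

lemma weighted_sum_le:
  assumes "finite A" "\<And>e. e \<in> A \<Longrightarrow> e > 0" "\<And>e. e \<in> A \<Longrightarrow> k e + s e + c \<le> t"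
  shows "(\<Sum>e\<in>A. q ^ k e * I e) * q ^ c \<le> card A * q ^ t"
proof -
  have "(\<Sum>e\<in>A. q ^ k e * I e) * q ^ c \<le> (\<Sum>e\<in>A. q ^ t)"
    unfolding sum_distrib_right
  proof (rule sum_mono)
    fix e assume e: "e \<in> A"
    have "q ^ k e * I e * q ^ c \<le> q ^ k e * q ^ s e * q ^ c"
      using I_le(1)[OF assms(2)[OF e]] by (intro mult_le_mono) auto
    also have "\<dots> \<le> q ^ t" using assms(3)[OF e] q_ge_2 by (simp flip: power_add add: power_increasing)
    finally show "q ^ k e * I e * q ^ c \<le> q ^ t" .
  qed
  then show ?thesis by simp
qed

lemma proper_divisors:
  assumes "d > 0"
  shows "finite {e. e dvd d \<and> e < (c :: nat)}" "e \<in> {e. e dvd d \<and> e < c} \<Longrightarrow> e > 0"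
    "c > 0 \<Longrightarrow> card {e. e dvd d \<and> e < c} \<le> c - 1"
proof -
  show pos: "e > 0" if "e \<in> {e. e dvd d \<and> e < c}" for e using that assms by (auto intro: Nat.gr0I)
  show "finite {e. e dvd d \<and> e < c}" by (rule finite_subset[of _ "{..<c}"]) auto
  have "card {e. e dvd d \<and> e < c} \<le> card {1..<c}" using pos by (intro card_mono) (auto simp: Suc_le_eq)
  then show "c > 0 \<Longrightarrow> card {e. e dvd d \<and> e < c} \<le> c - 1" by simp
qed

lemma D_upper:
  assumes d: "d > 0" and "\<And>e. e dvd d \<Longrightarrow> 0 < e \<Longrightarrow> e < d \<Longrightarrow> (d div e - 1) + s e + c \<le> s d"
  shows "D d * q ^ c \<le> (d - 1) * q ^ s d"
proof -
  have "D d * q ^ c \<le> card {e. e dvd d \<and> e < d} * q ^ s d"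
    unfolding formulas(3)[OF d] using assms(2) proper_divisors[OF d] by (intro weighted_sum_le) auto
  also have "\<dots> \<le> (d - 1) * q ^ s d" using proper_divisors(3)[OF d, of d] d by (intro mult_le_mono) auto
  finally show ?thesis .
qed

lemma ratio_bound:
  assumes d: "d > 0" and "D d * q ^ c \<le> (d - 1) * q ^ s d"
  shows "\<bar>real (I d) / real (N d) - 1\<bar> \<le> 2 * real d / real q ^ c"
proof -
  have qpos: "real q ^ c > 0" "real q ^ s d > 0" using q_ge_2 by auto
  have "q ^ s d > 0" using q_ge_2 by simp
  then have Npos: "real (N d) > 0" using N_ge[OF d] by linarith
  have "real (I d) + real (D d) = real (N d)" using formulas(2)[OF d] by (metis of_nat_add)
  then have "real (I d) / real (N d) - 1 = - (real (D d) / real (N d))" using Npos by (simp add: field_simps)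
  then have abs: "\<bar>real (I d) / real (N d) - 1\<bar> = real (D d) / real (N d)" by simp
  have "D d * q ^ c \<le> d * q ^ s d" using assms(2) by (meson diff_le_self le_trans mult_le_mono1)
  also have "\<dots> \<le> d * (2 * N d)" using N_ge[OF d] by simp
  finally have "real (D d * q ^ c) \<le> real (d * (2 * N d))" by (rule of_nat_mono)
  then have "real (D d) * real q ^ c \<le> 2 * real d * real (N d)" by (simp add: mult_ac)
  then show ?thesis unfolding abs using Npos qpos by (simp add: field_simps)
qed

text \<open>
  Here \<open>d div e - 1 < d\<close> and \<open>s e \<le> s (d - 1) < s d - d\<close>.  The bound is weak in \<open>d\<close> but uniform in the
  field, as the limit over growing fields requires.
\<close>

lemma ratio_bound_2:
  assumes d: "d > 0" shows "\<bar>real (I d) / real (N d) - 1\<bar> \<le> 2 * real d / real q ^ 2"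
proof (rule ratio_bound[OF d], rule D_upper[OF d])
  fix e assume e: "e dvd d" "0 < e" "e < d"
  have "d div e \<le> d" by simp
  moreover have "s e \<le> s (d - 1)" using e by (intro card_mons_mono) auto
  moreover have "s (d - 1) + d + 1 \<le> s d" using card_mons_gap[OF n d] .
  moreover have "1 \<le> d div e" using e by (simp add: div_greater_zero_iff Suc_le_eq)
  ultimately show "(d div e - 1) + s e + 2 \<le> s d" by linarith
qed

text \<open>
  A proper divisor of \<open>d \<ge> 3\<close> is at most \<open>d - 2\<close>, and skipping two degrees instead of one gains another
  factor \<open>q ^ d\<close>.
\<close>

lemma ratio_bound_d:
  assumes d: "d \<ge> 3" shows "\<bar>real (I d) / real (N d) - 1\<bar> \<le> 2 * real d / real q ^ d"
proof (rule ratio_bound, goal_cases)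
  case 2
  show ?case
  proof (rule D_upper)
    fix e assume e: "e dvd d" "0 < e" "e < d"
    have "d div e \<le> d" by simp
    moreover have "e \<noteq> d - 1"
    proof
      assume "e = d - 1"
      then have "e dvd d - 1" by simp
      with e(1) have "e dvd d - (d - 1)" by (rule dvd_diff_nat)
      moreover have "d - (d - 1) = 1" using d by simp
      ultimately have "e = 1" by simp
      then show False using \<open>e = d - 1\<close> d by simp
    qed
    then have "s e \<le> s (d - 1 - 1)" using e d by (intro card_mons_mono) auto
    moreover have "s (d - 1) + d + 1 \<le> s d" using card_mons_gap[OF n, of d] d by simp
    moreover have "s (d - 1 - 1) + (d - 1) + 1 \<le> s (d - 1)" using card_mons_gap[OF n, of "d - 1"] d by simp
    moreover have "1 \<le> d div e" using e by (simp add: div_greater_zero_iff Suc_le_eq)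
    ultimately show "(d div e - 1) + s e + d \<le> s d" using d by linarith
  qed (use d in simp)
qed (use d in simp)

theorem ratio_tendsto_1: "(\<lambda>d. real (I d) / real (N d)) \<longlonglongrightarrow> 1"
proof (rule LIM_zero_cancel, rule tendsto_0_le[where K = 2])
  show "(\<lambda>d. real d / 2 ^ d) \<longlonglongrightarrow> 0"
    using lim_n_over_pown[of "2 :: real"] by simp
  show "\<forall>\<^sub>F d in sequentially. norm (real (I d) / real (N d) - 1) \<le> norm (real d / 2 ^ d) * 2"
    using eventually_ge_at_top[of 3]
  proof eventually_elim
    case (elim d)
    have "2 * real d / real q ^ d \<le> 2 * real d / 2 ^ d"
      using q_ge_2 by (intro divide_left_mono power_mono mult_pos_pos) auto
    then show ?case using ratio_bound_d[OF elim] by (simp add: mult.commute)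
  qed
qed

end

section \<open>The error term in two variables\<close>

lemma first_divisor:
  assumes "1 < d"
  shows "1 < first_divisor d" "first_divisor d dvd d" "\<And>l. 1 < l \<Longrightarrow> l dvd d \<Longrightarrow> first_divisor d \<le> l"
    "Factorial_Ring.prime (first_divisor d)"
proof -
  have "1 < first_divisor d \<and> first_divisor d dvd d"
    unfolding first_divisor_def by (rule LeastI[of _ d]) (use assms in simp)
  then show *: "1 < first_divisor d" "first_divisor d dvd d" by auto
  show least: "first_divisor d \<le> l" if "1 < l" "l dvd d" for l
    unfolding first_divisor_def by (rule Least_le) (use that in simp)
  show "Factorial_Ring.prime (first_divisor d)"
    unfolding prime_nat_iff
  proof (intro conjI allI impI)
    fix m assume m: "m dvd first_divisor d"
    then have "m dvd d" using * by (auto intro: dvd_trans)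
    have "m \<noteq> 0" using m * by (intro notI) simp
    show "m = 1 \<or> m = first_divisor d"
    proof (rule ccontr)
      assume "\<not> ?thesis"
      then have "1 < m" "m < first_divisor d" using \<open>m \<noteq> 0\<close> m * by (auto dest: dvd_imp_le)
      then show False using least[of m] \<open>m dvd d\<close> by simp
    qed
  qed (use * in simp)
qed

text \<open>
  The cofactor is a product of at least two primes, and none of them is smaller than the first divisor.
\<close>

lemma cofactor_of_first_divisor:
  assumes "3 \<le> size (prime_factorization d)"
  obtains E where "d = first_divisor d * E" "2 * first_divisor d \<le> E" "2 \<le> first_divisor d"
proof -
  define l where "l = first_divisor d"
  have "d \<noteq> 0" "d \<noteq> 1" using assms by (intro notI; simp)+
  then have d: "1 < d" by linarith
  note l = first_divisor[OF d, folded l_def]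
  obtain E where E: "d = l * E" using l(2) by blast
  have E0: "E \<noteq> 0" using E d by (intro notI) simp
  have "prime_factorization d = prime_factorization l + prime_factorization E"
    unfolding E using l E0 by (intro prime_factorization_mult) auto
  then have size: "2 \<le> size (prime_factorization E)"
    using assms l(4) by (simp add: prime_factorization_prime)
  have "E \<noteq> 1" using size by (intro notI) simp
  then obtain p where p: "Factorial_Ring.prime p" "p dvd E" using prime_factor_nat by blast
  obtain m where m: "E = p * m" using p(2) by blast
  have "m \<noteq> 1"
  proof
    assume "m = 1"
    then show False using size p(1) m by (simp add: prime_factorization_prime)
  qed
  then have "2 \<le> m" using m E0 by (cases m) auto
  moreover have "l \<le> p" using p l(3)[of p] E prime_gt_1_nat by simp
  ultimately have "2 * l \<le> E" using m mult_le_mono[of 2 m l p] by (simp add: mult.commute)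
  then show ?thesis using that E l(1) unfolding l_def by simp
qed

text \<open>
  With \<open>e = 1 + a\<close> and \<open>E = e + 2 + b\<close> the claim becomes a polynomial inequality in \<open>a\<close>, \<open>b\<close> and \<open>l\<close>,
  which reduces by \<open>2 l \<le> E\<close> to one in \<open>a\<close> and \<open>b\<close> in which all coefficients of the difference are
  nonnegative.  The case \<open>e = E - 1\<close> does not occur: then \<open>e\<close> would divide \<open>l E - l e = l\<close>, which is too
  small.
\<close>

lemma exponent_gap:
  assumes l: "2 \<le> l" "2 * l \<le> E" and e: "e dvd l * E" "0 < e" "e < E"
  shows "l * E div e + card (mons 2 e) + E \<le> card (mons 2 E) + l"
proof -
  obtain k where k: "l * E = e * k" using e(1) by blast
  have kdiv: "l * E div e = k" using k e(2) by simp
  have "e \<noteq> E - 1"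
  proof
    assume eq: "e = E - 1"
    have "E = e + 1" using eq e by simp
    then have "l * E = l * e + l" by simp
    then have "e dvd l" using e(1) by (metis dvd_add_right_iff dvd_triv_right)
    then have "e \<le> l" using l by (intro dvd_imp_le) auto
    then show False using eq l by linarith
  qed
  then have "2 \<le> E - e" using e by linarith
  then obtain b where b: "E = e + (2 + b)" by (metis le_Suc_ex le_add_diff_inverse less_imp_le e(3))
  obtain a where a: "e = 1 + a" using e(2) by (metis Suc_eq_plus1_left gr0_implies_Suc)
  have E': "E = 3 + a + b" using a b by simp
  have key: "E * (2 + b) + 2 * (e * E) \<le> e * (2 + b) * (E + e + 3)"
    unfolding a E' by (simp add: algebra_simps)
  have "2 * l * (2 + b) \<le> E * (2 + b)" using l(2) by (rule mult_le_mono1)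
  with key have main: "2 * l * (2 + b) + 2 * (e * E) \<le> e * (2 + b) * (E + e + 3)" by linarith
  have "2 * (e * k) = 2 * l * e + 2 * l * (2 + b)" unfolding k[symmetric] b by (simp add: algebra_simps)
  moreover have "(E + 1) * (E + 2) = (e + 1) * (e + 2) + (2 + b) * (E + e + 3)" unfolding b by (simp add: algebra_simps)
  then have "e * ((E + 1) * (E + 2)) = e * ((e + 1) * (e + 2)) + e * (2 + b) * (E + e + 3)"
    by (metis distrib_left mult.assoc)
  ultimately have "2 * (e * k) + e * ((e + 1) * (e + 2)) + 2 * (e * E) \<le> e * ((E + 1) * (E + 2)) + 2 * l * e"
    using main by linarith
  then have "e * (2 * k + (e + 1) * (e + 2) + 2 * E) \<le> e * ((E + 1) * (E + 2) + 2 * l)"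
    by (simp only: distrib_left mult_ac)
  then have "2 * k + (e + 1) * (e + 2) + 2 * E \<le> (E + 1) * (E + 2) + 2 * l" using e(2) by simp
  then show ?thesis unfolding kdiv using card_mons_2[of e] card_mons_2[of E] by linarith
qed

context counted_field
begin

text \<open>
  Write \<open>d = l E\<close> with \<open>l\<close> the first divisor.  All proper divisors of \<open>d\<close> are at most \<open>E\<close>, so \<open>D\<^sub>d\<close> is
  \<open>q ^ (l - 1) I\<^sub>E\<close> plus a remainder \<open>R\<close> over the smaller divisors.  In units of \<open>T = q ^ (l - 1 + s E)\<close>, the
  remainder is at most \<open>(E - 1) / q ^ E\<close>.  Replacing \<open>I\<^sub>E\<close> by \<open>q ^ s E\<close> costs at most \<open>E / q ^ E\<close>, and
  replacing \<open>N\<^sub>d\<close> by \<open>q ^ s d\<close> costs a relative error \<open>1 / q ^ (d + 1)\<close>.  The slack between \<open>E\<close> and \<open>d\<close> in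
  \<open>\<beta>\<^sub>d = d / q ^ E\<close> absorbs all of this.
\<close>

theorem error_term:
  assumes n2: "n = 2" and d3: "3 \<le> size (prime_factorization d)"
  shows "\<bar>real (D d) / real (N d) - alpha q d\<bar> \<le> alpha q d * beta q d"
proof -
  define l where "l = first_divisor d"
  obtain E where E: "d = l * E" "2 * l \<le> E" "2 \<le> l"
    using cofactor_of_first_divisor[OF d3] unfolding l_def by blast
  have d: "0 < d" "1 < d" "E < d" "E > 0" "d div E = l" "d div l = E" "2 * E \<le> d" "E dvd d"
  proof -
    have "E > 0" using E by simp
    moreover have "2 * E \<le> d" using mult_le_mono1[OF E(3), of E] E(1) by simp
    ultimately show "0 < d" "1 < d" "E < d" "E > 0" "2 * E \<le> d" by linarith+
    then show "d div E = l" "d div l = E" "E dvd d" using E by simp_all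
  qed
  have s2: "s x = (x + 1) * (x + 2) div 2" for x using card_mons_2[of x] n2 by simp
  define Q where "Q = real q"
  have Q: "2 \<le> Q" using q_ge_2 by (simp add: Q_def)
  define T where "T = Q ^ (l - 1 + s E)"
  define y where "y = inverse (Q ^ E)"
  have pos: "T > 0" "y > 0" "Q ^ s d > 0" using Q by (simp_all add: T_def y_def)
  have alpha: "alpha q d = T / Q ^ s d"
    using d(6) by (simp add: alpha_def Let_def l_def[symmetric] T_def Q_def s2)
  have beta: "beta q d = real d * y"
    using d(6) by (simp add: beta_def l_def[symmetric] y_def Q_def field_simps)
  \<comment> \<open>Against the main term, every smaller divisor loses a factor \<open>q ^ E\<close>.\<close>
  have gap: "(d div e - 1) + s e + E \<le> l - 1 + s E" if "e dvd d" "0 < e" "e < E" for e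
  proof -
    have "d div e + s e + E \<le> s E + l" using exponent_gap[OF E(3,2), of e] that E(1) n2 by simp
    moreover have "1 \<le> d div e" using that d by (simp add: div_greater_zero_iff Suc_le_eq dvd_imp_le)
    ultimately show ?thesis using E(3) by linarith
  qed
  define R where "R = (\<Sum>e | e dvd d \<and> e < E. q ^ (d div e - 1) * I e)"
  have "{e. e dvd d \<and> e < d} = insert E {e. e dvd d \<and> e < E}"
  proof (intro equalityI subsetI)
    fix e assume e: "e \<in> {e. e dvd d \<and> e < d}"
    then obtain k where k: "d = e * k" by blast
    have "k \<noteq> 0" using k d(1) by (intro notI) simp
    moreover have "k \<noteq> 1" using k e by (intro notI) simp
    ultimately have "1 < k" by linarith
    moreover have "k dvd d" using k by simp
    ultimately have "l \<le> k" using first_divisor(3)[OF d(2)] by (simp add: l_def)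
    then have "l * e \<le> l * E" using k E(1) by (metis mult.commute mult_le_mono1)
    then have "e \<le> E" using E(3) by simp
    then show "e \<in> insert E {e. e dvd d \<and> e < E}" using e by auto
  qed (use d in auto)
  then have D_eq: "D d = q ^ (l - 1) * I E + R"
    unfolding formulas(3)[OF d(1)] R_def using proper_divisors(1)[OF d(1), of E] d(5) by simp
  have "R * q ^ E \<le> card {e. e dvd d \<and> e < E} * q ^ (l - 1 + s E)"
    unfolding R_def
  proof (rule weighted_sum_le)
    show "finite {e. e dvd d \<and> e < E}" by (rule proper_divisors(1)[OF d(1)])
    fix e assume e: "e \<in> {e. e dvd d \<and> e < E}"
    then show "0 < e" by (rule proper_divisors(2)[OF d(1)])
    with e show "(d div e - 1) + s e + E \<le> l - 1 + s E" using gap[of e] by blast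
  qed
  also have "\<dots> \<le> (E - 1) * q ^ (l - 1 + s E)" using proper_divisors(3)[OF d(1,4)] by (rule mult_le_mono1)
  finally have "real (R * q ^ E) \<le> real ((E - 1) * q ^ (l - 1 + s E))" by (rule of_nat_mono)
  then have R: "real R \<le> (real E - 1) * T * y"
    using d(4) Q by (simp add: T_def y_def Q_def of_nat_diff field_simps)
  have "D E * q ^ E \<le> (E - 1) * q ^ s E"
  proof (rule D_upper[OF d(4)])
    fix e assume e: "e dvd E" "0 < e" "e < E"
    then obtain k where k: "E = e * k" by blast
    then have kk: "E div e = k" "d div e = l * k" "1 \<le> k" using e E(1) d(4) by auto
    have "l * k = k + (l - 1) * k" using E(3) by (metis Suc_diff_1 add.commute less_le_trans mult_Suc pos2 add_0)
    moreover have "l - 1 \<le> (l - 1) * k" using kk(3) by simp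
    moreover have "(d div e - 1) + s e + E \<le> l - 1 + s E" using gap[of e] e d(8) dvd_trans by blast
    ultimately show "(E div e - 1) + s e + E \<le> s E" using kk by linarith
  qed
  then have "real (D E * q ^ E) \<le> real ((E - 1) * q ^ s E)" by (rule of_nat_mono)
  then have DE: "real (D E) \<le> (real E - 1) * Q ^ s E * y"
    using d(4) Q by (simp add: y_def Q_def of_nat_diff field_simps)
  have T_eq: "T = Q ^ (l - 1) * Q ^ s E" by (simp add: T_def power_add)
  have Npos: "real (N d) > 0"
  proof -
    have "q ^ s d > 0" using q_ge_2 by simp
    then show ?thesis using N_ge[OF d(1)] by linarith
  qed
  have N_le: "real (N d) \<le> Q ^ s d"
    using N_add[OF d(1)] unfolding Q_def by (metis le_add1 of_nat_le_iff of_nat_power)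
  have upper: "real (D d) / real (N d) \<le> T / Q ^ s d * (1 + real d * y)"
  proof -
    have "real (I E) \<le> Q ^ s E" using I_le(1)[OF d(4)] unfolding Q_def by (metis of_nat_le_iff of_nat_power)
    then have "Q ^ (l - 1) * real (I E) \<le> T" unfolding T_eq using Q by (intro mult_left_mono) auto
    then have 1: "real (D d) \<le> T * (1 + (real E - 1) * y)"
      using R by (simp add: D_eq Q_def algebra_simps)
    define z where "z = inverse (Q ^ (d + 1))"
    have "Q ^ s (d - 1) * Q ^ (d + 1) = Q ^ s d"
      using card_mons_step[OF d(1), of 2] card_mons_eq_2[of d] n2 by (simp flip: power_add)
    then have "Q ^ s (d - 1) = Q ^ s d * z" using Q by (simp add: z_def field_simps)
    moreover have "real (N d) + Q ^ s (d - 1) = Q ^ s d"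
      using N_add[OF d(1)] unfolding Q_def by (metis of_nat_add of_nat_power)
    ultimately have N_eq: "real (N d) = Q ^ s d * (1 - z)" by (simp add: algebra_simps)
    have "z \<le> y" unfolding z_def y_def using Q d(3) by (intro le_imp_inverse_le power_increasing) auto
    \<comment> \<open>The product of the two relative errors, \<open>d * z * y\<close>, is at most \<open>y\<close>.\<close>
    have "d \<le> 2 ^ (d + 1)" using less_exp[of "d + 1"] by linarith
    then have "real d \<le> 2 ^ (d + 1)" by (metis of_nat_le_iff of_nat_numeral of_nat_power)
    also have "\<dots> \<le> Q ^ (d + 1)" using Q by (intro power_mono) auto
    finally have "real d * z \<le> 1" using Q by (simp add: z_def field_simps)
    then have "real d * z * y \<le> y" using pos(2) by (simp add: mult_left_le_one_le mult_le_cancel_right1)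
    moreover have "(real E + 1) * y \<le> real d * y" using d(3) pos(2) by (intro mult_right_mono) auto
    ultimately have "1 + (real E - 1) * y \<le> (1 + real d * y) * (1 - z)"
      using \<open>z \<le> y\<close> by (simp add: algebra_simps)
    then have "real (D d) \<le> T * ((1 + real d * y) * (1 - z))" using 1 pos(1) by (meson less_imp_le mult_left_mono order_trans)
    also have "\<dots> = T / Q ^ s d * (1 + real d * y) * real (N d)" using pos(3) Q by (simp add: N_eq)
    finally show ?thesis using Npos by (simp add: pos_divide_le_eq)
  qed
  have lower: "T / Q ^ s d * (1 - real d * y) \<le> real (D d) / real (N d)"
  proof -
    have "Q ^ s (E - 1) * Q ^ (E + 1) = Q ^ s E"
      using card_mons_step[OF d(4), of 2] card_mons_eq_2[of E] n2 by (simp flip: power_add)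
    then have "Q ^ s (E - 1) = Q ^ s E * (y / Q)" using Q by (simp add: y_def field_simps)
    also have "\<dots> \<le> Q ^ s E * y" using Q pos(2) by (intro mult_left_mono) (auto simp: field_simps)
    finally have 1: "Q ^ s (E - 1) \<le> Q ^ s E * y" .
    have "real (N E) + Q ^ s (E - 1) = Q ^ s E"
      using N_add[OF d(4)] unfolding Q_def by (metis of_nat_add of_nat_power)
    moreover have "real (I E) + real (D E) = real (N E)" using formulas(2)[OF d(4)] by (metis of_nat_add)
    ultimately have "Q ^ s E * (1 - real E * y) \<le> real (I E)" using 1 DE by (simp add: algebra_simps)
    moreover have "Q ^ s E * (1 - real d * y) \<le> Q ^ s E * (1 - real E * y)"
      using Q pos(2) d(3) by (intro mult_left_mono) auto
    ultimately have "Q ^ s E * (1 - real d * y) \<le> real (I E)" by linarith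
    then have "Q ^ (l - 1) * (Q ^ s E * (1 - real d * y)) \<le> Q ^ (l - 1) * real (I E)"
      using Q by (intro mult_left_mono) auto
    then have "T * (1 - real d * y) \<le> real (D d)"
      by (simp add: T_eq D_eq Q_def mult.assoc)
    then have "T * (1 - real d * y) / Q ^ s d \<le> real (D d) / Q ^ s d"
      using pos(3) by (simp add: divide_right_mono)
    also have "\<dots> \<le> real (D d) / real (N d)" using N_le Npos by (intro divide_left_mono) auto
    finally show ?thesis by simp
  qed
  show ?thesis using upper lower
    unfolding alpha beta abs_le_iff distrib_left right_diff_distrib mult_1_right by linarith
qed

end

section \<open>The counting theorem\<close>

theorem theorem5p1:
  fixes n q :: nat and K :: "'a ring"
  assumes "2 \<le> n" and "primepow q" and "field K" and "order K = q"
  shows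
    "((\<lambda>d. real (num_indecomposable K n d) / real (num_polys K n d)) \<longlonglongrightarrow> 1) \<and>
     (\<forall>d\<ge>1. ((\<lambda>L :: 'a ring. real (num_indecomposable L n d) / real (num_polys L n d))
        \<longlongrightarrow> 1) finite_fields_at_top) \<and>
     (\<forall>d. size (prime_factorization d) \<in> {1, 2} \<longrightarrow>
        (\<exists>p. Factorial_Ring.prime p \<and> d = p \<and>
           int (num_decomposable K n d) = int q ^ d * (int q ^ n - 1)) \<or>
        (\<exists>p. Factorial_Ring.prime p \<and> d = p ^ 2 \<and>
           int (num_decomposable K n d) =
             int q ^ (p - 1) * int (num_polys K n p)
             + (int q ^ d - int q ^ (2 * p - 1)) * (int q ^ n - 1)) \<or>
        (\<exists>p p'. Factorial_Ring.prime p \<and> Factorial_Ring.prime p' \<and> p < p' \<and> d = p * p' \<and>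
           int (num_decomposable K n d) =
             int q ^ (p - 1) * int (num_polys K n p')
             + int q ^ (p' - 1) * int (num_polys K n p)
             + (int q ^ d - 2 * int q ^ (p + p' - 1)) * (int q ^ n - 1))) \<and>
     (n = 2 \<longrightarrow> (\<forall>d. 3 \<le> size (prime_factorization d) \<longrightarrow>
        \<bar>real (num_decomposable K n d) / real (num_polys K n d) - alpha q d\<bar>
          \<le> alpha q d * beta q d))"
proof (intro conjI allI impI)
  have "q > 0" using assms(2) by (rule primepow_gt_0_nat)
  then have "finite (carrier K)" using assms(4) by (auto simp: Coset.order_def intro: card_ge_0_finite)
  then interpret counted_field K n q using assms by (intro counted_field.intro)
  show "(\<lambda>d. real (num_indecomposable K n d) / real (num_polys K n d)) \<longlonglongrightarrow> 1" by (rule ratio_tendsto_1)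
  show "\<bar>real (num_decomposable K n d) / real (num_polys K n d) - alpha q d\<bar> \<le> alpha q d * beta q d"
    if "n = 2" "3 \<le> size (prime_factorization d)" for d :: nat using that by (rule error_term)
  fix d :: nat assume "size (prime_factorization d) \<in> {1, 2}"
  from at_most_two_primes[OF this] show "(\<exists>p. Factorial_Ring.prime p \<and> d = p \<and>
           int (num_decomposable K n d) = int q ^ d * (int q ^ n - 1)) \<or>
        (\<exists>p. Factorial_Ring.prime p \<and> d = p ^ 2 \<and>
           int (num_decomposable K n d) =
             int q ^ (p - 1) * int (num_polys K n p)
             + (int q ^ d - int q ^ (2 * p - 1)) * (int q ^ n - 1)) \<or>
        (\<exists>p p'. Factorial_Ring.prime p \<and> Factorial_Ring.prime p' \<and> p < p' \<and> d = p * p' \<and>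
           int (num_decomposable K n d) =
             int q ^ (p - 1) * int (num_polys K n p')
             + int q ^ (p' - 1) * int (num_polys K n p)
             + (int q ^ d - 2 * int q ^ (p + p' - 1)) * (int q ^ n - 1))" .
next
  fix d :: nat assume d: "1 \<le> d"
  let ?F = "finite_fields_at_top :: 'a ring filter"
  have fields: "\<forall>\<^sub>F L in ?F. field L \<and> finite (carrier L)"
    unfolding finite_fields_at_top_def by (rule filter_leD[OF inf_le2]) (simp add: eventually_principal)
  have "filterlim (order :: 'a ring \<Rightarrow> nat) at_top ?F"
    unfolding finite_fields_at_top_def by (rule filterlim_mono[OF filterlim_filtercomap order_refl inf_le1])
  then have "filterlim (\<lambda>L :: 'a ring. real (order L)) at_top ?F"
    by (rule filterlim_compose[OF filterlim_real_sequentially])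
  then have "filterlim (\<lambda>L :: 'a ring. real (order L) ^ 2) at_top ?F"
    by (rule filterlim_pow_at_top[rotated]) simp
  then have lim: "((\<lambda>L :: 'a ring. 2 * real d / real (order L) ^ 2) \<longlongrightarrow> 0) ?F"
    by (rule real_tendsto_divide_at_top[OF tendsto_const])
  have "((\<lambda>L :: 'a ring. real (num_indecomposable L n d) / real (num_polys L n d) - 1) \<longlongrightarrow> 0) ?F"
  proof (rule tendsto_0_le[OF lim, where K = 1])
    show "\<forall>\<^sub>F L in ?F. norm (real (num_indecomposable L n d) / real (num_polys L n d) - 1)
        \<le> norm (2 * real d / real (order L) ^ 2) * 1"
      using fields
    proof eventually_elim
      case (elim L)
      then interpret counted_field L n "order L" using assms(1) by (intro counted_field.intro) simp_all
      show ?case using ratio_bound_2[of d] d by simp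
    qed
  qed
  then show "((\<lambda>L :: 'a ring. real (num_indecomposable L n d) / real (num_polys L n d)) \<longlongrightarrow> 1) ?F"
    by (rule LIM_zero_cancel)
qed

end
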